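(* Let $R_1^D(z)=\sum_j (z-\lambda_j)_+$ be the first Riesz-mean of the eigenvalues $\lambda_j$ (counted with multiplicity) of the Dirichlet Laplacian on the hemisphere $\mathbb{S}^2_+$. For all $z\geq 0$ the following bounds hold: $$ \frac14 z^2-\frac13 z\sqrt{z+\frac14}\leq R_1^D(z)\leq \frac14 z^2-\frac13 z\sqrt{z+\frac14}+\frac14 z . $$ Moreover, equality in the lower bound occurs if and only if $z=\lambda_{(l)}$ for some $l\in\mathbb{N}\setminus\{0\}$, where $\lambda_{(l)}=l(l+1)$.
   Context: $\mathbb{S}^2_+=\mathbb{S}^2\cap\{x_3>0\}$ is the open hemisphere of the round unit sphere $\mathbb{S}^2\subset\mathbb{R}^3$. The distinct eigenvalues (energy levels) of the Dirichlet Laplacian $-\Delta$ on $\mathbb{S}^2_+$ (zero boundary condition on the equator) are $\lambda_{(l)}=l(l+1)$, $l\in\mathbb{N}\setminus\{0\}$, with multiplicity $l$; thus $R_1^D(z)=\sum_{l\ge1} l\,(z-l(l+1))_+$. Here $a_+=\max(a,0)$ denotes the positive part of a real number $a$, and $\mathbb{N}$ denotes the set of natural numbers including zero.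
   Formalization: The equality case is corrected to "z = 0 or z = l(l+1) for some l ≥ 1", because at z = 0 both the lower bound and the Riesz mean equal 0 although 0 is not an eigenvalue. *)

theory Defs
  imports "HOL-Analysis.Analysis" "HOL-Library.Function_Algebras"
begin

definition partial :: "3 \<Rightarrow> (real^3 \<Rightarrow> real) \<Rightarrow> real^3 \<Rightarrow> real" where
  "partial i f x = frechet_derivative f (at x) (axis i 1)"

(* Only used for open sets S. *)
definition C1_on :: "(real^3) set \<Rightarrow> (real^3 \<Rightarrow> real) \<Rightarrow> bool" where
  "C1_on S f \<longleftrightarrow> f differentiable_on S \<and> (\<forall>i. continuous_on S (partial i f))"

definition C2_on :: "(real^3) set \<Rightarrow> (real^3 \<Rightarrow> real) \<Rightarrow> bool" where
  "C2_on S f \<longleftrightarrow> C1_on S f \<and> (\<forall>i. C1_on S (partial i f))"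

definition laplacian :: "(real^3 \<Rightarrow> real) \<Rightarrow> real^3 \<Rightarrow> real" where
  "laplacian f x = (\<Sum>i\<in>UNIV. partial i (partial i f) x)"

definition hemisphere :: "(real^3) set" where
  "hemisphere = {x. norm x = 1 \<and> x $ 3 > 0}"

definition closed_hemisphere :: "(real^3) set" where
  "closed_hemisphere = {x. norm x = 1 \<and> x $ 3 \<ge> 0}"

definition equator :: "(real^3) set" where
  "equator = {x. norm x = 1 \<and> x $ 3 = 0}"

definition radial_extension :: "(real^3 \<Rightarrow> real) \<Rightarrow> real^3 \<Rightarrow> real" where
  "radial_extension u y = u (y /\<^sub>R norm y)"

(* The Laplace-Beltrami operator of the round unit sphere is the restriction to the sphere
   of the Euclidean Laplacian of the extension that is constant along rays: at a unit vector x
   the radial derivatives of the extension vanish, and its second derivative along a straight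
   line through x in a unit tangent direction is the second derivative of u along the geodesic
   with that initial velocity. *)
definition sphere_laplacian :: "(real^3 \<Rightarrow> real) \<Rightarrow> real^3 \<Rightarrow> real" where
  "sphere_laplacian u x = laplacian (radial_extension u) x"

(* u is C^2 on the open hemisphere iff its radial extension is C^2 on the open half-space,
   the cone over the hemisphere. *)
definition C2_on_hemisphere :: "(real^3 \<Rightarrow> real) \<Rightarrow> bool" where
  "C2_on_hemisphere u \<longleftrightarrow> C2_on {y. y $ 3 > 0} (radial_extension u)"

(* Classical solutions, the zero function included. The last condition makes each function on
   the closed hemisphere correspond to a single total function, so that dimensions are those of
   the function space on the hemisphere. *)
definition dirichlet_eigenspace :: "real \<Rightarrow> (real^3 \<Rightarrow> real) set" where
  "dirichlet_eigenspace \<mu> = {u.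
     C2_on_hemisphere u \<and>
     continuous_on closed_hemisphere u \<and>
     (\<forall>x\<in>hemisphere. - sphere_laplacian u x = \<mu> * u x) \<and>
     (\<forall>x\<in>equator. u x = 0) \<and>
     (\<forall>x. x \<notin> closed_hemisphere \<longrightarrow> u x = 0)}"

definition dirichlet_eigenvalues :: "real set" where
  "dirichlet_eigenvalues = {\<mu>. \<exists>u\<in>dirichlet_eigenspace \<mu>. \<exists>x. u x \<noteq> 0}"

lemma vector_space_real_functions:
  "vector_space (\<lambda>(c::real) (f::'a \<Rightarrow> real) x. c * f x)"
  by unfold_locales (auto simp: fun_eq_iff algebra_simps)

(* The dimension of a space without a finite basis is 0 by library convention; since all
   eigenspaces here are finite-dimensional, this is never relevant. *)
definition multiplicity_of :: "real \<Rightarrow> nat" where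
  "multiplicity_of \<mu> =
     vector_space.dim (\<lambda>(c::real) (f::real^3 \<Rightarrow> real) x. c * f x) (dirichlet_eigenspace \<mu>)"

definition riesz_mean_1 :: "real \<Rightarrow> real" where
  "riesz_mean_1 z =
     (\<Sum>\<^sub>\<infinity>\<mu>\<in>dirichlet_eigenvalues. real (multiplicity_of \<mu>) * max (z - \<mu>) 0)"

end

theory Submission
  imports Defs
begin

text \<open>The bounds are elementary once the spectrum is known, so most of the work is the proof that the
Dirichlet eigenvalues of the hemisphere are exactly the numbers \<open>l (l + 1)\<close> with
\<open>l \<ge> 1\<close>, the eigenspace of \<open>l (l + 1)\<close> having dimension \<open>l\<close>.

To bound the spectrum from above, let \<open>u\<close> be an eigenfunction for \<open>\<mu>\<close> and \<open>w\<close> its extension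
constant along rays, so that \<open>\<Delta>w = - \<mu> w / |y|\<^sup>2\<close> on the upper half-space and \<open>w = 0\<close> on its boundary.
With \<open>\<omega> = y\<^sub>1 + \<i> y\<^sub>2\<close>, test \<open>w\<close> against \<open>Re (c \<omega>\<^sup>m) y\<^sub>3\<^sup>k\<close> times a function of \<open>|y|\<close>. This polynomial
is homogeneous of degree \<open>d = m + k\<close> and its Laplacian is \<open>k (k - 1) Re (c \<omega>\<^sup>m) y\<^sub>3\<^bsup>k-2\<^esup>\<close>, so Green's
identity becomes a relation between two moments of \<open>w\<close> (lemma \<open>moment_recursion\<close>):
\<open>(\<mu> - d (d + 1)) M\<^sub>k + k (k - 1) M\<^bsub>k-2\<^esub> = 0\<close>. Starting from \<open>k = 1\<close>, all odd moments with
\<open>d (d + 1) \<noteq> \<mu>\<close> are thereby determined by those with \<open>d (d + 1) = \<mu>\<close>. On the other hand the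
functions \<open>Re (c \<omega>\<^sup>m) y\<^sub>3\<^sup>k\<close> with \<open>k\<close> odd are complete by the Stone-Weierstrass theorem
(\<open>eigenfunction_eq_0_if_moments_0\<close>). Hence a nonzero eigenfunction forces \<open>\<mu> = l (l + 1)\<close>, and it is
determined by its moments with \<open>m + k = l\<close> and \<open>k\<close> odd. There are \<open>l\<close> of these, counting the real
and the imaginary part of \<open>\<omega>\<^sup>m\<close> for \<open>m > 0\<close>.

Two devices keep the analysis elementary. Integrals over the hemisphere are replaced by Lebesgue
integrals over a solid shell, and the only integral theorem used is that the partial derivatives of
a compactly supported function have integral zero, which is translation invariance of Lebesgue
measure. Since \<open>u\<close> is merely continuous up to the equator, test functions are first cut off near
the plane \<open>y\<^sub>3 = 0\<close>; the error tends to zero because \<open>w\<close> does.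

Conversely, for each of the \<open>l\<close> angular factors there is an odd polynomial \<open>F\<close>,
given by a terminating power series, for which \<open>Re (c \<omega>\<^sup>m) F(y\<^sub>3)\<close> is an eigenfunction
(\<open>harmonic_in_eigenspace\<close>). These are independent because, on a suitable circle of latitude, they
restrict to nonzero multiples of distinct trigonometric functions.

As to the bounds themselves, for \<open>L (L + 1) \<le> z \<le> (L + 1) (L + 2)\<close> the Riesz mean is a finite sum and affine in
\<open>z\<close>. Writing \<open>sqrt (z + 1/4) = L + 1/2 + x\<close> with \<open>0 \<le> x \<le> 1\<close>, its difference to
\<open>z\<^sup>2/4 - z sqrt (z + 1/4) / 3\<close> factors as \<open>x (1 - x) Q\<close> with \<open>Q > 0\<close>
(\<open>riesz_mean_1_deviation\<close>). The lower bound and its equality case \<open>x \<in> {0, 1}\<close> can be read off, and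
the upper bound is the polynomial inequality \<open>x (1 - x) Q \<le> z/4\<close>.\<close>

section \<open>Partial derivatives and the Laplacian\<close>

lemma partial_eqI:
  assumes "(f has_derivative f') (at x)"
  shows "partial i f x = f' (axis i 1)"
  using frechet_derivative_at[OF assms] by (simp add: partial_def)

lemma frechet_derivative_eq_sum_partial:
  assumes "f differentiable (at x)"
  shows "frechet_derivative f (at x) h = (\<Sum>i\<in>UNIV. h $ i * partial i f x)"
proof -
  have lin: "linear (frechet_derivative f (at x))"
    using assms by (rule linear_frechet_derivative)
  have "h = (\<Sum>i\<in>UNIV. (h $ i) *\<^sub>R axis i 1)"
    by (metis (no_types, lifting) basis_expansion scalar_mult_eq_scaleR sum.cong)
  then have "frechet_derivative f (at x) h = frechet_derivative f (at x) (\<Sum>i\<in>UNIV. (h $ i) *\<^sub>R axis i 1)"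
    by simp
  also have "\<dots> = (\<Sum>i\<in>UNIV. h $ i * partial i f x)"
    using lin by (simp add: linear_sum linear_cmul partial_def)
  finally show ?thesis .
qed

lemma has_derivative_partial:
  assumes "f differentiable (at x)"
  shows "(f has_derivative (\<lambda>h. \<Sum>i\<in>UNIV. h $ i * partial i f x)) (at x)"
proof -
  have "frechet_derivative f (at x) = (\<lambda>h. \<Sum>i\<in>UNIV. h $ i * partial i f x)"
    using frechet_derivative_eq_sum_partial[OF assms] by (rule ext)
  then show ?thesis using assms frechet_derivative_works by metis
qed

lemma partial_cong:
  assumes "open S" "x \<in> S" "\<And>y. y \<in> S \<Longrightarrow> f y = g y"
  shows "partial i f x = partial i g x"
proof -
  have "(f has_derivative f') (at x) \<longleftrightarrow> (g has_derivative f') (at x)" for f'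
    using assms has_derivative_transform_within_open[of f f' x UNIV S g]
      has_derivative_transform_within_open[of g f' x UNIV S f] by auto
  then show ?thesis by (simp add: partial_def frechet_derivative_def)
qed

lemma C1_onD:
  assumes "C1_on S f" "open S"
  shows "x \<in> S \<Longrightarrow> f differentiable (at x)" "continuous_on S f"
    "continuous_on S (partial i f)"
  using assms differentiable_on_eq_differentiable_at[of S f] differentiable_imp_continuous_on[of f S]
  by (auto simp: C1_on_def)

text \<open>Differentiability and the partial derivatives are established together, since a candidate gradient
is what one computes in practice; the variant \<open>C2_onI\<close> below works in the same way.\<close>
lemma C1_onI:
  assumes "open S" "\<And>x. x \<in> S \<Longrightarrow> (f has_derivative (\<lambda>h. \<Sum>i\<in>UNIV. h $ i * g i x)) (at x)"
    "\<And>i. continuous_on S (g i)"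
  shows "C1_on S f" and "x \<in> S \<Longrightarrow> partial i f x = g i x"
proof -
  have p: "partial i f x = g i x" if "x \<in> S" for x i
    using partial_eqI[OF assms(2)[OF that]] exhaust_3[of i] by (auto simp: axis_def sum_3)
  show "C1_on S f"
    unfolding C1_on_def
  proof
    show "f differentiable_on S"
      using assms(1,2) differentiable_on_eq_differentiable_at differentiableI by blast
    show "\<forall>i. continuous_on S (partial i f)"
      using p assms(3) by (metis continuous_on_eq)
  qed
  show "x \<in> S \<Longrightarrow> partial i f x = g i x" using p by blast
qed

lemma C1_on_cong:
  assumes "open S" "C1_on S f" "\<And>y. y \<in> S \<Longrightarrow> f y = g y"
  shows "C1_on S g"
proof -
  have "partial i f x = partial i g x" if "x \<in> S" for x i
    using assms that partial_cong by metis
  then have "\<forall>i. continuous_on S (partial i g)"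
    using assms by (metis C1_onD(3) continuous_on_eq)
  moreover have "g differentiable_on S"
    using assms unfolding C1_on_def by (metis differentiable_on_def differentiable_transform_within zero_less_one)
  ultimately show ?thesis by (simp add: C1_on_def)
qed

lemma C2_onD:
  assumes "C2_on S f"
  shows "C1_on S f" "C1_on S (partial i f)"
  using assms by (auto simp: C2_on_def)

lemma C2_onI:
  assumes "open S" "\<And>x. x \<in> S \<Longrightarrow> (f has_derivative (\<lambda>h. \<Sum>i\<in>UNIV. h $ i * g i x)) (at x)"
    "\<And>i. C1_on S (g i)"
  shows "C2_on S f" and "x \<in> S \<Longrightarrow> partial i f x = g i x"
    and "x \<in> S \<Longrightarrow> partial j (partial i f) x = partial j (g i) x"
proof -
  have c: "continuous_on S (g i)" for i using assms C1_onD by blast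
  note I = C1_onI[OF assms(1,2) c]
  have "C1_on S (partial i f)" for i
    using C1_on_cong[OF assms(1) assms(3)[of i]] I(2) by metis
  then show "C2_on S f" using I(1) by (auto simp: C2_on_def)
  show "x \<in> S \<Longrightarrow> partial i f x = g i x" by (rule I(2))
  show "x \<in> S \<Longrightarrow> partial j (partial i f) x = partial j (g i) x"
    using partial_cong[OF assms(1)] I(2) by metis
qed

lemma C2_on_cong:
  assumes "open S" "C2_on S f" "\<And>y. y \<in> S \<Longrightarrow> f y = g y"
  shows "C2_on S g" "x \<in> S \<Longrightarrow> laplacian f x = laplacian g x"
proof -
  have p: "partial i f x = partial i g x" if "x \<in> S" for x i
    using assms that partial_cong by metis
  show "C2_on S g"
    using assms p C1_on_cong[OF assms(1)] unfolding C2_on_def by metis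
  show "x \<in> S \<Longrightarrow> laplacian f x = laplacian g x"
    unfolding laplacian_def using p partial_cong[OF assms(1)] by (metis (no_types, lifting) sum.cong)
qed

lemma C1_on_const: "open S \<Longrightarrow> C1_on S (\<lambda>y. c)"
  and partial_const: "partial i (\<lambda>y. c) x = 0"
proof -
  show "partial i (\<lambda>y. c) x = 0" using partial_eqI[OF has_derivative_const] by blast
  show "open S \<Longrightarrow> C1_on S (\<lambda>y. c)"
    by (rule C1_onI(1)[where g="\<lambda>_ _. 0"]) auto
qed

lemma C1_on_mult:
  assumes "open S" "C1_on S f" "C1_on S g"
  shows "C1_on S (\<lambda>y. f y * g y)"
    and "x \<in> S \<Longrightarrow> partial i (\<lambda>y. f y * g y) x = partial i f x * g x + f x * partial i g x"
proof -
  have d: "((\<lambda>y. f y * g y) has_derivative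
      (\<lambda>h. \<Sum>i\<in>UNIV. h $ i * (partial i f x * g x + f x * partial i g x))) (at x)" if "x \<in> S" for x
  proof -
    have "f differentiable (at x)" "g differentiable (at x)"
      using assms that C1_onD by blast+
    from has_derivative_mult[OF this[THEN has_derivative_partial]]
    show ?thesis by (rule has_derivative_eq_rhs)
        (simp add: fun_eq_iff sum_distrib_left sum_distrib_right sum.distrib algebra_simps)
  qed
  have c: "continuous_on S (\<lambda>x. partial i f x * g x + f x * partial i g x)" for i
    using assms by (intro continuous_intros) (auto intro: C1_onD)
  from C1_onI[OF assms(1) d c]
  show "C1_on S (\<lambda>y. f y * g y)"
    "x \<in> S \<Longrightarrow> partial i (\<lambda>y. f y * g y) x = partial i f x * g x + f x * partial i g x" by auto
qed

lemma C1_on_add: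
  assumes "open S" "C1_on S f" "C1_on S g"
  shows "C1_on S (\<lambda>y. f y + g y)"
    and "x \<in> S \<Longrightarrow> partial i (\<lambda>y. f y + g y) x = partial i f x + partial i g x"
proof -
  have d: "((\<lambda>y. f y + g y) has_derivative
      (\<lambda>h. \<Sum>i\<in>UNIV. h $ i * (partial i f x + partial i g x))) (at x)" if "x \<in> S" for x
  proof -
    have "f differentiable (at x)" "g differentiable (at x)"
      using assms that C1_onD by blast+
    from has_derivative_add[OF this[THEN has_derivative_partial]]
    show ?thesis by (rule has_derivative_eq_rhs)
        (simp add: fun_eq_iff sum.distrib algebra_simps)
  qed
  have c: "continuous_on S (\<lambda>x. partial i f x + partial i g x)" for i
    using assms by (intro continuous_intros) (auto intro: C1_onD)
  from C1_onI[OF assms(1) d c]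
  show "C1_on S (\<lambda>y. f y + g y)"
    "x \<in> S \<Longrightarrow> partial i (\<lambda>y. f y + g y) x = partial i f x + partial i g x" by auto
qed

lemma C2_on_const: "open S \<Longrightarrow> C2_on S (\<lambda>y. c)"
  and laplacian_const: "laplacian (\<lambda>y. c) x = 0"
proof -
  show "open S \<Longrightarrow> C2_on S (\<lambda>y. c)"
    by (rule C2_onI(1)[where g="\<lambda>_ _. 0"]) (auto intro: C1_on_const)
  have "partial i (\<lambda>y. c) = (\<lambda>_. 0)" for i by (rule ext) (rule partial_const)
  then show "laplacian (\<lambda>y. c) x = 0" by (simp add: laplacian_def partial_const)
qed

lemma C2_on_mult:
  assumes "open S" "C2_on S f" "C2_on S g"
  shows "C2_on S (\<lambda>y. f y * g y)"
    and "x \<in> S \<Longrightarrow> laplacian (\<lambda>y. f y * g y) x =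
      f x * laplacian g x + 2 * (\<Sum>i\<in>UNIV. partial i f x * partial i g x) + laplacian f x * g x"
proof -
  note a = assms C2_onD(1)[OF assms(2)] C2_onD(1)[OF assms(3)]
    C2_onD(2)[OF assms(2)] C2_onD(2)[OF assms(3)]
  have d: "((\<lambda>y. f y * g y) has_derivative
      (\<lambda>h. \<Sum>i\<in>UNIV. h $ i * (partial i f x * g x + f x * partial i g x))) (at x)" if "x \<in> S" for x
    using has_derivative_partial[OF C1_onD(1)[OF C1_on_mult(1)[OF a(1,4,5)] a(1) that]]
    by (simp only: C1_on_mult(2)[OF a(1,4,5) that])
  have c: "C1_on S (\<lambda>x. partial i f x * g x + f x * partial i g x)" for i
    using a by (intro C1_on_add C1_on_mult) auto
  note I = C2_onI[OF assms(1) d c]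
  show "C2_on S (\<lambda>y. f y * g y)" by (rule I(1))
  assume x: "x \<in> S"
  have "partial i (partial i (\<lambda>y. f y * g y)) x =
     f x * partial i (partial i g) x + 2 * (partial i f x * partial i g x) + partial i (partial i f) x * g x" for i
  proof -
    have c1: "C1_on S (\<lambda>x. partial i f x * g x)" "C1_on S (\<lambda>x. f x * partial i g x)"
      using a by (auto intro: C1_on_mult(1))
    have "partial i (partial i (\<lambda>y. f y * g y)) x
        = partial i (\<lambda>x. partial i f x * g x) x + partial i (\<lambda>x. f x * partial i g x) x"
      by (rule trans[OF I(3) C1_on_add(2)[OF a(1) c1 x]]) (use x in auto)
    also have "partial i (\<lambda>x. partial i f x * g x) x
        = partial i (partial i f) x * g x + partial i f x * partial i g x"
      by (rule C1_on_mult(2)[OF a(1,6,5) x])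
    also have "partial i (\<lambda>x. f x * partial i g x) x
        = partial i f x * partial i g x + f x * partial i (partial i g) x"
      by (rule C1_on_mult(2)[OF a(1,4,7) x])
    finally show ?thesis by simp
  qed
  then show "laplacian (\<lambda>y. f y * g y) x =
      f x * laplacian g x + 2 * (\<Sum>i\<in>UNIV. partial i f x * partial i g x) + laplacian f x * g x"
    by (simp add: laplacian_def sum.distrib sum_distrib_left sum_distrib_right)
qed

lemma C2_on_add:
  assumes "open S" "C2_on S f" "C2_on S g"
  shows "C2_on S (\<lambda>y. f y + g y)"
    and "x \<in> S \<Longrightarrow> laplacian (\<lambda>y. f y + g y) x = laplacian f x + laplacian g x"
proof -
  note a = assms C2_onD(1)[OF assms(2)] C2_onD(1)[OF assms(3)]
    C2_onD(2)[OF assms(2)] C2_onD(2)[OF assms(3)]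
  have d: "((\<lambda>y. f y + g y) has_derivative
      (\<lambda>h. \<Sum>i\<in>UNIV. h $ i * (partial i f x + partial i g x))) (at x)" if "x \<in> S" for x
    using has_derivative_partial[OF C1_onD(1)[OF C1_on_add(1)[OF a(1,4,5)] a(1) that]]
    by (simp only: C1_on_add(2)[OF a(1,4,5) that])
  have c: "C1_on S (\<lambda>x. partial i f x + partial i g x)" for i
    using a by (intro C1_on_add) auto
  note I = C2_onI[OF assms(1) d c]
  show "C2_on S (\<lambda>y. f y + g y)" by (rule I(1))
  assume x: "x \<in> S"
  have "partial i (partial i (\<lambda>y. f y + g y)) x = partial i (partial i f) x + partial i (partial i g) x" for i
    by (rule trans[OF I(3) C1_on_add(2)[OF a(1,6,7) x]]) (use x in auto)
  then show "laplacian (\<lambda>y. f y + g y) x = laplacian f x + laplacian g x"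
    by (simp add: laplacian_def sum.distrib)
qed

lemma C2_on_sum:
  assumes "open S" "finite J" "\<And>j. j \<in> J \<Longrightarrow> C2_on S (f j)"
  shows "C2_on S (\<lambda>y. \<Sum>j\<in>J. f j y) \<and> (\<forall>x\<in>S. laplacian (\<lambda>y. \<Sum>j\<in>J. f j y) x = (\<Sum>j\<in>J. laplacian (f j) x))"
  using assms(2,3)
proof (induction J rule: finite_induct)
  case empty
  then show ?case using assms(1) C2_on_const by (simp add: laplacian_const)
next
  case (insert j J)
  then show ?case using C2_on_add[OF assms(1), of "f j" "\<lambda>y. \<Sum>j\<in>J. f j y"] by simp
qed

text \<open>For \<open>c = 1\<close> and \<open>c = -\<i>\<close> these are the real and imaginary parts of \<open>(y\<^sub>1 + \<i> y\<^sub>2)\<^sup>m\<close>. Arbitrary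
complex \<open>c\<close> are admitted so that the family is closed under differentiation: differentiating only
lowers \<open>m\<close> and changes \<open>c\<close>.\<close>
definition planar :: "complex \<Rightarrow> nat \<Rightarrow> real^3 \<Rightarrow> real" where
  "planar c m y = Re (c * Complex (y $ 1) (y $ 2) ^ m)"

lemma planar_0 [simp]: "planar 0 m y = 0"
  and planar_minus: "planar (- c) m y = - planar c m y"
  by (simp_all add: planar_def)

lemma planar_imaginary: "planar (\<i> * c) m y = - Im (c * Complex (y $ 1) (y $ 2) ^ m)"
  unfolding planar_def by (simp only: mult.assoc Re_i_times)

lemma planar_has_derivative:
  "(planar c m has_derivative (\<lambda>h. \<Sum>i\<in>UNIV. h $ i *
     planar (if i = 1 then of_nat m * c else if i = 2 then \<i> * of_nat m * c else 0) (m - 1) y)) (at y)"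
proof -
  have l: "((\<lambda>y::real^3. Complex (y $ 1) (y $ 2)) has_derivative (\<lambda>h. Complex (h $ 1) (h $ 2))) (at y)"
  proof -
    have "linear (\<lambda>y::real^3. Complex (y $ 1) (y $ 2))"
      by (rule linearI) (auto simp: complex_eq_iff)
    then show ?thesis using linear_imp_has_derivative by blast
  qed
  have "((\<lambda>y. Re (c * Complex (y $ 1) (y $ 2) ^ m)) has_derivative
     (\<lambda>h. Re (c * (of_nat m * Complex (h $ 1) (h $ 2) * Complex (y $ 1) (y $ 2) ^ (m - 1))))) (at y)"
    by (rule has_derivative_Re has_derivative_mult_right has_derivative_power l)+
  then have "(planar c m has_derivative
     (\<lambda>h. Re (c * (of_nat m * Complex (h $ 1) (h $ 2) * Complex (y $ 1) (y $ 2) ^ (m - 1))))) (at y)"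
    by (simp add: planar_def[abs_def])
  moreover have "Re (c * (of_nat m * Complex (h $ 1) (h $ 2) * Complex (y $ 1) (y $ 2) ^ (m - 1))) =
     (\<Sum>i\<in>UNIV. h $ i *
       planar (if i = 1 then of_nat m * c else if i = 2 then \<i> * of_nat m * c else 0) (m - 1) y)" for h :: "real^3"
  proof -
    define X where "X = of_nat m * c * Complex (y $ 1) (y $ 2) ^ (m - 1)"
    have e: "c * (of_nat m * Complex (h $ 1) (h $ 2) * Complex (y $ 1) (y $ 2) ^ (m - 1)) = Complex (h $ 1) (h $ 2) * X"
      by (simp only: X_def mult.assoc mult.commute mult.left_commute)
    have p: "planar (of_nat m * c) (m - 1) y = Re X" "planar (\<i> * of_nat m * c) (m - 1) y = - Im X"
      by (simp only: planar_def X_def) (simp only: planar_imaginary X_def mult.assoc)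
    show ?thesis unfolding e by (simp add: sum_3 p[unfolded One_nat_def])
  qed
  ultimately show ?thesis by (simp add: fun_eq_iff)
qed

lemma continuous_on_planar: "continuous_on S (planar c m)"
  by (rule continuous_at_imp_continuous_on) (rule ballI, rule has_derivative_continuous, rule planar_has_derivative)

lemma C1_on_planar: "open S \<Longrightarrow> C1_on S (planar c m)"
  by (rule C1_onI(1)[OF _ planar_has_derivative continuous_on_planar])

lemma C2_on_planar: "open S \<Longrightarrow> C2_on S (planar c m)"
  by (rule C2_onI(1)[OF _ planar_has_derivative C1_on_planar])

lemma partial_planar:
  "partial i (planar c m) =
     planar (if i = 1 then of_nat m * c else if i = 2 then \<i> * of_nat m * c else 0) (m - 1)"
  by (rule ext, rule C1_onI(2)[OF open_UNIV planar_has_derivative continuous_on_planar]) simp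

text \<open>The partial derivatives multiply \<open>c\<close> by \<open>m\<close> and by \<open>\<i> m\<close>, so the two second derivatives
cancel because \<open>\<i>\<^sup>2 = -1\<close>.\<close>
lemma laplacian_planar: "laplacian (planar c m) y = 0"
proof -
  have e: "\<i> * a * (\<i> * b * c) = - (a * (b * c))" for a b
  proof -
    have "\<i> * a * (\<i> * b * c) = (\<i> * \<i>) * (a * (b * c))" by (simp only: ac_simps)
    then show ?thesis by simp
  qed
  show ?thesis unfolding laplacian_def sum_3 partial_planar by (simp add: e planar_minus)
qed

lemma euler_planar: "(\<Sum>i\<in>UNIV. y $ i * partial i (planar c m) y) = real m * planar c m y"
proof (cases m)
  case (Suc n)
  define X where "X = c * Complex (y $ 1) (y $ 2) ^ n"
  have 1: "of_nat m * c * Complex (y $ 1) (y $ 2) ^ n = of_real (real m) * X"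
    by (simp add: X_def mult.assoc)
  have 2: "planar (of_nat m * c) n y = real m * Re X"
    unfolding planar_def 1 by simp
  have 3: "planar (\<i> * of_nat m * c) n y = - (real m * Im X)"
    unfolding mult.assoc[of \<i>] planar_imaginary 1 by simp
  have "planar c m y = Re (Complex (y $ 1) (y $ 2) * X)"
    unfolding planar_def X_def Suc power_Suc by (simp only: mult.left_commute)
  then show ?thesis using 2 3
    by (simp add: sum_3 partial_planar Suc del: of_nat_Suc) (simp add: algebra_simps)
qed (simp add: sum_3 partial_planar planar_def)

lemma axial_has_derivative:
  assumes "(A has_real_derivative A1) (at (y $ 3))"
  shows "((\<lambda>y::real^3. A (y $ 3)) has_derivative (\<lambda>h. \<Sum>i\<in>UNIV. h $ i * (if i = 3 then A1 else 0))) (at y)"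
proof -
  have "((\<lambda>y::real^3. y $ 3) has_derivative (\<lambda>h. h $ 3)) (at y)"
    by (simp add: bounded_linear_imp_has_derivative bounded_linear_vec_nth)
  from has_derivative_compose[OF this] assms
  have "((\<lambda>y::real^3. A (y $ 3)) has_derivative (\<lambda>h. A1 * h $ 3)) (at y)"
    by (simp add: has_field_derivative_def)
  then show ?thesis by (rule has_derivative_eq_rhs) (simp add: fun_eq_iff sum_3)
qed

lemma radial_has_derivative:
  assumes "(B has_real_derivative B1) (at (y \<bullet> y))"
  shows "((\<lambda>y::real^3. B (y \<bullet> y)) has_derivative (\<lambda>h. \<Sum>i\<in>UNIV. h $ i * (2 * y $ i * B1))) (at y)"
proof -
  have "((\<lambda>y::real^3. y \<bullet> y) has_derivative (\<lambda>h. 2 * (y \<bullet> h))) (at y)"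
    by (auto intro!: derivative_eq_intros simp: inner_commute)
  from has_derivative_compose[OF this] assms
  have "((\<lambda>y::real^3. B (y \<bullet> y)) has_derivative (\<lambda>h. B1 * (2 * (y \<bullet> h)))) (at y)"
    by (simp add: has_field_derivative_def)
  then show ?thesis by (rule has_derivative_eq_rhs)
      (simp add: fun_eq_iff sum_3 inner_vec_def algebra_simps)
qed

lemma continuous_on_axial:
  assumes "continuous_on T A" "\<And>y. y \<in> S \<Longrightarrow> y $ 3 \<in> T"
  shows "continuous_on S (\<lambda>y::real^3. A (y $ 3))"
  by (rule continuous_on_compose2[OF assms(1)]) (use assms(2) in \<open>auto intro!: continuous_intros\<close>)

lemma continuous_on_radial:
  assumes "continuous_on T B" "\<And>y. y \<in> S \<Longrightarrow> y \<bullet> y \<in> T"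
  shows "continuous_on S (\<lambda>y::real^3. B (y \<bullet> y))"
  by (rule continuous_on_compose2[OF assms(1)]) (use assms(2) in \<open>auto intro!: continuous_intros\<close>)

section \<open>Compactly supported divergences and functions constant along rays\<close>

lemma C1_on_Un:
  assumes "open S" "open T" "C1_on S f" "C1_on T f"
  shows "C1_on (S \<union> T) f"
proof -
  have "f differentiable_on S \<union> T"
    using assms by (auto simp: differentiable_on_eq_differentiable_at open_Un C1_on_def)
  then show ?thesis
    using assms continuous_on_open_Un unfolding C1_on_def by blast
qed

lemma integrable_compact_support:
  fixes f :: "real^3 \<Rightarrow> real"
  assumes "compact K" "continuous_on K f" "\<And>y. y \<notin> K \<Longrightarrow> f y = 0"
  shows "integrable lborel f"
proof -
  have "(\<lambda>y. indicator K y *\<^sub>R f y) = f"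
    using assms(3) by (auto simp: fun_eq_iff indicator_def)
  then show ?thesis using borel_integrable_compact[OF assms(1,2)] by simp
qed

text \<open>By translation invariance the difference quotients of \<open>f\<close> have integral zero. They converge to the
partial derivative, and by the mean value theorem they are bounded by its maximum; since they all
live on a fixed ball, dominated convergence applies.\<close>
lemma integral_partial_eq_0:
  assumes "open S" "compact K" "K \<subseteq> S" "C1_on S f" "\<And>y. y \<notin> K \<Longrightarrow> f y = 0"
  shows "integral\<^sup>L lborel (partial i f) = 0" "integrable lborel (partial i f)"
proof -
  have oK: "open (- K)" using assms(2) by (simp add: compact_imp_closed open_Compl)
  have z: "C1_on (- K) f"
    by (rule C1_on_cong[OF oK C1_on_const[OF oK, of 0]]) (use assms(5) in auto)
  have "S \<union> - K = UNIV" using assms(3) by auto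
  with C1_on_Un[OF assms(1) oK assms(4) z] have C1: "C1_on UNIV f" by simp
  define p where "p = partial i f"
  have pc: "continuous_on UNIV p" and fc: "continuous_on UNIV f"
    using C1 C1_onD by (auto simp: p_def)
  have pz: "p y = 0" if "y \<notin> K" for y
    using partial_cong[OF oK, of y f "\<lambda>_. 0" i] that assms(5) partial_const by (auto simp: p_def)
  define e where "e = (axis i 1 :: real^3)"
  have D: "((\<lambda>t. f (y + t *\<^sub>R e)) has_real_derivative p (y + t *\<^sub>R e)) (at t)" for y t
  proof -
    have 1: "((\<lambda>t. y + t *\<^sub>R e) has_derivative (\<lambda>h. h *\<^sub>R e)) (at t)"
      by (auto intro!: derivative_eq_intros)
    have dF: "f differentiable (at (y + t *\<^sub>R e))" using C1_onD(1)[OF C1] by simp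
    then have "(f has_derivative frechet_derivative f (at (y + t *\<^sub>R e))) (at (y + t *\<^sub>R e))"
      by (simp add: frechet_derivative_works)
    from has_derivative_compose[OF 1 this]
    have "((\<lambda>t. f (y + t *\<^sub>R e)) has_derivative (\<lambda>h. frechet_derivative f (at (y + t *\<^sub>R e)) (h *\<^sub>R e))) (at t)" .
    moreover have "frechet_derivative f (at (y + t *\<^sub>R e)) (h *\<^sub>R e) = p (y + t *\<^sub>R e) * h" for h
      using linear_frechet_derivative[OF dF] by (simp add: linear_cmul p_def partial_def e_def)
    ultimately show ?thesis by (simp add: has_field_derivative_def)
  qed
  have ne: "norm e = 1" by (simp add: e_def)
  obtain C where C: "\<And>y. \<bar>p y\<bar> \<le> C"
  proof -
    have "compact (p ` K)" using assms(2) pc by (meson compact_continuous_image continuous_on_subset subset_UNIV)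
    then obtain C where "\<forall>x\<in>p ` K. norm x \<le> C" using compact_imp_bounded bounded_iff by metis
    then have "\<bar>p y\<bar> \<le> max C 0" for y by (cases "y \<in> K") (force simp: pz)+
    then show ?thesis using that by blast
  qed
  obtain R where R: "\<And>y. y \<in> K \<Longrightarrow> norm y \<le> R"
    using assms(2) compact_imp_bounded bounded_iff by metis
  define h where "h n = inverse (real (Suc n))" for n
  have h: "h n > 0" "h n \<le> 1" for n by (auto simp: h_def field_simps)
  define d where "d n y = (f (y + h n *\<^sub>R e) - f y) / h n" for n y
  have fi: "integrable lborel f"
    by (rule integrable_compact_support[OF assms(2) _ assms(5)]) (use fc continuous_on_subset in auto)
  have tr: "integral\<^sup>L lborel (\<lambda>y. f (y + a)) = integral\<^sup>L lborel f"
       "integrable lborel (\<lambda>y. f (y + a))" for a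
  proof -
    have m: "f \<in> borel_measurable lborel" using fi by auto
    have "integral\<^sup>L (distr lborel borel ((+) a)) f = integral\<^sup>L lborel (\<lambda>y. f (a + y))"
      by (rule integral_distr) (use m in auto)
    then show "integral\<^sup>L lborel (\<lambda>y. f (y + a)) = integral\<^sup>L lborel f"
      by (simp add: lborel_distr_plus add.commute)
    have "integrable (distr lborel borel ((+) a)) f = integrable lborel (\<lambda>y. f (a + y))"
      by (rule integrable_distr_eq) (use m in auto)
    then show "integrable lborel (\<lambda>y. f (y + a))" using fi by (simp add: lborel_distr_plus add.commute)
  qed
  have di: "integral\<^sup>L lborel (d n) = 0" for n
    using tr[of "h n *\<^sub>R e"] fi by (simp add: d_def[abs_def])
  have dp: "(\<lambda>n. d n y) \<longlonglongrightarrow> p y" for y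
  proof -
    have "((\<lambda>s. (f (y + s *\<^sub>R e) - f y) / s) \<longlongrightarrow> p y) (at 0)"
      using D[of y 0] by (simp add: DERIV_def)
    moreover have "filterlim h (at 0) sequentially"
      unfolding filterlim_at using LIMSEQ_inverse_real_of_nat h(1)
      by (auto simp: h_def[abs_def] simp del: of_nat_Suc intro!: always_eventually)
    ultimately show ?thesis unfolding d_def by (rule filterlim_compose)
  qed
  have db: "norm (d n y) \<le> C * indicator (cball 0 (R + 1)) y" for n y
  proof (cases "y \<in> cball 0 (R + 1)")
    case True
    obtain z where "f (y + h n *\<^sub>R e) - f (y + 0 *\<^sub>R e) = (h n - 0) * p (y + z *\<^sub>R e)"
      using MVT2[OF h(1)[of n], of "\<lambda>t. f (y + t *\<^sub>R e)" "\<lambda>t. p (y + t *\<^sub>R e)"] D by blast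
    then have "d n y = p (y + z *\<^sub>R e)" using h(1)[of n] by (simp add: d_def)
    then show ?thesis using True C by simp
  next
    case False
    then have y: "norm y > R + 1" by simp
    have "norm y \<le> norm (y + h n *\<^sub>R e) + norm (h n *\<^sub>R e)"
      by (metis add_diff_cancel_right' norm_triangle_ineq4)
    also have "norm (h n *\<^sub>R e) \<le> 1" using h[of n] ne by simp
    finally have "y + h n *\<^sub>R e \<notin> K" "y \<notin> K" using y R by fastforce+
    then show ?thesis using False assms(5) by (simp add: d_def)
  qed
  have pm: "p \<in> borel_measurable lborel" using pc by (simp add: borel_measurable_continuous_onI)
  have dm: "d n \<in> borel_measurable lborel" for n
    using tr(2)[of "h n *\<^sub>R e"] fi by (auto simp: d_def[abs_def])
  have wi: "integrable lborel (\<lambda>y. C * indicator (cball 0 (R + 1)) y :: real)"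
    using emeasure_lborel_cball_finite by (intro integrable_mult_right integrable_real_indicator) auto
  have "(\<lambda>n. integral\<^sup>L lborel (d n)) \<longlonglongrightarrow> integral\<^sup>L lborel p"
    by (rule integral_dominated_convergence[OF pm dm wi]) (use dp db in auto)
  then show "integral\<^sup>L lborel (partial i f) = 0"
    unfolding di p_def[symmetric] using LIMSEQ_unique tendsto_const by blast
  show "integrable lborel (partial i f)"
    unfolding p_def[symmetric]
    by (rule integrable_compact_support[OF assms(2) _ pz]) (use pc continuous_on_subset in auto)
qed

definition upper_half_space :: "(real^3) set" where
  "upper_half_space = {y. y $ 3 > 0}"

lemma open_upper_half_space: "open upper_half_space"
  unfolding upper_half_space_def by (intro open_Collect_less continuous_intros)

text \<open>Differentiate \<open>F (c y) = a F(y)\<close>. It is applied to a function constant along rays and then to its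
partial derivatives, which are homogeneous of degree \<open>-1\<close>.\<close>
lemma partial_homogeneous:
  assumes F: "C1_on upper_half_space F" and c: "c > 0"
    and hom: "\<And>y. y \<in> upper_half_space \<Longrightarrow> F (c *\<^sub>R y) = a * F y"
    and y: "y \<in> upper_half_space"
  shows "partial i F (c *\<^sub>R y) = a / c * partial i F y"
proof -
  have cy: "c *\<^sub>R y \<in> upper_half_space" using y c by (simp add: upper_half_space_def)
  note dy = has_derivative_partial[OF C1_onD(1)[OF F open_upper_half_space y]]
  note dcy = has_derivative_partial[OF C1_onD(1)[OF F open_upper_half_space cy]]
  have "((\<lambda>y. c *\<^sub>R y) has_derivative (\<lambda>h::real^3. c *\<^sub>R h)) (at y)"
    by (auto intro!: derivative_eq_intros)
  from partial_eqI[OF has_derivative_compose[OF this dcy]]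
  have 1: "partial i (\<lambda>y. F (c *\<^sub>R y)) y = c * partial i F (c *\<^sub>R y)"
    using exhaust_3[of i] by (auto simp: sum_3 axis_def)
  from partial_eqI[OF has_derivative_mult_right[OF dy, of a]]
  have 2: "partial i (\<lambda>y. a * F y) y = a * partial i F y"
    using exhaust_3[of i] by (auto simp: sum_3 axis_def)
  have "partial i (\<lambda>y. F (c *\<^sub>R y)) y = partial i (\<lambda>y. a * F y) y"
    by (rule partial_cong[OF open_upper_half_space y hom])
  then show ?thesis unfolding 1 2 using c by (simp add: field_simps)
qed

lemma radial_extension_scale: "c > 0 \<Longrightarrow> radial_extension u (c *\<^sub>R y) = radial_extension u y"
proof -
  assume "c > 0"
  then have "(c *\<^sub>R y) /\<^sub>R norm (c *\<^sub>R y) = y /\<^sub>R norm y" by simp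
  then show ?thesis unfolding radial_extension_def by (rule arg_cong)
qed

lemma euler_radial_extension:
  assumes "C1_on upper_half_space (radial_extension u)" "y \<in> upper_half_space"
  shows "(\<Sum>i\<in>UNIV. y $ i * partial i (radial_extension u) y) = 0"
proof -
  let ?w = "radial_extension u"
  have y: "(1::real) *\<^sub>R y \<in> upper_half_space" using assms(2) by simp
  have 1: "((\<lambda>t::real. t *\<^sub>R y) has_derivative (\<lambda>h. h *\<^sub>R y)) (at 1)"
    by (auto intro!: derivative_eq_intros)
  have "((\<lambda>t::real. ?w (t *\<^sub>R y)) has_derivative
      (\<lambda>h. \<Sum>i\<in>UNIV. (h *\<^sub>R y) $ i * partial i ?w (1 *\<^sub>R y))) (at 1)"
    by (rule has_derivative_compose[OF 1 has_derivative_partial[OF C1_onD(1)[OF assms(1) open_upper_half_space y]]])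
  moreover have "((\<lambda>t::real. ?w (t *\<^sub>R y)) has_derivative (\<lambda>h. 0)) (at 1)"
  proof (rule has_derivative_transform_within_open[where s="{0<..}"])
    show "((\<lambda>t::real. ?w y) has_derivative (\<lambda>h. 0)) (at 1)" by simp
  qed (auto simp: radial_extension_scale)
  ultimately have "(\<lambda>h. \<Sum>i\<in>UNIV. (h *\<^sub>R y) $ i * partial i ?w (1 *\<^sub>R y)) = (\<lambda>h. 0)"
    by (rule has_derivative_unique)
  from fun_cong[OF this, of 1] show ?thesis by simp
qed

text \<open>The Laplacian of a function constant along rays is homogeneous of degree \<open>-2\<close>, so it is known as
soon as it is known on the unit sphere.\<close>
lemma laplacian_radial_extension:
  assumes "C2_on upper_half_space (radial_extension u)" "y \<in> upper_half_space"
  shows "laplacian (radial_extension u) y = sphere_laplacian u (y /\<^sub>R norm y) / (y \<bullet> y)"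
proof -
  let ?w = "radial_extension u" and ?c = "norm y"
  have c: "?c > 0" using assms(2) by (auto simp: upper_half_space_def)
  define x where "x = y /\<^sub>R norm y"
  have y: "y = ?c *\<^sub>R x" using c by (simp add: x_def)
  have x: "x \<in> upper_half_space" using c assms(2) by (simp add: x_def upper_half_space_def)
  have 1: "partial i ?w (?c *\<^sub>R z) = 1 / ?c * partial i ?w z" if "z \<in> upper_half_space" for z i
    by (rule partial_homogeneous[OF C2_onD(1)[OF assms(1)] c _ that]) (simp only: radial_extension_scale[OF c] mult_1)
  have "partial i (partial i ?w) (?c *\<^sub>R x) = (1 / ?c) / ?c * partial i (partial i ?w) x" for i
    by (rule partial_homogeneous[OF C2_onD(2)[OF assms(1)] c 1 x])
  then have "laplacian ?w y = (1 / ?c) / ?c * laplacian ?w x"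
    unfolding laplacian_def y[symmetric] by (simp add: sum_distrib_left)
  moreover have "y \<bullet> y = ?c * ?c" by (simp add: norm_eq_sqrt_inner)
  ultimately show ?thesis by (simp add: sphere_laplacian_def x_def)
qed

section \<open>Green and Euler identities on the half-space\<close>

text \<open>\<open>F\<close> is a formula for the divergence of \<open>G\<close> that is valid on \<open>S\<close> only; the indicator discards its
values elsewhere.\<close>
lemma integral_sum_partial_eq_0:
  assumes "open S" "compact K" "K \<subseteq> S" "\<And>i. C1_on S (G i)" "\<And>i y. y \<notin> K \<Longrightarrow> G i y = 0"
    and F: "\<And>y. y \<in> S \<Longrightarrow> F y = (\<Sum>i\<in>UNIV. partial i (G i) y)"
  shows "integral\<^sup>L lborel (\<lambda>y. indicator S y * F y) = 0" "integrable lborel (\<lambda>y. indicator S y * F y)"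
proof -
  have oK: "open (- K)" using assms(2) by (simp add: compact_imp_closed open_Compl)
  have pz: "partial i (G i) y = 0" if "y \<notin> K" for y i
    using partial_cong[OF oK, of y "G i" "\<lambda>_. 0" i] that assms(5) partial_const by auto
  have "(\<lambda>y. indicator S y * F y) = (\<lambda>y. \<Sum>i\<in>UNIV. partial i (G i) y)"
  proof
    fix y
    show "indicator S y * F y = (\<Sum>i\<in>UNIV. partial i (G i) y)"
    proof (cases "y \<in> S")
      case False
      then have "y \<notin> K" using assms(3) by blast
      then show ?thesis using False by (simp add: pz)
    qed (simp add: F)
  qed
  moreover note i = integral_partial_eq_0[OF assms(1-4) assms(5)]
  ultimately show "integral\<^sup>L lborel (\<lambda>y. indicator S y * F y) = 0" "integrable lborel (\<lambda>y. indicator S y * F y)"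
    by (simp_all add: i Bochner_Integration.integral_sum)
qed

text \<open>The integrand is the divergence of the field \<open>g \<nabla>f - f \<nabla>g\<close>, which vanishes off \<open>K\<close>.\<close>
lemma green_identity:
  assumes S: "open S" "compact K" "K \<subseteq> S" and f: "C2_on S f" and g: "C2_on S g"
    and gz: "\<And>y. y \<notin> K \<Longrightarrow> g y = 0"
  shows "integral\<^sup>L lborel (\<lambda>y. indicator S y * (g y * laplacian f y - f y * laplacian g y)) = 0"
    and "integrable lborel (\<lambda>y. indicator S y * (g y * laplacian f y - f y * laplacian g y))"
proof -
  define G where "G i y = g y * partial i f y + (-1) * (f y * partial i g y)" for i y
  have oK: "open (- K)" using S(2) by (simp add: compact_imp_closed open_Compl)
  have pz: "partial i g y = 0" if "y \<notin> K" for y i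
    using partial_cong[OF oK, of y g "\<lambda>_. 0" i] that gz partial_const by auto
  note D = C2_onD(1)[OF f] C2_onD(2)[OF f] C2_onD(1)[OF g] C2_onD(2)[OF g]
  have c1: "C1_on S (\<lambda>y. g y * partial i f y)" "C1_on S (\<lambda>y. f y * partial i g y)" for i
    by (rule C1_on_mult(1)[OF S(1)], rule D, rule D)+
  have c2: "C1_on S (\<lambda>y. (-1) * (f y * partial i g y))" for i
    by (rule C1_on_mult(1)[OF S(1) C1_on_const[OF S(1)] c1(2)])
  have c: "C1_on S (G i)" for i
    unfolding G_def by (rule C1_on_add(1)[OF S(1) c1(1) c2])
  have F: "g y * laplacian f y - f y * laplacian g y = (\<Sum>i\<in>UNIV. partial i (G i) y)" if y: "y \<in> S" for y
  proof -
    have "partial i (G i) y = partial i (\<lambda>y. g y * partial i f y) y + partial i (\<lambda>y. (-1) * (f y * partial i g y)) y" for i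
      unfolding G_def by (rule C1_on_add(2)[OF S(1) c1(1) c2 y])
    moreover have "partial i (\<lambda>y. g y * partial i f y) y = partial i g y * partial i f y + g y * partial i (partial i f) y" for i
      by (rule C1_on_mult(2)[OF S(1) D(3) D(2) y])
    moreover have "partial i (\<lambda>y. (-1) * (f y * partial i g y)) y = 0 * (f y * partial i g y) + (-1) * partial i (\<lambda>y. f y * partial i g y) y" for i
      using C1_on_mult(2)[OF S(1) C1_on_const[OF S(1)] c1(2) y, of i "-1"] by (simp only: partial_const)
    moreover have "partial i (\<lambda>y. f y * partial i g y) y = partial i f y * partial i g y + f y * partial i (partial i g) y" for i
      by (rule C1_on_mult(2)[OF S(1) D(1) D(4) y])
    ultimately have "partial i (G i) y = g y * partial i (partial i f) y - f y * partial i (partial i g) y" for i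
      by simp
    then show ?thesis by (simp add: laplacian_def sum_subtractf sum_distrib_left)
  qed
  have z: "G i y = 0" if "y \<notin> K" for i y using that gz pz by (simp add: G_def)
  show "integral\<^sup>L lborel (\<lambda>y. indicator S y * (g y * laplacian f y - f y * laplacian g y)) = 0"
    "integrable lborel (\<lambda>y. indicator S y * (g y * laplacian f y - f y * laplacian g y))"
    by (rule integral_sum_partial_eq_0[OF S c z F]; assumption)+
qed

lemma coordinate_C1:
  assumes "open S"
  shows "C1_on S (\<lambda>y. y $ i)" and "partial j (\<lambda>y. y $ i) x = (if i = j then 1 else 0)"
proof -
  have d: "((\<lambda>y. y $ i) has_derivative (\<lambda>h. \<Sum>j\<in>UNIV. h $ j * (if i = j then 1 else 0))) (at x)" for x :: "real^3"
  proof -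
    have "((\<lambda>y::real^3. y $ i) has_derivative (\<lambda>h. h $ i)) (at x)"
      by (simp add: bounded_linear_imp_has_derivative bounded_linear_vec_nth)
    then show ?thesis by (rule has_derivative_eq_rhs) (use exhaust_3[of i] in \<open>auto simp: fun_eq_iff sum_3\<close>)
  qed
  show "C1_on S (\<lambda>y. y $ i)" by (rule C1_onI(1)[OF assms d]) auto
  show "partial j (\<lambda>y. y $ i) x = (if i = j then 1 else 0)"
    by (rule C1_onI(2)[OF open_UNIV d]) auto
qed

text \<open>The integrand is the divergence of the field \<open>y w g\<close>, because \<open>w\<close> has no radial derivative. This
identity is what integration in the radial direction would give in polar coordinates.\<close>
lemma euler_identity:
  assumes K: "compact K" "K \<subseteq> upper_half_space"
    and w: "C1_on upper_half_space w" "\<And>y. y \<in> upper_half_space \<Longrightarrow> (\<Sum>i\<in>UNIV. y $ i * partial i w y) = 0"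
    and g: "C1_on upper_half_space g" "\<And>y. y \<notin> K \<Longrightarrow> g y = 0"
  shows "integral\<^sup>L lborel (\<lambda>y. indicator upper_half_space y * (w y * (3 * g y + (\<Sum>i\<in>UNIV. y $ i * partial i g y)))) = 0"
    and "integrable lborel (\<lambda>y. indicator upper_half_space y * (w y * (3 * g y + (\<Sum>i\<in>UNIV. y $ i * partial i g y))))"
proof -
  note o = open_upper_half_space
  define G where "G i y = y $ i * (w y * g y)" for i and y :: "real^3"
  have c1: "C1_on upper_half_space (\<lambda>y. w y * g y)" by (rule C1_on_mult(1)[OF o w(1) g(1)])
  have c: "C1_on upper_half_space (G i)" for i
    unfolding G_def by (rule C1_on_mult(1)[OF o coordinate_C1(1)[OF o] c1])
  have F: "w y * (3 * g y + (\<Sum>i\<in>UNIV. y $ i * partial i g y)) = (\<Sum>i\<in>UNIV. partial i (G i) y)"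
    if y: "y \<in> upper_half_space" for y
  proof -
    have "partial i (G i) y = w y * g y + y $ i * (partial i w y * g y + w y * partial i g y)" for i
      unfolding G_def C1_on_mult(2)[OF o coordinate_C1(1)[OF o] c1 y]
        C1_on_mult(2)[OF o w(1) g(1) y] coordinate_C1(2)[OF open_UNIV] by simp
    then have "(\<Sum>i\<in>UNIV. partial i (G i) y) = (\<Sum>i\<in>UNIV. w y * g y + g y * (y $ i * partial i w y) + w y * (y $ i * partial i g y))"
      by (simp add: algebra_simps)
    also have "\<dots> = 3 * (w y * g y) + g y * (\<Sum>i\<in>UNIV. y $ i * partial i w y) + w y * (\<Sum>i\<in>UNIV. y $ i * partial i g y)"
      by (simp add: sum.distrib sum_distrib_left)
    finally show ?thesis using w(2)[OF y] by (simp add: algebra_simps)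
  qed
  have z: "G i y = 0" if "y \<notin> K" for i y using that g(2) by (simp add: G_def)
  show "integral\<^sup>L lborel (\<lambda>y. indicator upper_half_space y * (w y * (3 * g y + (\<Sum>i\<in>UNIV. y $ i * partial i g y)))) = 0"
    "integrable lborel (\<lambda>y. indicator upper_half_space y * (w y * (3 * g y + (\<Sum>i\<in>UNIV. y $ i * partial i g y))))"
    by (rule integral_sum_partial_eq_0[OF o K c z F]; assumption)+
qed

lemma axial_C1:
  assumes "\<And>t. (A has_real_derivative A1 t) (at t)" "continuous_on UNIV A1" "open S"
  shows "C1_on S (\<lambda>y::real^3. A (y $ 3))"
    and "x \<in> S \<Longrightarrow> partial i (\<lambda>y::real^3. A (y $ 3)) x = (if i = 3 then A1 (x $ 3) else 0)"
proof -
  have c: "continuous_on S (\<lambda>y::real^3. if i = 3 then A1 (y $ 3) else 0)" for i :: 3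
    by (cases "i = 3") (auto intro: continuous_on_axial[OF assms(2)])
  note I = C1_onI[OF assms(3) axial_has_derivative[OF assms(1)] c]
  show "C1_on S (\<lambda>y::real^3. A (y $ 3))"
    "x \<in> S \<Longrightarrow> partial i (\<lambda>y::real^3. A (y $ 3)) x = (if i = 3 then A1 (x $ 3) else 0)"
    by (fact I(1)) (erule I(2))
qed

lemma axial_C2:
  assumes "\<And>t. (A has_real_derivative A1 t) (at t)" "\<And>t. (A1 has_real_derivative A2 t) (at t)"
    "continuous_on UNIV A2" "open S"
  shows "C2_on S (\<lambda>y::real^3. A (y $ 3))"
    and "x \<in> S \<Longrightarrow> laplacian (\<lambda>y::real^3. A (y $ 3)) x = A2 (x $ 3)"
proof -
  note A1 = axial_C1[OF assms(2,3,4)]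
  have c: "C1_on S (\<lambda>y::real^3. if i = 3 then A1 (y $ 3) else 0)" for i :: 3
    by (cases "i = 3") (simp_all add: A1 C1_on_const[OF assms(4)])
  note I = C2_onI[OF assms(4) axial_has_derivative[OF assms(1)] c]
  show "C2_on S (\<lambda>y::real^3. A (y $ 3))" by (fact I(1))
  assume x: "x \<in> S"
  have "partial i (partial i (\<lambda>y::real^3. A (y $ 3))) x = (if i = 3 then A2 (x $ 3) else 0)" for i
    unfolding I(3)[OF x] by (cases "i = 3") (simp_all add: A1(2)[OF x] partial_const)
  then show "laplacian (\<lambda>y::real^3. A (y $ 3)) x = A2 (x $ 3)"
    by (simp add: laplacian_def)
qed

lemma radial_C1:
  assumes "\<forall>s>0. (B has_real_derivative B1 s) (at s)" "continuous_on {0<..} B1" "open S" "0 \<notin> S"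
  shows "C1_on S (\<lambda>y::real^3. B (y \<bullet> y))"
    and "x \<in> S \<Longrightarrow> partial i (\<lambda>y::real^3. B (y \<bullet> y)) x = 2 * x $ i * B1 (x \<bullet> x)"
proof -
  have pos: "y \<bullet> y > 0" if "y \<in> S" for y using that assms(4) by (metis inner_gt_zero_iff)
  have c: "continuous_on S (\<lambda>y::real^3. 2 * y $ i * B1 (y \<bullet> y))" for i :: 3
    by (intro continuous_intros continuous_on_radial[OF assms(2)]) (use pos in auto)
  note I = C1_onI[OF assms(3) radial_has_derivative[OF assms(1)[rule_format, OF pos]] c]
  show "C1_on S (\<lambda>y::real^3. B (y \<bullet> y))"
    "x \<in> S \<Longrightarrow> partial i (\<lambda>y::real^3. B (y \<bullet> y)) x = 2 * x $ i * B1 (x \<bullet> x)"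
    by (rule I(1); assumption) (rule I(2); assumption)
qed

lemma radial_C2:
  assumes "\<forall>s>0. (B has_real_derivative B1 s) (at s)"
    "\<forall>s>0. (B1 has_real_derivative B2 s) (at s)" "continuous_on {0<..} B2" "open S" "0 \<notin> S"
  shows "C2_on S (\<lambda>y::real^3. B (y \<bullet> y))"
    and "x \<in> S \<Longrightarrow> laplacian (\<lambda>y::real^3. B (y \<bullet> y)) x = 6 * B1 (x \<bullet> x) + 4 * (x \<bullet> x) * B2 (x \<bullet> x)"
proof -
  note o = assms(4)
  have pos: "y \<bullet> y > 0" if "y \<in> S" for y using that assms(5) by (metis inner_gt_zero_iff)
  note B1 = radial_C1[OF assms(2,3,4,5)]
  have c0: "C1_on S (\<lambda>y::real^3. 2 * y $ i)" for i
    by (rule C1_on_mult(1)[OF o C1_on_const[OF o] coordinate_C1(1)[OF o]])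
  have c: "C1_on S (\<lambda>y::real^3. 2 * y $ i * B1 (y \<bullet> y))" for i
    by (rule C1_on_mult(1)[OF o c0 B1(1)])
  note I = C2_onI[OF o radial_has_derivative[OF assms(1)[rule_format, OF pos]] c]
  show "C2_on S (\<lambda>y::real^3. B (y \<bullet> y))" by (rule I(1); assumption)
  assume x: "x \<in> S"
  have c00: "partial i (\<lambda>y::real^3. 2 * y $ i) x = 2" for i
    unfolding C1_on_mult(2)[OF o C1_on_const[OF o] coordinate_C1(1)[OF o] x] coordinate_C1(2)[OF open_UNIV] partial_const by simp
  have "partial i (partial i (\<lambda>y::real^3. B (y \<bullet> y))) x = 2 * B1 (x \<bullet> x) + 4 * (x $ i * x $ i) * B2 (x \<bullet> x)" for i
  proof -
    have "partial i (partial i (\<lambda>y::real^3. B (y \<bullet> y))) x = partial i (\<lambda>y::real^3. 2 * y $ i * B1 (y \<bullet> y)) x"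
      by (rule I(3)) (use x in auto)
    then show ?thesis
      unfolding C1_on_mult(2)[OF o c0 B1(1) x] c00 B1(2)[OF x] by simp
  qed
  then have "laplacian (\<lambda>y::real^3. B (y \<bullet> y)) x = (\<Sum>i\<in>(UNIV::3 set). 2 * B1 (x \<bullet> x) + 4 * (x $ i * x $ i) * B2 (x \<bullet> x))"
    by (simp add: laplacian_def)
  also have "\<dots> = 6 * B1 (x \<bullet> x) + 4 * (x \<bullet> x) * B2 (x \<bullet> x)"
    by (simp add: sum_3 inner_vec_def algebra_simps)
  finally show "laplacian (\<lambda>y::real^3. B (y \<bullet> y)) x = 6 * B1 (x \<bullet> x) + 4 * (x \<bullet> x) * B2 (x \<bullet> x)" .
qed

text \<open>The test functions are products of a function of \<open>y\<^sub>1 + \<i> y\<^sub>2\<close>, one of \<open>y\<^sub>3\<close> and one of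
\<open>|y|\<^sup>2\<close>. The same formula later yields the Laplacians of the explicit eigenfunctions.\<close>
lemma laplacian_planar_axial_radial:
  assumes A: "\<And>t. (A has_real_derivative A1 t) (at t)" "\<And>t. (A1 has_real_derivative A2 t) (at t)"
    "continuous_on UNIV A2"
    and B: "\<forall>s>0. (B has_real_derivative B1 s) (at s)"
    "\<forall>s>0. (B1 has_real_derivative B2 s) (at s)" "continuous_on {0<..} B2"
    and S: "open S" "0 \<notin> S"
  shows "C2_on S (\<lambda>y. planar c m y * (A (y $ 3) * B (y \<bullet> y)))"
    and "y \<in> S \<Longrightarrow> laplacian (\<lambda>y. planar c m y * (A (y $ 3) * B (y \<bullet> y))) y =
      planar c m y * (A2 (y $ 3) * B (y \<bullet> y) + 4 * (y $ 3) * A1 (y $ 3) * B1 (y \<bullet> y)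
        + A (y $ 3) * ((6 + 4 * real m) * B1 (y \<bullet> y) + 4 * (y \<bullet> y) * B2 (y \<bullet> y)))"
proof -
  note a = axial_C2[OF A S(1)] and b = radial_C2[OF B S]
  have A1c: "continuous_on UNIV A1" using A(2) DERIV_isCont continuous_at_imp_continuous_on by blast
  have B1c: "continuous_on {0<..} B1" using B(2) DERIV_isCont by (intro continuous_at_imp_continuous_on) auto
  note a1 = axial_C1[OF A(1) A1c S(1)] and b1 = radial_C1[OF B(1) B1c S]
  note ab = C2_on_mult[OF S(1) a(1) b(1)]
  note hab = C2_on_mult[OF S(1) C2_on_planar[OF S(1), of c m] ab(1)]
  show "C2_on S (\<lambda>y. planar c m y * (A (y $ 3) * B (y \<bullet> y)))" by (fact hab(1))
  assume y: "y \<in> S"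
  have 1: "laplacian (\<lambda>y. A (y $ 3) * B (y \<bullet> y)) y =
     A (y $ 3) * (6 * B1 (y \<bullet> y) + 4 * (y \<bullet> y) * B2 (y \<bullet> y)) + 4 * (y $ 3) * A1 (y $ 3) * B1 (y \<bullet> y) + A2 (y $ 3) * B (y \<bullet> y)"
    unfolding ab(2)[OF y] a(2)[OF y] b(2)[OF y] a1(2)[OF y] b1(2)[OF y] by (simp add: sum_3)
  have 2: "(\<Sum>i\<in>UNIV. partial i (planar c m) y * partial i (\<lambda>y. A (y $ 3) * B (y \<bullet> y)) y)
     = 2 * real m * planar c m y * A (y $ 3) * B1 (y \<bullet> y)"
  proof -
    have p: "partial i (\<lambda>y. A (y $ 3) * B (y \<bullet> y)) y = (if i = 3 then A1 (y $ 3) else 0) * B (y \<bullet> y) + A (y $ 3) * (2 * y $ i * B1 (y \<bullet> y))" for i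
      unfolding C1_on_mult(2)[OF S(1) a1(1) b1(1) y] a1(2)[OF y] b1(2)[OF y] ..
    have p3: "partial 3 (planar c m) y = 0" by (simp add: partial_planar)
    have "(\<Sum>i\<in>UNIV. partial i (planar c m) y * partial i (\<lambda>y. A (y $ 3) * B (y \<bullet> y)) y)
      = (\<Sum>i\<in>UNIV. y $ i * partial i (planar c m) y) * (2 * A (y $ 3) * B1 (y \<bullet> y))"
      unfolding p sum_3 p3 by (simp add: algebra_simps)
    then show ?thesis unfolding euler_planar by simp
  qed
  show "laplacian (\<lambda>y. planar c m y * (A (y $ 3) * B (y \<bullet> y))) y =
      planar c m y * (A2 (y $ 3) * B (y \<bullet> y) + 4 * (y $ 3) * A1 (y $ 3) * B1 (y \<bullet> y)
        + A (y $ 3) * ((6 + 4 * real m) * B1 (y \<bullet> y) + 4 * (y \<bullet> y) * B2 (y \<bullet> y)))"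
    unfolding hab(2)[OF y] 1 2 laplacian_planar by (simp add: algebra_simps)
qed

lemma euler_planar_axial_radial:
  assumes A: "\<And>t. (A has_real_derivative A1 t) (at t)" "continuous_on UNIV A1"
    and C: "\<forall>s>0. (C has_real_derivative C1 s) (at s)" "continuous_on {0<..} C1"
    and S: "open S" "0 \<notin> S"
  shows "C1_on S (\<lambda>y. planar c m y * (A (y $ 3) * C (y \<bullet> y)))"
    and "y \<in> S \<Longrightarrow> (\<Sum>i\<in>UNIV. y $ i * partial i (\<lambda>y. planar c m y * (A (y $ 3) * C (y \<bullet> y))) y) =
      planar c m y * (real m * A (y $ 3) * C (y \<bullet> y) + y $ 3 * A1 (y $ 3) * C (y \<bullet> y)
        + 2 * (y \<bullet> y) * A (y $ 3) * C1 (y \<bullet> y))"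
proof -
  note a = axial_C1[OF A S(1)] and b = radial_C1[OF C S]
  note ab = C1_on_mult[OF S(1) a(1) b(1)]
  note hab = C1_on_mult[OF S(1) C1_on_planar[OF S(1), of c m] ab(1)]
  show "C1_on S (\<lambda>y. planar c m y * (A (y $ 3) * C (y \<bullet> y)))" by (fact hab(1))
  assume y: "y \<in> S"
  have "(\<Sum>i\<in>UNIV. y $ i * partial i (\<lambda>y. planar c m y * (A (y $ 3) * C (y \<bullet> y))) y)
    = (\<Sum>i\<in>UNIV. y $ i * partial i (planar c m) y) * (A (y $ 3) * C (y \<bullet> y))
      + planar c m y * (y $ 3 * A1 (y $ 3) * C (y \<bullet> y)) + planar c m y * (A (y $ 3) * (2 * (\<Sum>i\<in>UNIV. y $ i * y $ i) * C1 (y \<bullet> y)))"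
    unfolding hab(2)[OF y] ab(2)[OF y] a(2)[OF y] b(2)[OF y] sum_3 by (simp add: algebra_simps)
  moreover have "(\<Sum>i\<in>UNIV. y $ i * y $ i) = y \<bullet> y" by (simp add: inner_vec_def)
  ultimately show "(\<Sum>i\<in>UNIV. y $ i * partial i (\<lambda>y. planar c m y * (A (y $ 3) * C (y \<bullet> y))) y) =
      planar c m y * (real m * A (y $ 3) * C (y \<bullet> y) + y $ 3 * A1 (y $ 3) * C (y \<bullet> y)
        + 2 * (y \<bullet> y) * A (y $ 3) * C1 (y \<bullet> y))"
    unfolding euler_planar by (simp add: algebra_simps)
qed

section \<open>The weak form of the eigenvalue equation\<close>

text \<open>The extension is continuous away from the origin, in particular across the plane \<open>y\<^sub>3 = 0\<close>, because
\<open>u\<close> vanishes on the equator and, by convention, on the lower hemisphere.\<close>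
lemma radial_extension_eigenfunction:
  assumes u: "u \<in> dirichlet_eigenspace \<mu>"
  shows radial_extension_C2: "C2_on upper_half_space (radial_extension u)"
    and radial_extension_laplacian:
      "y \<in> upper_half_space \<Longrightarrow> laplacian (radial_extension u) y = - \<mu> * radial_extension u y / (y \<bullet> y)"
    and radial_extension_eq_0: "y \<notin> upper_half_space \<Longrightarrow> radial_extension u y = 0"
    and continuous_on_radial_extension: "continuous_on (- {0}) (radial_extension u)"
proof -
  show C2: "C2_on upper_half_space (radial_extension u)"
    using u by (simp add: dirichlet_eigenspace_def C2_on_hemisphere_def upper_half_space_def)
  show "laplacian (radial_extension u) y = - \<mu> * radial_extension u y / (y \<bullet> y)" if y: "y \<in> upper_half_space"
  proof -
    have "y \<noteq> 0" using y by (auto simp: upper_half_space_def)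
    then have "y /\<^sub>R norm y \<in> hemisphere" using y by (simp add: hemisphere_def upper_half_space_def)
    then have "sphere_laplacian u (y /\<^sub>R norm y) = - \<mu> * radial_extension u y"
      using u by (fastforce simp: dirichlet_eigenspace_def radial_extension_def)
    then show ?thesis using laplacian_radial_extension[OF C2 y] by simp
  qed
  have z: "u x = 0" if "x $ 3 \<le> 0 \<or> norm x \<noteq> 1" for x
    using u that by (cases "x $ 3 = 0 \<and> norm x = 1")
      (auto simp: dirichlet_eigenspace_def closed_hemisphere_def equator_def)
  show "radial_extension u y = 0" if "y \<notin> upper_half_space"
    unfolding radial_extension_def
    by (rule z) (use that in \<open>auto simp: upper_half_space_def mult_nonneg_nonpos\<close>)
  define L where "L = sphere 0 1 \<inter> {x::real^3. x $ 3 \<le> 0}"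
  have cl: "closed closed_hemisphere" "closed L"
  proof -
    have e: "closed_hemisphere = sphere 0 1 \<inter> {x. 0 \<le> x $ 3}" by (auto simp: closed_hemisphere_def)
    show "closed closed_hemisphere"
      unfolding e by (auto intro!: closed_Int closed_Collect_le continuous_intros)
    show "closed L" unfolding L_def by (auto intro!: closed_Int closed_Collect_le continuous_intros)
  qed
  have "continuous_on L u"
    by (rule continuous_on_eq[OF continuous_on_const[of L 0]]) (auto simp: L_def z)
  then have "continuous_on (closed_hemisphere \<union> L) u"
    using u cl by (intro continuous_on_closed_Un) (auto simp: dirichlet_eigenspace_def)
  moreover have "closed_hemisphere \<union> L = sphere 0 1" by (auto simp: closed_hemisphere_def L_def)
  ultimately have "continuous_on (sphere 0 1) u" by simp
  then show "continuous_on (- {0}) (radial_extension u)"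
    unfolding radial_extension_def[abs_def]
    by (rule continuous_on_compose2) (auto intro!: continuous_intros simp: field_simps split: if_splits)
qed

text \<open>The support of all radial weights below: a compact set that stays away from the origin, where functions
constant along rays are discontinuous.\<close>
definition shell :: "(real^3) set" where
  "shell = {y. 1 \<le> y \<bullet> y \<and> y \<bullet> y \<le> 4}"

lemma compact_shell: "compact shell"
proof -
  have "shell \<subseteq> cball 0 2"
    by (auto simp: shell_def norm_le_square)
  moreover have "closed shell"
    unfolding shell_def by (intro closed_Collect_conj closed_Collect_le continuous_intros)
  ultimately show ?thesis using compact_cball compact_Int_closed by (metis inf.absorb_iff2)
qed

lemma zero_notin_shell: "0 \<notin> shell"
  by (simp add: shell_def)

text \<open>Green's identity with test function \<open>h A(y\<^sub>3) B(|y|\<^sup>2)\<close>, where \<open>h = planar c m\<close>, produces second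
derivatives of \<open>B\<close>. They are removed by subtracting Euler's identity for
\<open>h A(y\<^sub>3) C(|y|\<^sup>2)\<close> with \<open>C(s) = 2 B'(s) + d B(s) / s\<close> and \<open>d = m + k\<close>. What remains besides \<open>A''\<close> is
the spherical eigenvalue \<open>d (d + 1)\<close> of a homogeneous harmonic of degree \<open>d\<close>, and a term that measures
how far \<open>A\<close> is from being homogeneous of degree \<open>k\<close>.\<close>
lemma weak_equation:
  fixes k :: real and c m
  assumes u: "u \<in> dirichlet_eigenspace \<mu>"
    and A: "\<And>t. (A has_real_derivative A1 t) (at t)" "\<And>t. (A1 has_real_derivative A2 t) (at t)"
      "continuous_on UNIV A2"
    and A0: "\<epsilon> > 0" "\<And>t. t < \<epsilon> \<Longrightarrow> A t = 0"
    and B: "\<forall>s>0. (B has_real_derivative B1 s) (at s)"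
      "\<forall>s>0. (B1 has_real_derivative B2 s) (at s)" "continuous_on {0<..} B2"
    and B0: "\<And>s. s \<notin> {1..4} \<Longrightarrow> B s = 0"
  defines "I \<equiv> \<lambda>y::real^3. radial_extension u y * planar c m y *
      (A2 (y $ 3) * B (y \<bullet> y) + (\<mu> - (m + k) * (m + k + 1)) * (A (y $ 3) * B (y \<bullet> y) / (y \<bullet> y))
       + (y $ 3 * A1 (y $ 3) - k * A (y $ 3)) * (2 * B1 (y \<bullet> y) - (m + k) * B (y \<bullet> y) / (y \<bullet> y)))"
  shows "integral\<^sup>L lborel I = 0" "integrable lborel I"
proof -
  let ?w = "radial_extension u" and ?V = upper_half_space
  define d where "d = real m + k"
  define C where "C s = 2 * B1 s + d * B s / s" for s
  define C1 where "C1 s = 2 * B2 s + d * B1 s / s - d * B s / s^2" for s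
  note o = open_upper_half_space
  have V0: "0 \<notin> ?V" by (simp add: upper_half_space_def)
  have A1c: "continuous_on UNIV A1" using A(2) DERIV_isCont continuous_at_imp_continuous_on by blast
  have Bc: "continuous_on {0<..} B" using B(1) DERIV_isCont by (intro continuous_at_imp_continuous_on) auto
  have B1c: "continuous_on {0<..} B1" using B(2) DERIV_isCont by (intro continuous_at_imp_continuous_on) auto
  have C: "\<forall>s>0. (C has_real_derivative C1 s) (at s)"
  proof (intro allI impI)
    fix s :: real assume s: "s > 0"
    show "(C has_real_derivative C1 s) (at s)"
      unfolding C_def[abs_def] C1_def
      by (rule derivative_eq_intros B(1)[rule_format, OF s] B(2)[rule_format, OF s] refl | use s in \<open>simp add: field_simps power2_eq_square\<close>)+
  qed
  have C1c: "continuous_on {0<..} C1"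
    unfolding C1_def[abs_def] by (intro continuous_intros B(3) B1c Bc) auto
  define K where "K = shell \<inter> {y. \<epsilon> \<le> y $ 3}"
  have K: "compact K" "K \<subseteq> ?V"
  proof -
    have "closed {y::real^3. \<epsilon> \<le> y $ 3}" by (intro closed_Collect_le continuous_intros)
    then show "compact K" unfolding K_def using compact_shell compact_Int_closed by blast
    show "K \<subseteq> ?V" using A0(1) by (auto simp: K_def upper_half_space_def)
  qed
  have B10: "B1 s = 0" if "s \<notin> {1..4}" "s > 0" for s
  proof -
    have "((\<lambda>s. 0) has_real_derivative B1 s) (at s)"
      by (rule has_field_derivative_transform_within_open[OF B(1)[rule_format, OF that(2)], of "- {1..4}"])
        (use that B0 in \<open>auto intro!: open_Compl\<close>)
    then show ?thesis using DERIV_unique DERIV_const by blast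
  qed
  have outside: "A (y $ 3) = 0 \<or> (y \<bullet> y \<notin> {1..4} \<and> y \<bullet> y > 0)" if "y \<notin> K" for y
  proof (cases "y $ 3 < \<epsilon>")
    case False
    then have "y \<noteq> 0" "y \<notin> shell" using A0(1) that by (auto simp: K_def)
    then show ?thesis by (auto simp: shell_def)
  qed (simp add: A0)
  define \<psi> where "\<psi> = (\<lambda>y. planar c m y * (A (y $ 3) * B (y \<bullet> y)))"
  define g where "g = (\<lambda>y. planar c m y * (A (y $ 3) * C (y \<bullet> y)))"
  have z\<psi>: "\<psi> y = 0" if "y \<notin> K" for y
    using outside[OF that] B0 by (auto simp: \<psi>_def)
  have zg: "g y = 0" if "y \<notin> K" for y
    using outside[OF that] B0 B10 by (auto simp: g_def C_def)
  note P = laplacian_planar_axial_radial[OF A B o V0, where c=c and m=m, folded \<psi>_def]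
  note Q = euler_planar_axial_radial[OF A(1) A1c C C1c o V0, where c=c and m=m, folded g_def]
  note G = green_identity[OF o K radial_extension_C2[OF u] P(1) z\<psi>]
  note E = euler_identity[OF K C2_onD(1)[OF radial_extension_C2[OF u]]
    euler_radial_extension[OF C2_onD(1)[OF radial_extension_C2[OF u]]] Q(1) zg]
  have algebra: "w * h * (a2 * b + (\<mu> - d * (d + 1)) * (a * b / s) + (z * a1 - k * a) * (2 * b1 - d * b / s))
    = - (h * (a * b) * (- \<mu> * w / s) - w * (h * (a2 * b + 4 * z * a1 * b1 + a * ((6 + 4 * real m) * b1 + 4 * s * b2))))
      - w * (3 * (h * (a * (2 * b1 + d * b / s))) + h * (real m * a * (2 * b1 + d * b / s) + z * a1 * (2 * b1 + d * b / s)
         + 2 * s * a * (2 * b2 + d * b1 / s - d * b / s^2)))"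
    if "s > 0" for w h a a1 a2 b b1 b2 s z
  proof -
    have k: "k = d - real m" by (simp add: d_def)
    define q where "q = b / s"
    have r: "s * (d * b1 / s) = d * b1" "s * (d * b / s^2) = d * q" "b / s = q" "a * b / s = a * q"
      "d * b / s = d * q" "- \<mu> * w / s * b = - \<mu> * w * q"
      using that by (simp_all add: q_def power2_eq_square)
    have "2 * s * a * (2 * b2 + d * b1 / s - d * b / s^2)
      = 2 * a * (2 * s * b2 + s * (d * b1 / s) - s * (d * b / s^2))" by (simp add: algebra_simps)
    also have "\<dots> = 2 * a * (2 * s * b2 + d * b1 - d * q)" unfolding r ..
    finally have 1: "2 * s * a * (2 * b2 + d * b1 / s - d * b / s^2) = 2 * a * (2 * s * b2 + d * b1 - d * q)" .
    have 2: "h * (a * b) * (- \<mu> * w / s) = - h * a * \<mu> * w * q"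
      by (simp add: q_def)
    show ?thesis unfolding 1 2 unfolding r k by algebra
  qed
  have I: "I = (\<lambda>y. - (indicator ?V y * (\<psi> y * laplacian ?w y - ?w y * laplacian \<psi> y))
     - indicator ?V y * (?w y * (3 * g y + (\<Sum>i\<in>UNIV. y $ i * partial i g y))))"
  proof
    fix y
    show "I y = - (indicator ?V y * (\<psi> y * laplacian ?w y - ?w y * laplacian \<psi> y))
     - indicator ?V y * (?w y * (3 * g y + (\<Sum>i\<in>UNIV. y $ i * partial i g y)))"
    proof (cases "y \<in> ?V")
      case True
      then have s: "y \<bullet> y > 0" using V0 by (metis inner_gt_zero_iff)
      have i: "indicator ?V y = (1::real)" using True by simp
      show ?thesis
        unfolding i radial_extension_laplacian[OF u True] P(2)[OF True] Q(2)[OF True] mult_1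
        unfolding I_def \<psi>_def g_def C_def C1_def d_def[symmetric]
        by (rule algebra[OF s])
    next
      case False
      then show ?thesis using radial_extension_eq_0[OF u False] by (simp add: I_def)
    qed
  qed
  show "integral\<^sup>L lborel I = 0" "integrable lborel I"
    unfolding I using G E by simp_all
qed

section \<open>Cut-off functions and moments\<close>

text \<open>Powers of the positive part supply differentiable functions of compact support with explicit
derivatives.\<close>
lemma DERIV_pos_part_power:
  assumes "n > 0"
  shows "((\<lambda>t::real. max 0 t ^ Suc n) has_real_derivative real (Suc n) * max 0 t ^ n) (at t)"
proof (cases t "0::real" rule: linorder_cases)
  case less
  have "((\<lambda>t. 0) has_real_derivative real (Suc n) * max 0 t ^ n) (at t)"
    using less assms by (simp add: max_def zero_power)
  then show ?thesis
    by (rule has_field_derivative_transform_within_open[of _ _ _ "{..<0}"]) (use less in auto)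
next
  case greater
  have "((\<lambda>t. t ^ Suc n) has_real_derivative real (Suc n) * max 0 t ^ n) (at t)"
    using DERIV_pow[of "Suc n" t UNIV] greater by (simp add: max_def del: power_Suc)
  then show ?thesis
    by (rule has_field_derivative_transform_within_open[of _ _ _ "{0<..}"]) (use greater in auto)
next
  case equal
  have "continuous (at 0) (\<lambda>h::real. max 0 h ^ n)" by (intro continuous_intros)
  then have "((\<lambda>h::real. max 0 h ^ n) \<longlongrightarrow> 0) (at 0)"
    using assms by (simp add: continuous_at zero_power)
  moreover have "(max 0 (0 + h) ^ Suc n - max 0 0 ^ Suc n) / h = max 0 h ^ n" if "h \<noteq> 0" for h :: real
    using that assms by (auto simp: max_def)
  ultimately have "((\<lambda>h::real. (max 0 (0 + h) ^ Suc n - max 0 0 ^ Suc n) / h) \<longlongrightarrow> 0) (at 0)"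
    by (subst tendsto_cong[of _ "\<lambda>h. max 0 h ^ n"]) (auto simp: eventually_at_filter)
  then show ?thesis using equal assms by (simp add: DERIV_def zero_power)
qed

text \<open>A ramp that vanishes up to \<open>1\<close> and has slope one from \<open>3\<close> on. It is obtained by integrating twice
the piecewise linear hat on \<open>[1, 3]\<close>, written as
\<open>(t-1)\<^sub>+ - 2 (t-2)\<^sub>+ + (t-3)\<^sub>+\<close>; this makes \<open>G\<close> a cubic spline.\<close>
lemma smooth_ramp_exists:
  obtains G G1 G2 :: "real \<Rightarrow> real"
  where "\<And>t. (G has_real_derivative G1 t) (at t)" "\<And>t. (G1 has_real_derivative G2 t) (at t)"
    "continuous_on UNIV G2"
    "\<And>t. t \<le> 1 \<Longrightarrow> G t = 0" "\<And>t. t \<ge> 3 \<Longrightarrow> G t = t - 2" "\<And>t. t \<ge> 3 \<Longrightarrow> G1 t = 1"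
    "\<And>t. 0 \<le> G1 t \<and> G1 t \<le> 1" "\<And>t. t \<ge> 0 \<Longrightarrow> 0 \<le> G t \<and> G t \<le> t"
    "\<And>t. \<bar>G2 t\<bar> \<le> 1" "\<And>t. t \<notin> {1..3} \<Longrightarrow> G2 t = 0"
proof
  let ?p = "\<lambda>a t::real. max 0 (t - a)"
  let ?G2 = "\<lambda>t. ?p 1 t - 2 * ?p 2 t + ?p 3 t"
  let ?G1 = "\<lambda>t. (?p 1 t ^ 2 - 2 * ?p 2 t ^ 2 + ?p 3 t ^ 2) / 2"
  let ?G = "\<lambda>t. (?p 1 t ^ 3 - 2 * ?p 2 t ^ 3 + ?p 3 t ^ 3) / 6"
  have d: "((\<lambda>t. ?p a t ^ Suc n) has_real_derivative real (Suc n) * ?p a t ^ n) (at t)" if "n > 0" for a t n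
  proof -
    have "((\<lambda>t. t - a) has_real_derivative 1) (at t)" by (auto intro!: derivative_eq_intros)
    from DERIV_chain2[where g="\<lambda>t. t - a" and x=t and s=UNIV and Db=1, OF DERIV_pos_part_power[OF that, of "t - a"] this]
    show ?thesis by simp
  qed
  have d3: "((\<lambda>t. ?p a t ^ 3) has_real_derivative 3 * ?p a t ^ 2) (at t)" for a t
    using d[of 2 a t] by (simp add: eval_nat_numeral)
  have d2: "((\<lambda>t. ?p a t ^ 2) has_real_derivative 2 * ?p a t) (at t)" for a t
    using d[of 1 a t] by (simp add: eval_nat_numeral)
  show "(?G has_real_derivative ?G1 t) (at t)" for t
  proof -
    have "(?G has_real_derivative (3 * ?p 1 t ^ 2 - 2 * (3 * ?p 2 t ^ 2) + 3 * ?p 3 t ^ 2) / 6) (at t)"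
      by (intro DERIV_add DERIV_diff DERIV_cmult DERIV_cdivide d3)
    then show ?thesis by (rule DERIV_cong) (simp add: field_simps)
  qed
  show "(?G1 has_real_derivative ?G2 t) (at t)" for t
  proof -
    have "(?G1 has_real_derivative (2 * ?p 1 t - 2 * (2 * ?p 2 t) + 2 * ?p 3 t) / 2) (at t)"
      by (intro DERIV_add DERIV_diff DERIV_cmult DERIV_cdivide d2)
    then show ?thesis by (rule DERIV_cong) (simp add: field_simps)
  qed
  show "continuous_on UNIV ?G2" by (intro continuous_intros)
  show "?G t = 0" if "t \<le> 1" for t using that by (simp add: max_def)
  show "?G t = t - 2" if "t \<ge> 3" for t
    using that by (auto simp: max_def power3_eq_cube field_simps)
  show "?G1 t = 1" if "t \<ge> 3" for t
    using that by (auto simp: max_def power2_eq_square algebra_simps)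
  have "t \<le> 1 \<or> 1 \<le> t \<and> t \<le> 2 \<or> 2 \<le> t \<and> t \<le> 3 \<or> 3 \<le> t" for t :: real by linarith
  note cases = this
  have sq: "a^2 \<le> 1" if "0 \<le> a" "a \<le> 1" for a :: real using that by (simp add: power_le_one)
  have cu: "a^3 \<le> 1" if "0 \<le> a" "a \<le> 1" for a :: real using that by (simp add: power_le_one)
  have mid1: "?G1 t = 1 - (3 - t)^2 / 2" "?G t = t - 2 + (3 - t)^3 / 6" if "2 \<le> t" "t \<le> 3" for t
    using that by (auto simp: max_def power2_eq_square power3_eq_cube field_simps)
  show "0 \<le> ?G1 t \<and> ?G1 t \<le> 1" for t
    using cases[of t]
  proof (elim disjE conjE)
    assume "1 \<le> t" "t \<le> 2"
    then show ?thesis using sq[of "t - 1"] by (auto simp: max_def)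
  next
    assume t: "2 \<le> t" "t \<le> 3"
    show ?thesis unfolding mid1[OF t] using sq[of "3 - t"] t by auto
  next
    assume "3 \<le> t"
    then show ?thesis by (auto simp: max_def power2_eq_square algebra_simps)
  qed (simp add: max_def)
  show "0 \<le> ?G t \<and> ?G t \<le> t" if "t \<ge> 0" for t
    using cases[of t]
  proof (elim disjE conjE)
    assume "1 \<le> t" "t \<le> 2"
    then show ?thesis using cu[of "t - 1"] by (auto simp: max_def)
  next
    assume t: "2 \<le> t" "t \<le> 3"
    show ?thesis unfolding mid1[OF t] using cu[of "3 - t"] t by auto
  next
    assume "3 \<le> t"
    then show ?thesis by (auto simp: max_def power3_eq_cube algebra_simps)
  qed (use that in \<open>simp add: max_def\<close>)
  show "\<bar>?G2 t\<bar> \<le> 1" for t by (auto simp: max_def abs_if)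
  show "?G2 t = 0" if "t \<notin> {1..3}" for t using that by (auto simp: max_def)
qed

definition bump :: "real \<Rightarrow> real" where
  "bump s = max 0 ((s - 1) * (4 - s)) ^ 3"

lemma bump_nonneg: "bump s \<ge> 0" and bump_eq_0: "s \<notin> {1<..<4} \<Longrightarrow> bump s = 0"
  and bump_pos: "s \<in> {1<..<4} \<Longrightarrow> bump s > 0"
proof -
  show "s \<notin> {1<..<4} \<Longrightarrow> bump s = 0"
    by (auto simp: bump_def max_def mult_le_0_iff not_less zero_le_mult_iff)
qed (auto simp: bump_def)

lemma continuous_on_bump [continuous_intros]:
  "continuous_on S f \<Longrightarrow> continuous_on S (\<lambda>x. bump (f x))"
  unfolding bump_def by (intro continuous_intros)

lemma bump_powr_derivatives:
  obtains B1 B2 where "\<forall>s>0. ((\<lambda>s. bump s * s powr a) has_real_derivative B1 s) (at s)"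
      "\<forall>s>0. (B1 has_real_derivative B2 s) (at s)" "continuous_on {0<..} B2"
      "\<And>s. s \<notin> {1..4} \<Longrightarrow> B1 s = 0"
proof -
  let ?q = "\<lambda>s::real. max 0 ((s - 1) * (4 - s))"
  have q: "((\<lambda>s. ?q s ^ Suc n) has_real_derivative real (Suc n) * ?q s ^ n * (5 - 2 * s)) (at s)" if "n > 0" for n s
    by (rule DERIV_chain2[OF DERIV_pos_part_power[OF that]]) (auto intro!: derivative_eq_intros simp: algebra_simps)
  have q3: "((\<lambda>s. ?q s ^ 3) has_real_derivative 3 * ?q s ^ 2 * (5 - 2 * s)) (at s)" for s
    using q[of 2 s] by (simp add: eval_nat_numeral)
  have q2: "((\<lambda>s. ?q s ^ 2) has_real_derivative 2 * ?q s * (5 - 2 * s)) (at s)" for s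
    using q[of 1 s] by (simp add: eval_nat_numeral)
  define p where "p b s = s powr b" for b s :: real
  have p: "(p b has_real_derivative b * p (b - 1) s) (at s)" if "s > 0" for b s
    unfolding p_def using that by (auto intro!: derivative_eq_intros simp: powr_diff)
  have pc: "continuous_on {0<..} (p b)" for b
    unfolding p_def by (intro continuous_intros) auto
  define B1 where "B1 s = 3 * ?q s ^ 2 * (5 - 2 * s) * p a s + ?q s ^ 3 * (a * p (a - 1) s)" for s
  define B2 where "B2 s = 3 * ((2 * ?q s * (5 - 2 * s)) * (5 - 2 * s) - 2 * ?q s ^ 2) * p a s
     + 3 * ?q s ^ 2 * (5 - 2 * s) * (a * p (a - 1) s)
     + ((3 * ?q s ^ 2 * (5 - 2 * s)) * (a * p (a - 1) s) + ?q s ^ 3 * (a * ((a - 1) * p (a - 1 - 1) s)))" for s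
  show ?thesis
  proof
    show "\<forall>s>0. ((\<lambda>s. bump s * s powr a) has_real_derivative B1 s) (at s)"
      unfolding bump_def p_def[symmetric] B1_def
      by (intro allI impI) (rule derivative_eq_intros q3 p refl | assumption | simp)+
    show "\<forall>s>0. (B1 has_real_derivative B2 s) (at s)"
      unfolding B1_def[abs_def] B2_def
      by (intro allI impI) (rule derivative_eq_intros q2 q3 p refl | assumption | simp add: algebra_simps)+
    show "continuous_on {0<..} B2"
      unfolding B2_def[abs_def] by (intro continuous_intros pc)
    show "B1 s = 0" if "s \<notin> {1..4}" for s
      using bump_eq_0[of s] that by (auto simp: B1_def bump_def)
  qed
qed

text \<open>Since \<open>radial_extension u\<close> and \<open>f (y / |y|)\<close> depend only on the direction of \<open>y\<close>, this is a positive
constant times the integral of \<open>u f\<close> over the hemisphere.\<close>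
definition moment :: "(real^3 \<Rightarrow> real) \<Rightarrow> (real^3 \<Rightarrow> real) \<Rightarrow> real" where
  "moment u f = integral\<^sup>L lborel
     (\<lambda>y. radial_extension u y * f (y /\<^sub>R norm y) * (bump (y \<bullet> y) / (y \<bullet> y)))"

lemma planar_scale: "planar c m (t *\<^sub>R y) = t ^ m * planar c m y"
proof -
  have "Complex (t * y $ 1) (t * y $ 2) = of_real t * Complex (y $ 1) (y $ 2)"
    by (simp add: complex_eq_iff)
  then have "c * Complex (t * y $ 1) (t * y $ 2) ^ m = of_real (t ^ m) * (c * Complex (y $ 1) (y $ 2) ^ m)"
    by (simp only: power_mult_distrib of_real_power ac_simps)
  then show ?thesis
    unfolding planar_def vector_scaleR_component real_scaleR_def by (simp only: Re_complex_of_real times_complex.sel Im_complex_of_real)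
qed

text \<open>Homogeneity of \<open>planar c m\<close> and of the power of \<open>y\<^sub>3\<close> turns the normalisation \<open>y / |y|\<close> into the factor
\<open>|y|\<^bsup>-(m+k)\<^esup>\<close>, so that the moment is the integral of a polynomial against a radial weight.\<close>
lemma moment_planar:
  "moment u (\<lambda>x. planar c m x * (x $ 3) ^ k) = integral\<^sup>L lborel
     (\<lambda>y. radial_extension u y * planar c m y * (y $ 3) ^ k *
       (bump (y \<bullet> y) * (y \<bullet> y) powr (- (real m + real k) / 2)) / (y \<bullet> y))"
  unfolding moment_def
proof (rule Bochner_Integration.integral_cong[OF refl])
  fix y :: "real^3"
  show "radial_extension u y * (planar c m (y /\<^sub>R norm y) * (y /\<^sub>R norm y) $ 3 ^ k) * (bump (y \<bullet> y) / (y \<bullet> y))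
    = radial_extension u y * planar c m y * (y $ 3) ^ k *
       (bump (y \<bullet> y) * (y \<bullet> y) powr (- (real m + real k) / 2)) / (y \<bullet> y)"
  proof (cases "y = 0")
    case False
    then have pos: "norm y > 0" by simp
    have "(y \<bullet> y) powr (- (real m + real k) / 2) = (norm y powr 2) powr (- (real m + real k) / 2)"
      using False by (simp add: power2_norm_eq_inner[symmetric])
    also have "\<dots> = norm y powr (- real (m + k))"
    proof -
      have e: "2 * (- (real m + real k) / 2) = - real (m + k)" by (simp add: field_simps)
      show ?thesis unfolding powr_powr e ..
    qed
    also have "\<dots> = inverse (norm y) ^ m * inverse (norm y) ^ k"
      by (simp only: powr_minus powr_realpow[OF pos] power_add inverse_mult_distrib power_inverse)
    finally show ?thesis
      unfolding planar_scale vector_scaleR_component real_scaleR_def power_mult_distrib by (simp add: ac_simps)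
  qed simp
qed

section \<open>The recursion between moments\<close>

text \<open>The points of the compact shell where \<open>w\<close> is at least \<open>\<delta>\<close> form a compact set on which
\<open>y\<^sub>3\<close> is positive, so \<open>y\<^sub>3\<close> has a positive minimum there.\<close>
lemma small_near_equator:
  assumes u: "u \<in> dirichlet_eigenspace \<mu>" and "\<delta> > 0"
  obtains \<eta> where "\<eta> > 0" "\<And>y. y \<in> shell \<Longrightarrow> y $ 3 < \<eta> \<Longrightarrow> \<bar>radial_extension u y\<bar> \<le> \<delta>"
proof -
  let ?w = "radial_extension u"
  have c: "continuous_on shell ?w"
    using continuous_on_radial_extension[OF u] by (rule continuous_on_subset) (use zero_notin_shell in auto)
  define T where "T = {y \<in> shell. \<delta> \<le> \<bar>?w y\<bar>}"
  have "T = shell \<inter> (\<lambda>y. \<bar>?w y\<bar>) -` {\<delta>..}" by (auto simp: T_def)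
  moreover have "closed (shell \<inter> (\<lambda>y. \<bar>?w y\<bar>) -` {\<delta>..})"
    by (rule continuous_closed_preimage)
      (use c compact_shell compact_imp_closed in \<open>auto intro!: continuous_intros\<close>)
  ultimately have T: "compact T"
    using compact_Int_closed[OF compact_shell, of T] by (simp add: T_def Int_absorb1)
  show ?thesis
  proof (cases "T = {}")
    case True
    show ?thesis by (rule that[of 1]) (use True in \<open>force simp: T_def not_le\<close>)+
  next
    case False
    have "continuous_on T (\<lambda>y. y $ 3)" by (intro continuous_intros)
    from continuous_attains_inf[OF T False this] obtain y0 where y0: "y0 \<in> T" "\<And>y. y \<in> T \<Longrightarrow> y0 $ 3 \<le> y $ 3" by auto
    have "y0 $ 3 > 0"
      using y0(1) radial_extension_eq_0[OF u, of y0] assms(2) by (force simp: T_def upper_half_space_def)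
    then show ?thesis
      using that[of "y0 $ 3"] y0(2) by (force simp: T_def not_le)
  qed
qed

lemma shell_slab_measure:
  assumes "0 < a"
  shows "measure lborel (shell \<inter> {y. a \<le> y $ 3 \<and> y $ 3 \<le> 3 * a}) \<le> 32 * a"
    and "shell \<inter> {y. a \<le> y $ 3 \<and> y $ 3 \<le> 3 * a} \<in> fmeasurable lborel"
proof -
  let ?T = "shell \<inter> {y. a \<le> y $ 3 \<and> y $ 3 \<le> 3 * a}"
  let ?l = "vector [-2, -2, a] :: real^3" and ?u = "vector [2, 2, 3 * a] :: real^3"
  have sub: "?T \<subseteq> cbox ?l ?u"
  proof
    fix y assume y: "y \<in> ?T"
    then have "y \<bullet> y \<le> 2^2" by (simp add: shell_def)
    then have "norm y \<le> 2" by (simp add: norm_le_square power2_eq_square)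
    then have "\<bar>y $ i\<bar> \<le> 2" for i using component_le_norm_cart[of y i] by linarith
    then have "- 2 \<le> y $ i \<and> y $ i \<le> 2" for i by (metis abs_le_iff minus_le_iff)
    then show "y \<in> cbox ?l ?u" using y by (simp add: mem_box_cart forall_3)
  qed
  have "closed {y::real^3. a \<le> y $ 3 \<and> y $ 3 \<le> 3 * a}"
    by (intro closed_Collect_conj closed_Collect_le continuous_intros)
  then have "compact ?T" using compact_shell compact_Int_closed by blast
  then show T: "?T \<in> fmeasurable lborel"
    by (rule fmeasurable_compact)
  have "measure lborel ?T \<le> measure lborel (cbox ?l ?u)"
    by (rule measure_mono_fmeasurable[OF sub]) (use T emeasure_lborel_cbox_finite in \<open>auto simp: fmeasurable_def\<close>)
  also have "measure lborel (cbox ?l ?u) = (\<Prod>i\<in>UNIV. ?u $ i - ?l $ i)"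
    by (rule content_cbox_cart) (use assms in \<open>simp add: interval_ne_empty_cart forall_3\<close>)
  also have "\<dots> = 32 * a"
  proof -
    have p3: "(\<Prod>i\<in>UNIV. f i) = f 1 * f 2 * f 3" for f :: "3 \<Rightarrow> real"
      unfolding UNIV_3 by (simp add: ac_simps)
    show ?thesis unfolding p3 vector_3 by simp
  qed
  finally show "measure lborel ?T \<le> 32 * a" .
qed

text \<open>Apply the weak equation with \<open>A(z) = G(N z) / N \<cdot> z\<^sup>j\<close>, where \<open>G\<close> is the ramp, and with
\<open>B(s) = bump(s) s\<^bsup>-d/2\<^esup>\<close>, where \<open>d = m + j + 1\<close>; then let \<open>N\<close> tend to infinity, so that \<open>A\<close> tends to
\<open>z\<^bsup>j+1\<^esup>\<close>. All terms converge dominatedly except the one containing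
\<open>N G''(N y\<^sub>3)\<close>. That one is of size \<open>N\<close> on a slab of volume of order \<open>1/N\<close> next to the equatorial plane,
and it tends to zero because \<open>w\<close> is small there; this is where the boundary condition enters.\<close>
lemma moment_recursion:
  assumes u: "u \<in> dirichlet_eigenspace \<mu>"
  shows "(\<mu> - real (m + Suc j) * (real (m + Suc j) + 1)) * moment u (\<lambda>x. planar c m x * (x $ 3) ^ Suc j)
    + real (j * Suc j) * moment u (\<lambda>x. planar c m x * (x $ 3) ^ (j - 1)) = 0"
proof -
  let ?w = "radial_extension u" and ?h = "planar c m"
  define d where "d = real m + real (Suc j)"
  define B where "B s = bump s * s powr (- d / 2)" for s
  obtain B1 B2 where B: "\<forall>s>0. (B has_real_derivative B1 s) (at s)"
      "\<forall>s>0. (B1 has_real_derivative B2 s) (at s)" "continuous_on {0<..} B2"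
      and B10: "\<And>s. s \<notin> {1..4} \<Longrightarrow> B1 s = 0"
    using bump_powr_derivatives[of "- d / 2"] unfolding B_def[abs_def] by blast
  have B0: "B s = 0" if "s \<notin> {1..4}" for s using bump_eq_0[of s] that by (auto simp: B_def)
  have Bc: "continuous_on {0<..} B" using B(1) DERIV_isCont by (intro continuous_at_imp_continuous_on) auto
  have B1c: "continuous_on {0<..} B1" using B(2) DERIV_isCont by (intro continuous_at_imp_continuous_on) auto
  obtain G G1 G2 where G: "\<And>t. (G has_real_derivative G1 t) (at t)" "\<And>t. (G1 has_real_derivative G2 t) (at t)"
    "continuous_on UNIV G2"
    and G_le1: "\<And>t. t \<le> 1 \<Longrightarrow> G t = 0" and G_ge3: "\<And>t. t \<ge> 3 \<Longrightarrow> G t = t - 2" "\<And>t. t \<ge> 3 \<Longrightarrow> G1 t = 1"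
    and G1_bd: "\<And>t. 0 \<le> G1 t \<and> G1 t \<le> 1" and G_bd: "\<And>t. t \<ge> 0 \<Longrightarrow> 0 \<le> G t \<and> G t \<le> t"
    and G2_bd: "\<And>t. \<bar>G2 t\<bar> \<le> 1" and G2_supp: "\<And>t. t \<notin> {1..3} \<Longrightarrow> G2 t = 0"
    using smooth_ramp_exists by blast
  have Gc: "continuous_on UNIV G" using G(1) DERIV_isCont continuous_at_imp_continuous_on by blast
  have G1c: "continuous_on UNIV G1" using G(2) DERIV_isCont continuous_at_imp_continuous_on by blast
  have sh0: "y \<noteq> 0" "y \<bullet> y > 0" "y \<bullet> y \<noteq> 0" if "y \<in> shell" for y using that by (auto simp: shell_def)
  have wc: "continuous_on shell ?w"
    using continuous_on_radial_extension[OF u] by (rule continuous_on_subset) (use sh0 in auto)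
  have hc: "continuous_on shell ?h" by (rule continuous_on_planar)
  have Bsc: "continuous_on shell (\<lambda>y. B (y \<bullet> y))" "continuous_on shell (\<lambda>y. B1 (y \<bullet> y))"
    by (rule continuous_on_radial[OF Bc] continuous_on_radial[OF B1c]; use sh0 in simp)+
  have Gsc: "continuous_on shell (\<lambda>y. G (N * y $ 3))" "continuous_on shell (\<lambda>y. G1 (N * y $ 3))"
    "continuous_on shell (\<lambda>y. G2 (N * y $ 3))" for N
    by (rule continuous_on_compose2[OF Gc] continuous_on_compose2[OF G1c] continuous_on_compose2[OF G(3)];
        auto intro!: continuous_intros)+
  have off: "B (y \<bullet> y) = 0" "B1 (y \<bullet> y) = 0" if "y \<notin> shell" for y
    using that B0 B10 by (auto simp: shell_def)
  define E where "E y = 2 * B1 (y \<bullet> y) - d * B (y \<bullet> y) / (y \<bullet> y)" for y :: "real^3"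
  have Ec: "continuous_on shell E"
    unfolding E_def[abs_def] by (intro continuous_intros Bsc) (use sh0 in auto)
  have Eoff: "E y = 0" if "y \<notin> shell" for y using off[OF that] by (simp add: E_def)
  define \<kappa> where "\<kappa> = \<mu> - d * (d + 1)"
  \<comment> \<open>\<open>F N\<close> and \<open>S N\<close> are the regular and the singular part of the weak equation, \<open>L\<close> is the limit
     of the regular part.\<close>
  define F where "F N y = ?w y * ?h y * ((2 * real j * G1 (N * y $ 3) * (y $ 3) ^ (j - 1)
       + real j * real (j - 1) * (G (N * y $ 3) / N) * (y $ 3) ^ (j - 2)) * B (y \<bullet> y)
     + \<kappa> * (G (N * y $ 3) / N * (y $ 3) ^ j * B (y \<bullet> y) / (y \<bullet> y))
     + (y $ 3) ^ j * (y $ 3 * G1 (N * y $ 3) - G (N * y $ 3) / N) * E y)" for N :: real and y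
  define S where "S N y = ?w y * ?h y * (y $ 3) ^ j * B (y \<bullet> y) * (N * G2 (N * y $ 3))" for N :: real and y
  define L where "L y = ?w y * ?h y * (real j * real (Suc j) * (y $ 3) ^ (j - 1) * B (y \<bullet> y)
     + \<kappa> * ((y $ 3) ^ Suc j * B (y \<bullet> y) / (y \<bullet> y)))" for y
  have F_int: "integrable lborel (F N)" if "N > 0" for N
    by (rule integrable_compact_support[OF compact_shell])
      (use that sh0 off Eoff in \<open>auto simp: F_def[abs_def] intro!: continuous_intros wc hc Bsc Gsc Ec\<close>)
  have S_int: "integrable lborel (S N)" for N
    by (rule integrable_compact_support[OF compact_shell])
      (use off in \<open>auto simp: S_def[abs_def] intro!: continuous_intros wc hc Bsc Gsc\<close>)
  have L_int: "integrable lborel L"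
    by (rule integrable_compact_support[OF compact_shell])
      (use sh0 off in \<open>auto simp: L_def[abs_def] intro!: continuous_intros wc hc Bsc simp del: power_Suc\<close>)
  have eq: "integral\<^sup>L lborel (F N) + integral\<^sup>L lborel (S N) = 0" if N: "N > 0" for N
  proof -
    define A where "A z = G (N * z) / N * z ^ j" for z
    define A1 where "A1 z = G1 (N * z) * z ^ j + G (N * z) / N * (real j * z ^ (j - 1))" for z
    define A2 where "A2 z = N * G2 (N * z) * z ^ j + 2 * (G1 (N * z) * (real j * z ^ (j - 1)))
       + G (N * z) / N * (real j * (real (j - 1) * z ^ (j - 2)))" for z
    have n: "((\<lambda>z. N * z) has_real_derivative N) (at z)" for z by (auto intro!: derivative_eq_intros)
    have g: "((\<lambda>z. G (N * z)) has_real_derivative G1 (N * z) * N) (at z)" for z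
      by (rule DERIV_chain2[OF G(1) n])
    have g1: "((\<lambda>z. G1 (N * z)) has_real_derivative G2 (N * z) * N) (at z)" for z
      by (rule DERIV_chain2[OF G(2) n])
    have p: "((\<lambda>z::real. z ^ i) has_real_derivative real i * z ^ (i - 1)) (at z)" for z i
      using DERIV_pow[of i z UNIV] by simp
    have A: "(A has_real_derivative A1 z) (at z)" for z
      unfolding A_def[abs_def] A1_def
      by (rule DERIV_cong[OF DERIV_mult[OF DERIV_cdivide[OF g] p]]) (use N in \<open>simp add: field_simps\<close>)
    have A1: "(A1 has_real_derivative A2 z) (at z)" for z
    proof -
      have "(A1 has_real_derivative (G2 (N * z) * N) * z ^ j + real j * z ^ (j - 1) * G1 (N * z)
         + (G1 (N * z) * N / N * (real j * z ^ (j - 1)) + real j * (real (j - 1) * z ^ (j - 1 - 1)) * (G (N * z) / N))) (at z)"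
        unfolding A1_def[abs_def]
        by (intro DERIV_add DERIV_mult DERIV_cdivide DERIV_cmult g g1 p)
      then show ?thesis
      proof (rule DERIV_cong)
        have "j - 1 - 1 = j - 2" by simp
        then show "(G2 (N * z) * N) * z ^ j + real j * z ^ (j - 1) * G1 (N * z)
         + (G1 (N * z) * N / N * (real j * z ^ (j - 1)) + real j * (real (j - 1) * z ^ (j - 1 - 1)) * (G (N * z) / N)) = A2 z"
          using N by (simp add: A2_def)
      qed
    qed
    have A2c: "continuous_on UNIV A2"
      unfolding A2_def[abs_def]
      by (intro continuous_intros continuous_on_compose2[OF Gc] continuous_on_compose2[OF G1c] continuous_on_compose2[OF G(3)])
        (use N in auto)
    have A0: "A t = 0" if "t < 1 / N" for t
      using G_le1[of "N * t"] that N by (simp add: A_def field_simps)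
    have N': "1 / N > 0" using N by simp
    note W = weak_equation[OF u A A1 A2c N' A0 B B0, of c m "real (Suc j)", folded d_def]
    have "?w y * ?h y * (A2 (y $ 3) * B (y \<bullet> y) + (\<mu> - d * (d + 1)) * (A (y $ 3) * B (y \<bullet> y) / (y \<bullet> y))
       + (y $ 3 * A1 (y $ 3) - real (Suc j) * A (y $ 3)) * (2 * B1 (y \<bullet> y) - d * B (y \<bullet> y) / (y \<bullet> y))) = F N y + S N y" for y
    proof -
      have "y $ 3 * (real j * (y $ 3) ^ (j - 1)) = real j * (y $ 3) ^ j" by (cases j) simp_all
      then have "y $ 3 * A1 (y $ 3) = y $ 3 * G1 (N * y $ 3) * (y $ 3) ^ j + G (N * y $ 3) / N * (real j * (y $ 3) ^ j)"
        by (simp only: A1_def distrib_left mult.left_commute[of "y $ 3" "G (N * y $ 3) / N"] mult.assoc)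
      then have e: "y $ 3 * A1 (y $ 3) - real (Suc j) * A (y $ 3) = (y $ 3) ^ j * (y $ 3 * G1 (N * y $ 3) - G (N * y $ 3) / N)"
        by (simp add: A_def algebra_simps add_divide_distrib)
      show ?thesis
        unfolding F_def S_def \<kappa>_def[symmetric] E_def[symmetric] e
        by (simp add: A2_def A_def algebra_simps)
    qed
    then have "integral\<^sup>L lborel (\<lambda>y. F N y + S N y) = 0" using W(1) by simp
    then show ?thesis using F_int[OF N] S_int by simp
  qed
  define N where "N n = real (Suc n)" for n
  have N: "N n > 0" for n by (simp add: N_def)
  have N_lim: "(\<lambda>n. 2 / N n) \<longlonglongrightarrow> 0"
    using tendsto_mult_right_zero[OF LIMSEQ_inverse_real_of_nat, of 2] by (simp add: N_def divide_inverse)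
  have F_lim: "(\<lambda>n. F (N n) y) \<longlonglongrightarrow> L y" for y
  proof (cases "y \<in> upper_half_space")
    case False
    then show ?thesis by (simp add: F_def L_def radial_extension_eq_0[OF u])
  next
    case True
    define z where "z = y $ 3"
    have z: "z > 0" using True by (simp add: z_def upper_half_space_def)
    define F' where "F' x = ?w y * ?h y * ((2 * real j * z ^ (j - 1)
         + real j * real (j - 1) * (z - x) * z ^ (j - 2)) * B (y \<bullet> y)
       + \<kappa> * ((z - x) * z ^ j * B (y \<bullet> y) / (y \<bullet> y)) + z ^ j * x * E y)" for x
    define b where "b = ?w y * ?h y * (z ^ j * E y - real j * real (j - 1) * z ^ (j - 2) * B (y \<bullet> y)
       - \<kappa> * (z ^ j * (B (y \<bullet> y) / (y \<bullet> y))))"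
    have lin: "F' x = F' 0 + b * x" for x
      by (simp add: F'_def b_def diff_divide_distrib algebra_simps)
    have "(\<lambda>n. F' 0 + b * (2 / N n)) \<longlonglongrightarrow> F' 0 + b * 0"
      by (intro tendsto_add tendsto_const tendsto_mult N_lim)
    then have "(\<lambda>n. F' (2 / N n)) \<longlonglongrightarrow> F' 0"
      unfolding lin[symmetric] by (simp add: lin[symmetric])
    moreover have "F' 0 = L y"
    proof -
      have "real j * real (j - 1) * z * z ^ (j - 2) = real j * real (j - 1) * z ^ (j - 1)"
        by (cases j; cases "j - 1") (auto simp: numeral_2_eq_2)
      moreover have "real j * real (Suc j) * z ^ (j - 1) = 2 * real j * z ^ (j - 1) + real j * real (j - 1) * z ^ (j - 1)"
        by (cases j) (simp_all add: algebra_simps)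
      ultimately show ?thesis by (simp add: F'_def L_def z_def[symmetric])
    qed
    moreover have "\<forall>\<^sub>F n in sequentially. F' (2 / N n) = F (N n) y"
    proof -
      have "\<forall>\<^sub>F n in sequentially. 3 / z \<le> real n"
        using filterlim_real_sequentially by (simp add: filterlim_at_top)
      then show ?thesis
      proof (rule eventually_mono)
        fix n assume "3 / z \<le> real n"
        then have "3 / z \<le> N n" by (simp add: N_def)
        then have 3: "N n * z \<ge> 3" using z by (simp add: field_simps)
        have e: "G (N n * z) / N n = z - 2 / N n" "G1 (N n * z) = 1"
          using G_ge3[OF 3] N[of n] by (simp_all add: field_simps)
        show "F' (2 / N n) = F (N n) y"
          unfolding F'_def F_def z_def[symmetric] e by simp
      qed
    qed
    ultimately show ?thesis using tendsto_cong by fastforce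
  qed
  \<comment> \<open>A dominating function, from \<open>0 \<le> G' \<le> 1\<close> and \<open>0 \<le> G(N z) / N \<le> z\<close>.\<close>
  define H where "H y = \<bar>?w y * ?h y\<bar> * ((2 * real j * \<bar>y $ 3\<bar> ^ (j - 1)
       + real j * real (j - 1) * \<bar>y $ 3\<bar> * \<bar>y $ 3\<bar> ^ (j - 2)) * \<bar>B (y \<bullet> y)\<bar>
     + \<bar>\<kappa>\<bar> * (\<bar>y $ 3\<bar> * \<bar>y $ 3\<bar> ^ j * \<bar>B (y \<bullet> y)\<bar> / (y \<bullet> y))
     + \<bar>y $ 3\<bar> ^ j * (2 * \<bar>y $ 3\<bar>) * \<bar>E y\<bar>)" for y
  have H_int: "integrable lborel H"
    by (rule integrable_compact_support[OF compact_shell])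
      (use sh0 off Eoff in \<open>auto simp: H_def[abs_def] intro!: continuous_intros wc hc Bsc Ec\<close>)
  have FH: "norm (F (N n) y) \<le> H y" for n y
  proof (cases "y \<in> upper_half_space")
    case False
    then show ?thesis by (simp add: F_def H_def radial_extension_eq_0[OF u])
  next
    case True
    define z where "z = y $ 3"
    have z: "z > 0" using True by (simp add: z_def upper_half_space_def)
    define g where "g = G (N n * z) / N n"
    have g: "0 \<le> g" "g \<le> z"
      using G_bd[of "N n * z"] N[of n] z by (simp_all add: g_def field_simps)
    define g1 where "g1 = G1 (N n * z)"
    have g1: "0 \<le> g1" "g1 \<le> 1" using G1_bd by (simp_all add: g1_def)
    have s: "y \<bullet> y \<ge> 0" by simp
    have "2 * real j * g1 * z ^ (j - 1) \<le> 2 * real j * 1 * z ^ (j - 1)"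
      "0 \<le> 2 * real j * g1 * z ^ (j - 1)"
      using g1 z by (intro mult_right_mono mult_left_mono mult_nonneg_nonneg; simp)+
    moreover have "real j * real (j - 1) * g * z ^ (j - 2) \<le> real j * real (j - 1) * z * z ^ (j - 2)"
      "0 \<le> real j * real (j - 1) * g * z ^ (j - 2)"
      using g z by (intro mult_right_mono mult_left_mono mult_nonneg_nonneg; simp)+
    ultimately have "\<bar>2 * real j * g1 * z ^ (j - 1) + real j * real (j - 1) * g * z ^ (j - 2)\<bar>
       \<le> 2 * real j * z ^ (j - 1) + real j * real (j - 1) * z * z ^ (j - 2)" by simp
    then have 1: "\<bar>(2 * real j * g1 * z ^ (j - 1) + real j * real (j - 1) * g * z ^ (j - 2)) * B (y \<bullet> y)\<bar>
       \<le> (2 * real j * z ^ (j - 1) + real j * real (j - 1) * z * z ^ (j - 2)) * \<bar>B (y \<bullet> y)\<bar>"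
      unfolding abs_mult by (rule mult_right_mono) simp
    have "g * z ^ j * \<bar>B (y \<bullet> y)\<bar> \<le> z * z ^ j * \<bar>B (y \<bullet> y)\<bar>"
      using g z by (intro mult_right_mono) simp_all
    then have "g * z ^ j * \<bar>B (y \<bullet> y)\<bar> / (y \<bullet> y) \<le> z * z ^ j * \<bar>B (y \<bullet> y)\<bar> / (y \<bullet> y)"
      using s by (rule divide_right_mono)
    moreover have "\<bar>g * z ^ j * B (y \<bullet> y) / (y \<bullet> y)\<bar> = g * z ^ j * \<bar>B (y \<bullet> y)\<bar> / (y \<bullet> y)"
      using g z s by (simp add: abs_mult)
    ultimately have "\<bar>g * z ^ j * B (y \<bullet> y) / (y \<bullet> y)\<bar> \<le> z * z ^ j * \<bar>B (y \<bullet> y)\<bar> / (y \<bullet> y)"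
      by (simp only:)
    then have 2: "\<bar>\<kappa> * (g * z ^ j * B (y \<bullet> y) / (y \<bullet> y))\<bar> \<le> \<bar>\<kappa>\<bar> * (z * z ^ j * \<bar>B (y \<bullet> y)\<bar> / (y \<bullet> y))"
      unfolding abs_mult[of \<kappa>] by (rule mult_left_mono) simp
    have "z * g1 \<le> z * 1" using g1 z by (intro mult_left_mono) auto
    then have "\<bar>z * g1 - g\<bar> \<le> 2 * z" using g g1 z mult_nonneg_nonneg[of z g1] by linarith
    then have "\<bar>z ^ j * (z * g1 - g)\<bar> \<le> z ^ j * (2 * z)"
      using z by (simp add: abs_mult)
    then have 3: "\<bar>z ^ j * (z * g1 - g) * E y\<bar> \<le> z ^ j * (2 * z) * \<bar>E y\<bar>"
      unfolding abs_mult[of _ "E y"] by (rule mult_right_mono) simp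
    have az: "\<bar>y $ 3\<bar> = z" using z by (simp add: z_def)
    have tri: "\<bar>p + q + r\<bar> \<le> p' + q' + r'" if "\<bar>p\<bar> \<le> p'" "\<bar>q\<bar> \<le> q'" "\<bar>r\<bar> \<le> r'"
      for p q r p' q' r' :: real using that by linarith
    show ?thesis
      unfolding F_def H_def az unfolding z_def[symmetric] g_def[symmetric] g1_def[symmetric] real_norm_def abs_mult[of "?w y * ?h y"]
      by (rule mult_left_mono[OF tri[OF 1 2 3]]) simp
  qed
  have limF: "(\<lambda>n. integral\<^sup>L lborel (F (N n))) \<longlonglongrightarrow> integral\<^sup>L lborel L"
    by (rule integral_dominated_convergence[OF _ _ H_int])
      (use L_int F_int N F_lim FH in auto)
  have limS: "(\<lambda>n. integral\<^sup>L lborel (S (N n))) \<longlonglongrightarrow> 0"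
  proof -
    have "continuous_on shell (\<lambda>y. ?h y * (y $ 3) ^ j * B (y \<bullet> y))"
      by (intro continuous_intros hc Bsc)
    then have "bounded ((\<lambda>y. ?h y * (y $ 3) ^ j * B (y \<bullet> y)) ` shell)"
      using compact_shell compact_continuous_image compact_imp_bounded by blast
    then obtain M where M: "M > 0" "\<And>y. y \<in> shell \<Longrightarrow> \<bar>?h y * (y $ 3) ^ j * B (y \<bullet> y)\<bar> \<le> M"
      unfolding bounded_pos by auto
    have key: "\<forall>\<^sub>F n in sequentially. \<bar>integral\<^sup>L lborel (S (N n))\<bar> < e" if e: "e > 0" for e
    proof -
      \<comment> \<open>The slab has volume at most \<open>32 / N\<close>, so that this choice leaves a bound of \<open>e / 2\<close>.\<close>
      define \<delta> where "\<delta> = e / (64 * M)"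
      have \<delta>: "\<delta> > 0" using e M by (simp add: \<delta>_def)
      obtain \<eta> where \<eta>: "\<eta> > 0" "\<And>y. y \<in> shell \<Longrightarrow> y $ 3 < \<eta> \<Longrightarrow> \<bar>?w y\<bar> \<le> \<delta>"
        using small_near_equator[OF u \<delta>] by blast
      have "\<forall>\<^sub>F n in sequentially. 4 / \<eta> \<le> real n"
        using filterlim_real_sequentially by (simp add: filterlim_at_top)
      then show ?thesis
      proof (rule eventually_mono)
        fix n assume "4 / \<eta> \<le> real n"
        then have "4 / \<eta> \<le> N n" by (simp add: N_def)
        then have n: "3 * (1 / N n) < \<eta>" using \<eta>(1) N[of n] by (simp add: field_simps)
        let ?T = "shell \<inter> {y. 1 / N n \<le> y $ 3 \<and> y $ 3 \<le> 3 * (1 / N n)}"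
        note T = shell_slab_measure[of "1 / N n"]
        have b: "norm (S (N n) y) \<le> (\<delta> * M * N n) * indicator ?T y" for y
        proof (cases "y \<in> ?T")
          case True
          then have "\<bar>?w y\<bar> \<le> \<delta>" using \<eta>(2)[of y] n by auto
          moreover have "\<bar>?h y * (y $ 3) ^ j * B (y \<bullet> y)\<bar> \<le> M" using True M by auto
          moreover have "\<bar>N n * G2 (N n * y $ 3)\<bar> \<le> N n" using G2_bd[of "N n * y $ 3"] N[of n] by (simp add: abs_mult)
          ultimately have "\<bar>?w y\<bar> * \<bar>?h y * (y $ 3) ^ j * B (y \<bullet> y)\<bar> * \<bar>N n * G2 (N n * y $ 3)\<bar> \<le> \<delta> * M * N n"
            using \<delta> M by (intro mult_mono) auto
          then show ?thesis using True by (simp add: S_def abs_mult mult.assoc)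
        next
          case False
          then have "y \<notin> shell \<or> N n * y $ 3 \<notin> {1..3}" using N[of n] by (auto simp: field_simps)
          then have "S (N n) y = 0" using off G2_supp by (auto simp: S_def)
          then show ?thesis using False by simp
        qed
        have Ti: "integrable lborel (\<lambda>y. (\<delta> * M * N n) * indicator ?T y :: real)"
          using T(2) N[of n] by (intro integrable_mult_right integrable_real_indicator) (auto simp: fmeasurable_def)
        have "\<bar>integral\<^sup>L lborel (S (N n))\<bar> \<le> integral\<^sup>L lborel (\<lambda>y. (\<delta> * M * N n) * indicator ?T y)"
        proof -
          have "\<bar>integral\<^sup>L lborel (S (N n))\<bar> \<le> integral\<^sup>L lborel (\<lambda>y. norm (S (N n) y))"
            using Bochner_Integration.integral_norm_bound[of lborel "S (N n)"] by simp
          also have "\<dots> \<le> integral\<^sup>L lborel (\<lambda>y. (\<delta> * M * N n) * indicator ?T y)"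
            by (rule Bochner_Integration.integral_mono[OF integrable_norm[OF S_int] Ti b])
          finally show ?thesis .
        qed
        also have "\<dots> = (\<delta> * M * N n) * measure lborel ?T" by simp
        also have "\<dots> \<le> (\<delta> * M * N n) * (32 * (1 / N n))"
          using T(1) N[of n] \<delta> M by (intro mult_left_mono) auto
        also have "\<dots> = e / 2" using N[of n] M by (simp add: \<delta>_def field_simps)
        also have "\<dots> < e" using e by simp
        finally show "\<bar>integral\<^sup>L lborel (S (N n))\<bar> < e" .
      qed
    qed
    show ?thesis by (rule tendstoI) (use key in \<open>simp add: dist_real_def\<close>)
  qed
  have "(\<lambda>n. 0) \<longlonglongrightarrow> integral\<^sup>L lborel L"
    using tendsto_add[OF limF limS] by (simp add: eq[OF N])
  then have "integral\<^sup>L lborel L = 0"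
    by (rule LIMSEQ_unique[OF _ tendsto_const])
  moreover have "integral\<^sup>L lborel L = \<kappa> * moment u (\<lambda>x. ?h x * (x $ 3) ^ Suc j)
     + real (j * Suc j) * moment u (\<lambda>x. ?h x * (x $ 3) ^ (j - 1))"
  proof -
    define f where "f y = ?w y * ?h y * (y $ 3) ^ Suc j * B (y \<bullet> y) / (y \<bullet> y)" for y
    define g where "g y = ?w y * ?h y * (y $ 3) ^ (j - 1) * B (y \<bullet> y)" for y
    have fi: "integrable lborel f"
      by (rule integrable_compact_support[OF compact_shell])
        (use sh0 off in \<open>auto simp: f_def[abs_def] intro!: continuous_intros wc hc Bsc simp del: power_Suc\<close>)
    have gi: "integrable lborel g"
      by (rule integrable_compact_support[OF compact_shell])
        (use off in \<open>auto simp: g_def[abs_def] intro!: continuous_intros wc hc Bsc\<close>)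
    have "L y = \<kappa> * f y + real (j * Suc j) * g y" for y
      unfolding L_def f_def g_def by (simp add: algebra_simps)
    then have "L = (\<lambda>y. \<kappa> * f y + real (j * Suc j) * g y)" by (rule ext)
    then have "integral\<^sup>L lborel L = \<kappa> * integral\<^sup>L lborel f + real (j * Suc j) * integral\<^sup>L lborel g"
      using fi gi by simp
    moreover have "integral\<^sup>L lborel f = moment u (\<lambda>x. ?h x * (x $ 3) ^ Suc j)"
      unfolding moment_planar f_def B_def d_def ..
    moreover have "integral\<^sup>L lborel g = moment u (\<lambda>x. ?h x * (x $ 3) ^ (j - 1))" if "j > 0"
      unfolding moment_planar
    proof (rule Bochner_Integration.integral_cong[OF refl])
      fix y :: "real^3"
      define s where "s = y \<bullet> y"
      have e: "- (real m + real (j - 1)) / 2 = - d / 2 + 1"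
        using that by (simp add: d_def of_nat_diff field_simps)
      have "B s = bump s * s powr (- d / 2 + 1) / s"
      proof (cases "s = 0")
        case False
        then have "s > 0" by (simp add: s_def)
        have "s powr (- d / 2 + 1) = s powr (- d / 2) * s"
          unfolding powr_add using \<open>s > 0\<close> by simp
        then show ?thesis using False unfolding B_def by (simp only: times_divide_eq_right mult.assoc[symmetric] nonzero_mult_div_cancel_right not_False_eq_True)
      qed (simp add: B_def)
      then show "g y = ?w y * ?h y * (y $ 3) ^ (j - 1) * (bump (y \<bullet> y) * (y \<bullet> y) powr (- (real m + real (j - 1)) / 2)) / (y \<bullet> y)"
        unfolding e g_def s_def[symmetric] by (simp only: times_divide_eq_right)
    qed
    ultimately show ?thesis by (cases "j = 0") (simp_all only: mult_0 of_nat_0 mult_zero_left neq0_conv)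
  qed
  moreover have "\<kappa> = \<mu> - real (m + Suc j) * (real (m + Suc j) + 1)" by (simp only: \<kappa>_def d_def of_nat_add)
  ultimately show ?thesis by (simp only:)
qed

section \<open>Completeness of the moments\<close>

lemma planar_add: "planar (c + c') m y = planar c m y + planar c' m y"
  by (simp only: planar_def distrib_right plus_complex.sel)

lemma planar_of_real_mult: "planar (of_real r * c) m y = r * planar c m y"
  unfolding planar_def mult.assoc
  by (simp only: Re_complex_of_real times_complex.sel Im_complex_of_real mult_zero_left diff_zero)

text \<open>This is \<open>y\<^sub>1 = (\<omega> + cnj \<omega>) / 2\<close> together with \<open>\<omega> cnj \<omega> = y\<^sub>1\<^sup>2 + y\<^sub>2\<^sup>2\<close> for
\<open>\<omega> = y\<^sub>1 + \<i> y\<^sub>2\<close>.\<close>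
lemma first_coordinate_planar:
  "y $ 1 * planar c (Suc n) y = planar (c / 2) (Suc (Suc n)) y + ((y $ 1)\<^sup>2 + (y $ 2)\<^sup>2) * planar (c / 2) n y"
proof -
  obtain a b where ab: "c * Complex (y $ 1) (y $ 2) ^ n = Complex a b" by (metis complex_surj)
  have e: "c * Complex (y $ 1) (y $ 2) ^ Suc n = Complex a b * Complex (y $ 1) (y $ 2)"
    "c / 2 * Complex (y $ 1) (y $ 2) ^ Suc (Suc n) = Complex a b * (Complex (y $ 1) (y $ 2) * Complex (y $ 1) (y $ 2)) / 2"
    "c / 2 * Complex (y $ 1) (y $ 2) ^ n = Complex a b / 2"
    unfolding ab[symmetric] by (simp_all only: power_Suc ac_simps times_divide_eq_left times_divide_eq_right)
  show ?thesis unfolding planar_def e by (simp add: field_simps power2_eq_square)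
qed

lemma second_coordinate_planar:
  "y $ 2 * planar c (Suc n) y = planar (- \<i> * c / 2) (Suc (Suc n)) y + ((y $ 1)\<^sup>2 + (y $ 2)\<^sup>2) * planar (\<i> * c / 2) n y"
proof -
  obtain a b where ab: "c * Complex (y $ 1) (y $ 2) ^ n = Complex a b" by (metis complex_surj)
  have e: "c * Complex (y $ 1) (y $ 2) ^ Suc n = Complex a b * Complex (y $ 1) (y $ 2)"
    "- \<i> * c / 2 * Complex (y $ 1) (y $ 2) ^ Suc (Suc n) = - \<i> * (Complex a b * (Complex (y $ 1) (y $ 2) * Complex (y $ 1) (y $ 2))) / 2"
    "\<i> * c / 2 * Complex (y $ 1) (y $ 2) ^ n = \<i> * Complex a b / 2"
    unfolding ab[symmetric] by (simp_all only: power_Suc ac_simps times_divide_eq_left times_divide_eq_right)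
  show ?thesis unfolding planar_def e by (simp add: field_simps power2_eq_square)
qed

text \<open>The linear span of the functions \<open>planar c m x \<cdot> x\<^sub>3\<^bsup>2j\<^esup>\<close>, up to equality on the closed hemisphere;
multiplication by real scalars is absorbed into \<open>c\<close>. Working modulo equality on the hemisphere makes
the relation \<open>x\<^sub>1\<^sup>2 + x\<^sub>2\<^sup>2 = 1 - x\<^sub>3\<^sup>2\<close> available.\<close>
inductive_set even_span :: "(real^3 \<Rightarrow> real) set" where
  gen: "(\<lambda>x. planar c m x * (x $ 3) ^ (2 * j)) \<in> even_span"
| add: "f \<in> even_span \<Longrightarrow> g \<in> even_span \<Longrightarrow> (\<lambda>x. f x + g x) \<in> even_span"
| cong: "f \<in> even_span \<Longrightarrow> (\<And>x. x \<in> closed_hemisphere \<Longrightarrow> f x = g x) \<Longrightarrow> g \<in> even_span"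

lemma closed_hemisphere_sum_squares:
  "x \<in> closed_hemisphere \<Longrightarrow> (x $ 1)\<^sup>2 + (x $ 2)\<^sup>2 = 1 - (x $ 3)\<^sup>2"
  by (simp add: closed_hemisphere_def norm_eq_1 inner_vec_def sum_3 power2_eq_square)

lemma continuous_on_even_span: "f \<in> even_span \<Longrightarrow> continuous_on closed_hemisphere f"
proof (induction rule: even_span.induct)
  case (cong f g)
  then show ?case by (metis continuous_on_eq)
qed (auto intro!: continuous_intros continuous_on_planar)

lemma even_span_scale: "f \<in> even_span \<Longrightarrow> (\<lambda>x. r * f x) \<in> even_span"
proof (induction rule: even_span.induct)
  case (gen c m j)
  show ?case
    by (rule even_span.cong[OF even_span.gen[of "of_real r * c" m j]]) (simp only: planar_of_real_mult mult.assoc)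
next
  case (add f g)
  show ?case
    by (rule even_span.cong[OF even_span.add[OF add.IH]]) (simp add: distrib_left)
next
  case (cong f g)
  show ?case by (rule even_span.cong[OF cong.IH]) (simp add: cong.hyps)
qed

lemma even_span_multiplierI:
  assumes "\<And>c m j. (\<lambda>x. p x * (planar c m x * (x $ 3) ^ (2 * j))) \<in> even_span" "f \<in> even_span"
  shows "(\<lambda>x. p x * f x) \<in> even_span"
  using assms(2)
proof (induction rule: even_span.induct)
  case (gen c m j)
  show ?case by (rule assms(1))
next
  case (add f g)
  show ?case
    by (rule even_span.cong[OF even_span.add[OF add.IH]]) (simp add: distrib_left)
next
  case (cong f g)
  show ?case by (rule even_span.cong[OF cong.IH]) (simp add: cong.hyps)
qed

lemma even_span_third_squared: "f \<in> even_span \<Longrightarrow> (\<lambda>x. (x $ 3)\<^sup>2 * f x) \<in> even_span"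
proof (rule even_span_multiplierI)
  show "(\<lambda>x. (x $ 3)\<^sup>2 * (planar c m x * (x $ 3) ^ (2 * j))) \<in> even_span" for c m j
    by (rule even_span.cong[OF even_span.gen[of c m "Suc j"]]) (simp add: power2_eq_square)
qed

text \<open>Multiplying by \<open>x\<^sub>1\<close> or \<open>x\<^sub>2\<close> raises or lowers \<open>m\<close> by one. Lowering costs a factor
\<open>x\<^sub>1\<^sup>2 + x\<^sub>2\<^sup>2\<close>, which is \<open>1 - x\<^sub>3\<^sup>2\<close> on the hemisphere and so only raises the even power of
\<open>x\<^sub>3\<close>.\<close>
lemma even_span_sphere_coordinate:
  assumes "\<And>c n x. p x * planar c (Suc n) x = planar (a c) (Suc (Suc n)) x + ((x $ 1)\<^sup>2 + (x $ 2)\<^sup>2) * planar (b c) n x"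
    and "\<And>c x. p x * planar c 0 x = planar (d c) 1 x"
    and f: "f \<in> even_span"
  shows "(\<lambda>x. p x * f x) \<in> even_span"
proof (rule even_span_multiplierI[OF _ f])
  fix c m j
  show "(\<lambda>x. p x * (planar c m x * (x $ 3) ^ (2 * j))) \<in> even_span"
  proof (cases m)
    case 0
    show ?thesis
      by (rule even_span.cong[OF even_span.gen[of "d c" 1 j]]) (simp only: 0 assms(2)[symmetric] mult.assoc)
  next
    case (Suc n)
    let ?g = "\<lambda>m c j x. planar c m x * (x $ 3) ^ (2 * j) :: real"
    have "(\<lambda>x. ?g (Suc (Suc n)) (a c) j x + (?g n (b c) j x + (-1) * ((x $ 3)\<^sup>2 * ?g n (b c) j x))) \<in> even_span"
      by (rule even_span.add even_span.gen even_span_scale even_span_third_squared)+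
    then show ?thesis
    proof (rule even_span.cong)
      fix x assume x: "x \<in> closed_hemisphere"
      have "p x * (planar c m x * (x $ 3) ^ (2 * j)) = (p x * planar c (Suc n) x) * (x $ 3) ^ (2 * j)"
        by (simp add: Suc)
      then show "?g (Suc (Suc n)) (a c) j x + (?g n (b c) j x + (-1) * ((x $ 3)\<^sup>2 * ?g n (b c) j x))
          = p x * (planar c m x * (x $ 3) ^ (2 * j))"
        unfolding assms(1) closed_hemisphere_sum_squares[OF x] by (simp add: algebra_simps)
    qed
  qed
qed

lemma even_span_first: "f \<in> even_span \<Longrightarrow> (\<lambda>x. x $ 1 * f x) \<in> even_span"
  by (rule even_span_sphere_coordinate[where p = "\<lambda>x. x $ 1" and d = "\<lambda>c. of_real (Re c)", OF first_coordinate_planar])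
    (simp_all add: planar_def)

lemma even_span_second: "f \<in> even_span \<Longrightarrow> (\<lambda>x. x $ 2 * f x) \<in> even_span"
  by (rule even_span_sphere_coordinate[where p = "\<lambda>x. x $ 2" and d = "\<lambda>c. - \<i> * of_real (Re c)", OF second_coordinate_planar])
    (simp_all add: planar_def)

text \<open>Stone-Weierstrass is applied to the functions that multiply the span into itself, because they
obviously form an algebra. They contain \<open>x\<^sub>1\<close>, \<open>x\<^sub>2\<close> and \<open>x\<^sub>3\<^sup>2\<close>, which separate the points of the
closed hemisphere since \<open>x\<^sub>3 \<ge> 0\<close> there, and they lie in the span since \<open>1\<close> does.\<close>
lemma even_span_dense:
  assumes f: "continuous_on closed_hemisphere f" and e: "e > 0"
  obtains g where "g \<in> even_span" "\<And>x. x \<in> closed_hemisphere \<Longrightarrow> \<bar>f x - g x\<bar> < e"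
proof -
  define P where "P p \<longleftrightarrow> (\<forall>f\<in>even_span. (\<lambda>x. p x * f x) \<in> even_span)" for p
  have one: "(\<lambda>x. 1) \<in> even_span"
    by (rule even_span.cong[OF even_span.gen[of 1 0 0]]) (simp add: planar_def)
  have sub: "p \<in> even_span" if "P p" for p
    using that one unfolding P_def by fastforce
  have cp: "compact closed_hemisphere"
  proof -
    have e: "closed_hemisphere = sphere 0 1 \<inter> {x. 0 \<le> x $ 3}" by (auto simp: closed_hemisphere_def)
    have "closed {x::real^3. 0 \<le> x $ 3}" by (intro closed_Collect_le continuous_intros)
    then show ?thesis unfolding e by (simp add: compact_Int_closed)
  qed
  have "\<exists>g. P g \<and> (\<forall>x\<in>closed_hemisphere. \<bar>f x - g x\<bar> < e)"
  proof (rule Stone_Weierstrass_HOL[OF cp _ _ _ _ _ f e])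
    show "P (\<lambda>x. c)" for c using even_span_scale by (simp add: P_def)
    show "continuous_on closed_hemisphere p" if "P p" for p
      using sub[OF that] by (rule continuous_on_even_span)
    show "P (\<lambda>x. p x + q x)" if "P p \<and> P q" for p q
      using that even_span.add unfolding P_def distrib_right by blast
    show "P (\<lambda>x. p x * q x)" if "P p \<and> P q" for p q
      unfolding P_def mult.assoc
    proof
      fix f assume "f \<in> even_span"
      then have "(\<lambda>x. q x * f x) \<in> even_span" using that unfolding P_def by blast
      moreover from that have "\<forall>f\<in>even_span. (\<lambda>x. p x * f x) \<in> even_span" unfolding P_def by blast
      ultimately show "(\<lambda>x. p x * (q x * f x)) \<in> even_span" by (rule bspec[rotated])
    qed
    fix x y :: "real^3"
    assume "x \<in> closed_hemisphere \<and> y \<in> closed_hemisphere \<and> x \<noteq> y"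
    then have x: "x $ 3 \<ge> 0" and y: "y $ 3 \<ge> 0" and ne: "x \<noteq> y" by (auto simp: closed_hemisphere_def)
    have "x $ 1 \<noteq> y $ 1 \<or> x $ 2 \<noteq> y $ 2 \<or> x $ 3 \<noteq> y $ 3"
      using ne by (auto simp: vec_eq_iff forall_3)
    moreover have "(x $ 3)\<^sup>2 \<noteq> (y $ 3)\<^sup>2" if "x $ 3 \<noteq> y $ 3" using that x y by (simp add: power2_eq_iff)
    moreover have "P (\<lambda>x. x $ 1)" "P (\<lambda>x. x $ 2)" "P (\<lambda>x. (x $ 3)\<^sup>2)"
      unfolding P_def using even_span_first even_span_second even_span_third_squared by auto
    ultimately show "\<exists>f. P f \<and> f x \<noteq> f y" by blast
  qed
  then show ?thesis using that sub by blast
qed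

lemma moment_integrable:
  assumes u: "u \<in> dirichlet_eigenspace \<mu>" and f: "continuous_on closed_hemisphere f"
  shows "integrable lborel (\<lambda>y. radial_extension u y * f (y /\<^sub>R norm y) * (bump (y \<bullet> y) / (y \<bullet> y)))"
proof -
  define K where "K = shell \<inter> {y. 0 \<le> y $ 3}"
  have "closed {y::real^3. 0 \<le> y $ 3}" by (intro closed_Collect_le continuous_intros)
  then have K: "compact K" unfolding K_def using compact_shell compact_Int_closed by blast
  have K0: "y \<noteq> 0" if "y \<in> K" for y using that zero_notin_shell by (auto simp: K_def)
  have wc: "continuous_on K (radial_extension u)"
    using continuous_on_radial_extension[OF u] by (rule continuous_on_subset) (use K0 in auto)
  have fc: "continuous_on K (\<lambda>y. f (y /\<^sub>R norm y))"
    by (rule continuous_on_compose2[OF f])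
      (use K0 in \<open>auto simp: closed_hemisphere_def K_def intro!: continuous_intros\<close>)
  have c: "continuous_on K (\<lambda>y. radial_extension u y * f (y /\<^sub>R norm y) * (bump (y \<bullet> y) / (y \<bullet> y)))"
    by (intro continuous_intros wc fc) (use K0 in auto)
  have z: "radial_extension u y * f (y /\<^sub>R norm y) * (bump (y \<bullet> y) / (y \<bullet> y)) = 0" if "y \<notin> K" for y
  proof -
    have "y \<notin> shell \<or> y \<notin> upper_half_space" using that by (auto simp: K_def upper_half_space_def)
    then show ?thesis
      using radial_extension_eq_0[OF u, of y] bump_eq_0[of "y \<bullet> y"] by (auto simp: shell_def)
  qed
  show ?thesis by (rule integrable_compact_support[OF K c z])
qed

lemma moment_cong:
  assumes u: "u \<in> dirichlet_eigenspace \<mu>" and "\<And>x. x \<in> closed_hemisphere \<Longrightarrow> f x = g x"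
  shows "moment u f = moment u g"
  unfolding moment_def
proof (rule Bochner_Integration.integral_cong[OF refl])
  fix y :: "real^3"
  show "radial_extension u y * f (y /\<^sub>R norm y) * (bump (y \<bullet> y) / (y \<bullet> y))
    = radial_extension u y * g (y /\<^sub>R norm y) * (bump (y \<bullet> y) / (y \<bullet> y))"
  proof (cases "y \<in> upper_half_space")
    case True
    then have "y \<noteq> 0" by (auto simp: upper_half_space_def)
    then have "y /\<^sub>R norm y \<in> closed_hemisphere"
      using True by (auto simp: closed_hemisphere_def upper_half_space_def)
    then show ?thesis using assms(2) by simp
  qed (simp add: radial_extension_eq_0[OF u])
qed

lemma moment_add:
  assumes u: "u \<in> dirichlet_eigenspace \<mu>" and "continuous_on closed_hemisphere f" "continuous_on closed_hemisphere g"
  shows "moment u (\<lambda>x. f x + g x) = moment u f + moment u g"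
  unfolding moment_def
  by (subst Bochner_Integration.integral_add[symmetric, OF moment_integrable[OF assms(1,2)] moment_integrable[OF assms(1,3)]])
    (simp add: algebra_simps)

text \<open>The moment of \<open>x\<^sub>3 g\<close> vanishes for every \<open>g\<close> in the span, hence by density also for \<open>g = u\<close>. The
moment of \<open>x\<^sub>3 u\<close> has a nonnegative integrand, which is positive wherever \<open>u \<noteq> 0\<close> inside the shell.\<close>
theorem eigenfunction_eq_0_if_moments_0:
  assumes u: "u \<in> dirichlet_eigenspace \<mu>"
    and zero: "\<And>c m j. moment u (\<lambda>x. planar c m x * (x $ 3) ^ (2 * j + 1)) = 0"
  shows "u x = 0"
proof -
  let ?w = "radial_extension u"
  have uc: "continuous_on closed_hemisphere u" using u by (simp add: dirichlet_eigenspace_def)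
  have z3: "continuous_on closed_hemisphere (\<lambda>x. x $ 3)" by (intro continuous_intros)
  have span: "moment u (\<lambda>x. x $ 3 * g x) = 0" if "g \<in> even_span" for g
    using that
  proof (induction rule: even_span.induct)
    case (gen c m j)
    show ?case using zero[of c m j] by (simp add: mult.left_commute)
  next
    case (add f g)
    have "continuous_on closed_hemisphere (\<lambda>x. x $ 3 * f x)" "continuous_on closed_hemisphere (\<lambda>x. x $ 3 * g x)"
      by (intro continuous_on_mult z3 continuous_on_even_span add.hyps)+
    from moment_add[OF u this] show ?case using add.IH by (simp add: distrib_left)
  next
    case (cong f g)
    then show ?case using moment_cong[OF u, of "\<lambda>x. x $ 3 * f x" "\<lambda>x. x $ 3 * g x"] by simp
  qed
  define p where "p y = ?w y * (y /\<^sub>R norm y) $ 3 * (bump (y \<bullet> y) / (y \<bullet> y))" for y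
  have p_int: "integrable lborel p"
    unfolding p_def by (rule moment_integrable[OF u z3])
  define C where "C = integral\<^sup>L lborel (\<lambda>y. \<bar>p y\<bar>)"
  have C0: "C \<ge> 0" unfolding C_def by simp
  define I where "I y = p y * ?w y" for y
  have I_eq: "I = (\<lambda>y. ?w y * (\<lambda>x. x $ 3 * u x) (y /\<^sub>R norm y) * (bump (y \<bullet> y) / (y \<bullet> y)))"
    by (rule ext) (simp add: I_def p_def radial_extension_def)
  have I_int: "integrable lborel I"
    unfolding I_eq by (rule moment_integrable[OF u]) (intro continuous_intros uc)
  have I_nonneg: "I y \<ge> 0" for y
  proof (cases "y \<in> upper_half_space")
    case True
    have "I y = (?w y)\<^sup>2 * ((y /\<^sub>R norm y) $ 3 * (bump (y \<bullet> y) / (y \<bullet> y)))"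
      by (simp add: I_def p_def power2_eq_square)
    then show ?thesis using True bump_nonneg[of "y \<bullet> y"] by (simp add: upper_half_space_def)
  qed (simp add: I_def radial_extension_eq_0[OF u])
  have "\<bar>integral\<^sup>L lborel I\<bar> \<le> e" if e: "e > 0" for e
  proof -
    have "e / (C + 1) > 0" using e C0 by simp
    from even_span_dense[OF uc this] obtain g where g: "g \<in> even_span"
      "\<And>x. x \<in> closed_hemisphere \<Longrightarrow> \<bar>u x - g x\<bar> < e / (C + 1)" by blast
    define J where "J y = ?w y * (\<lambda>x. x $ 3 * g x) (y /\<^sub>R norm y) * (bump (y \<bullet> y) / (y \<bullet> y))" for y
    have J_int: "integrable lborel J"
      unfolding J_def by (rule moment_integrable[OF u]) (intro continuous_intros continuous_on_even_span g)
    have "integral\<^sup>L lborel J = 0" using span[OF g(1)] by (simp add: J_def[abs_def] moment_def)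
    then have "integral\<^sup>L lborel I = integral\<^sup>L lborel (\<lambda>y. I y - J y)" using I_int J_int by simp
    then have "\<bar>integral\<^sup>L lborel I\<bar> \<le> integral\<^sup>L lborel (\<lambda>y. \<bar>I y - J y\<bar>)"
      using Bochner_Integration.integral_norm_bound[of lborel "\<lambda>y. I y - J y"] by simp
    also have "\<dots> \<le> integral\<^sup>L lborel (\<lambda>y. \<bar>p y\<bar> * (e / (C + 1)))"
    proof (rule Bochner_Integration.integral_mono)
      show "integrable lborel (\<lambda>y. \<bar>I y - J y\<bar>)" using I_int J_int by simp
      show "integrable lborel (\<lambda>y. \<bar>p y\<bar> * (e / (C + 1)))" using p_int by simp
      fix y :: "real^3"
      have d: "I y - J y = p y * (u (y /\<^sub>R norm y) - g (y /\<^sub>R norm y))"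
        by (simp add: I_eq J_def p_def algebra_simps diff_divide_distrib)
      show "\<bar>I y - J y\<bar> \<le> \<bar>p y\<bar> * (e / (C + 1))"
      proof (cases "y \<in> upper_half_space")
        case True
        then have "y \<noteq> 0" by (auto simp: upper_half_space_def)
        then have "y /\<^sub>R norm y \<in> closed_hemisphere"
          using True by (auto simp: closed_hemisphere_def upper_half_space_def)
        then show ?thesis unfolding d abs_mult using g(2) by (intro mult_left_mono) (auto simp: less_imp_le)
      next
        case False
        then have "p y = 0" by (simp add: p_def radial_extension_eq_0[OF u])
        then show ?thesis unfolding d by simp
      qed
    qed
    also have "\<dots> = C * (e / (C + 1))" by (simp add: C_def)
    also have "\<dots> \<le> e" using e C0 by (simp add: field_simps)
    finally show ?thesis .
  qed
  then have I0: "integral\<^sup>L lborel I = 0" by (metis abs_le_zero_iff field_le_epsilon add_0)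
  then have ae: "AE y in lborel. I y = 0"
    using integral_nonneg_eq_0_iff_AE[OF I_int] I_nonneg by simp
  have "u x = 0" if x: "x \<in> hemisphere" for x
  proof (rule ccontr)
    assume ux: "u x \<noteq> 0"
    define U where "U = {y. y \<bullet> y \<in> {1<..<4}} \<inter> upper_half_space"
    define W where "W = {y \<in> U. ?w y \<in> - {0}}"
    have U: "open U"
    proof -
      have "open {y::real^3. 1 < y \<bullet> y \<and> y \<bullet> y < 4}" by (intro open_Collect_conj open_Collect_less continuous_intros)
      then show ?thesis unfolding U_def using open_upper_half_space by (auto intro!: open_Int)
    qed
    have "continuous_on U ?w"
      using continuous_on_radial_extension[OF u] by (rule continuous_on_subset) (auto simp: U_def)
    then have W: "open W"
    proof -
      have "W = U \<inter> ?w -` (- {0})" by (auto simp: W_def)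
      moreover have "open (U \<inter> ?w -` (- {0}))"
        by (rule continuous_open_preimage[OF \<open>continuous_on U ?w\<close> U]) auto
      ultimately show ?thesis by simp
    qed
    \<comment> \<open>A point on the ray through \<open>x\<close> in the interior of the shell.\<close>
    define y where "y = (3/2) *\<^sub>R x"
    have "x \<bullet> x = 1" "x $ 3 > 0" using x by (auto simp: hemisphere_def norm_eq_1)
    moreover have "?w y = u x" using x by (simp add: y_def radial_extension_def hemisphere_def)
    ultimately have "y \<in> W" using ux by (simp add: W_def U_def y_def upper_half_space_def)
    then have "\<not> negligible W" using open_not_negligible[OF W] by blast
    moreover have "negligible W"
    proof -
      have "I y \<noteq> 0" if "y \<in> W" for y
        using that bump_pos[of "y \<bullet> y"] by (auto simp: W_def U_def I_def p_def upper_half_space_def)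
      then have "AE y in lborel. y \<notin> W" using ae by (auto elim!: eventually_mono)
      then have "W \<in> null_sets lborel" using W by (subst AE_iff_null_sets) auto
      then show ?thesis using negligible_iff_null_sets null_sets_completionI by blast
    qed
    ultimately show False by blast
  qed
  moreover have "u x = 0" if "x \<notin> hemisphere" for x
    using u that by (cases "x \<in> equator") (auto simp: dirichlet_eigenspace_def hemisphere_def closed_hemisphere_def equator_def)
  ultimately show ?thesis by blast
qed

section \<open>Upper bounds on the spectrum\<close>

lemma sum_fun_apply: "(\<Sum>i\<in>I. f i) x = (\<Sum>i\<in>I. f i x)"
  for f :: "'i \<Rightarrow> 'a \<Rightarrow> real"
  by (induction I rule: infinite_finite_induct) (auto simp: zero_fun_def plus_fun_def)

text \<open>Linear independence proper is a property of sets, so for an indexed family injectivity of the indexing has to be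
obtained along with it.\<close>
lemma independent_familyI:
  fixes b :: "nat \<Rightarrow> 'a \<Rightarrow> real"
  assumes "\<And>a. (\<And>x. (\<Sum>i<l. a i * b i x) = 0) \<Longrightarrow> \<forall>i<l. a i = 0"
  shows "inj_on b {..<l}"
    and "\<not> module.dependent (\<lambda>(c::real) (f::'a \<Rightarrow> real) x. c * f x) (b ` {..<l})"
proof -
  interpret V: vector_space "\<lambda>(c::real) (f::'a \<Rightarrow> real) x. c * f x" by (rule vector_space_real_functions)
  show inj: "inj_on b {..<l}"
  proof (rule inj_onI, rule ccontr)
    fix i k assume ik: "i \<in> {..<l}" "k \<in> {..<l}" "b i = b k" "i \<noteq> k"
    define a where "a j = (if j = i then 1 else if j = k then -1 else 0 :: real)" for j
    have "(\<Sum>j<l. a j * b j x) = 0" for x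
    proof -
      have "(\<Sum>j<l. a j * b j x) = (\<Sum>j<l. (if j = i then b i x else 0) - (if j = k then b i x else 0))"
        by (rule sum.cong) (use ik in \<open>auto simp: a_def\<close>)
      then show ?thesis using ik by (simp add: sum_subtractf)
    qed
    then have "a i = 0" using assms ik by blast
    then show False by (simp add: a_def)
  qed
  show "\<not> V.dependent (b ` {..<l})"
  proof
    assume "V.dependent (b ` {..<l})"
    then obtain u where u: "\<exists>v\<in>b ` {..<l}. u v \<noteq> 0" "(\<Sum>v\<in>b ` {..<l}. (\<lambda>x. u v * v x)) = 0"
      by (auto simp: V.dependent_finite)
    have "(\<Sum>i<l. u (b i) * b i x) = 0" for x
    proof -
      have "0 = (\<Sum>v\<in>b ` {..<l}. u v * v x)" using fun_cong[OF u(2), of x] by (simp add: sum_fun_apply)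
      also have "\<dots> = (\<Sum>i<l. u (b i) * b i x)" by (simp add: sum.reindex[OF inj])
      finally show ?thesis by simp
    qed
    then have "\<forall>i<l. u (b i) = 0" using assms[of "\<lambda>i. u (b i)"] by blast
    then show False using u(1) by auto
  qed
qed

text \<open>The vectors \<open>(T\<^sub>j b\<^sub>i)\<^sub>j\<close> are \<open>l\<close> independent elements of an \<open>l\<close>-dimensional space and therefore span
it. So for \<open>v\<close> in \<open>V\<close> some combination of the \<open>b\<^sub>i\<close> has the same values under all functionals as \<open>v\<close>,
and hence equals \<open>v\<close>. Linearity of the functionals is asked for on \<open>V\<close> only, because integrals are additive
only where they converge.\<close>
lemma dim_eq_if_separating_functionals:
  fixes V :: "('a \<Rightarrow> real) set" and b :: "nat \<Rightarrow> 'a \<Rightarrow> real" and T :: "nat \<Rightarrow> ('a \<Rightarrow> real) \<Rightarrow> real"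
  assumes b: "\<And>i. i < l \<Longrightarrow> b i \<in> V"
    and indep: "\<And>a. (\<And>x. (\<Sum>i<l. a i * b i x) = 0) \<Longrightarrow> \<forall>i<l. a i = 0"
    and V0: "(\<lambda>x. 0) \<in> V"
    and V_add: "\<And>f g. f \<in> V \<Longrightarrow> g \<in> V \<Longrightarrow> (\<lambda>x. f x + g x) \<in> V"
    and V_scale: "\<And>c f. f \<in> V \<Longrightarrow> (\<lambda>x. c * f x) \<in> V"
    and T_add: "\<And>j f g. f \<in> V \<Longrightarrow> g \<in> V \<Longrightarrow> T j (\<lambda>x. f x + g x) = T j f + T j g"
    and T_scale: "\<And>j c f. f \<in> V \<Longrightarrow> T j (\<lambda>x. c * f x) = c * T j f"
    and T_inj: "\<And>f x. f \<in> V \<Longrightarrow> (\<And>j. j < l \<Longrightarrow> T j f = 0) \<Longrightarrow> f x = 0"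
  shows "vector_space.dim (\<lambda>(c::real) (f::'a \<Rightarrow> real) x. c * f x) V = l"
proof -
  interpret V: vector_space "\<lambda>(c::real) (f::'a \<Rightarrow> real) x. c * f x" by (rule vector_space_real_functions)
  interpret N: vector_space "\<lambda>(c::real) (f::nat \<Rightarrow> real) x. c * f x" by (rule vector_space_real_functions)
  have V_sum: "(\<lambda>x. \<Sum>i\<in>I. a i * b i x) \<in> V \<and> (\<forall>j. T j (\<lambda>x. \<Sum>i\<in>I. a i * b i x) = (\<Sum>i\<in>I. a i * T j (b i)))"
    if "I \<subseteq> {..<l}" for I a
  proof -
    have "finite I" using that finite_subset by blast
    then show ?thesis using that
    proof (induction I rule: finite_induct)
      case empty
      have "T j (\<lambda>x. 0 * (\<lambda>x. 0) x) = 0" for j using T_scale[OF V0, of j 0] by simp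
      then show ?case using V0 by simp
    next
      case (insert i I)
      then have i: "b i \<in> V" using b by auto
      have "(\<lambda>x. a i * b i x) \<in> V" by (rule V_scale[OF i])
      moreover have IH: "(\<lambda>x. \<Sum>i\<in>I. a i * b i x) \<in> V" "\<And>j. T j (\<lambda>x. \<Sum>i\<in>I. a i * b i x) = (\<Sum>i\<in>I. a i * T j (b i))"
        using insert by auto
      ultimately show ?case
        using insert.hyps V_add T_add T_scale[OF i] by simp
    qed
  qed
  define A where "A i = (\<lambda>j. if j < l then T j (b i) else 0)" for i
  define D where "D = (\<lambda>i j. if j = i then 1 else 0 :: real) ` {..<l}"
  have span_D: "f \<in> N.span D" if "\<And>j. j \<ge> l \<Longrightarrow> f j = 0" for f
  proof -
    have "f = (\<Sum>i<l. (\<lambda>j. f i * (if j = i then 1 else 0)))"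
      by (rule ext) (use that in \<open>auto simp: sum_fun_apply not_less if_distrib[of "\<lambda>t. _ * t"] cong: if_cong\<close>)
    moreover have "(\<Sum>i<l. (\<lambda>j. f i * (if j = i then 1 else 0))) \<in> N.span D"
      by (intro N.span_sum N.span_scale N.span_base) (auto simp: D_def)
    ultimately show ?thesis by simp
  qed
  have D: "finite D" "card D \<le> l"
    using card_image_le[of "{..<l}" "\<lambda>i j. if j = i then 1 else 0 :: real"] by (simp_all add: D_def)
  have A_indep: "\<forall>i<l. a i = 0" if "\<And>j. (\<Sum>i<l. a i * A i j) = 0" for a
  proof -
    have "T j (\<lambda>x. \<Sum>i<l. a i * b i x) = 0" if "j < l" for j
      using V_sum[of "{..<l}" a] \<open>\<And>j. (\<Sum>i<l. a i * A i j) = 0\<close>[of j] that by (simp add: A_def)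
    then have "(\<Sum>i<l. a i * b i x) = 0" for x
      using T_inj[of "\<lambda>x. \<Sum>i<l. a i * b i x"] V_sum[of "{..<l}" a] by blast
    then show ?thesis by (rule indep)
  qed
  have A: "inj_on A {..<l}" "N.independent (A ` {..<l})"
    by (rule independent_familyI, rule A_indep, assumption)+
  have B: "inj_on b {..<l}" "V.independent (b ` {..<l})"
    by (rule independent_familyI, rule indep, assumption)+
  have "V \<subseteq> V.span (b ` {..<l})"
  proof
    fix v assume v: "v \<in> V"
    define \<tau> where "\<tau> = (\<lambda>j. if j < l then T j v else 0)"
    have "\<tau> \<in> N.span (A ` {..<l})"
    proof (rule ccontr)
      assume n: "\<tau> \<notin> N.span (A ` {..<l})"
      then have "N.independent (insert \<tau> (A ` {..<l}))" using A(2) by (simp add: N.independent_insertI)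
      moreover have "insert \<tau> (A ` {..<l}) \<subseteq> N.span D"
        by (auto intro!: span_D simp: \<tau>_def A_def)
      ultimately have "card (insert \<tau> (A ` {..<l})) \<le> card D"
        using N.independent_span_bound[OF D(1)] by blast
      moreover have "\<tau> \<notin> A ` {..<l}" by (rule contrapos_nn[OF n], rule N.span_base)
      ultimately show False using D(2) card_image[OF A(1)] by simp
    qed
    then obtain u where "\<tau> = (\<Sum>w\<in>A ` {..<l}. (\<lambda>x. u w * w x))"
      unfolding N.span_finite[OF finite_imageI[OF finite_lessThan]] by auto
    then have u: "\<tau> j = (\<Sum>i<l. u (A i) * A i j)" for j
      by (simp add: sum_fun_apply sum.reindex[OF A(1)])
    let ?s = "\<lambda>x. \<Sum>i<l. u (A i) * b i x"
    have s: "?s \<in> V" "\<And>j. T j ?s = (\<Sum>i<l. u (A i) * T j (b i))" using V_sum[of "{..<l}" "\<lambda>i. u (A i)"] by auto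
    have d: "(\<lambda>x. (-1) * ?s x) \<in> V" by (rule V_scale[OF s(1)])
    have "T j (\<lambda>x. v x + (-1) * ?s x) = 0" if "j < l" for j
      using T_add[OF v d, of j] T_scale[OF s(1), of j "-1"] s(2)[of j] u[of j] that by (simp add: \<tau>_def A_def)
    then have "v x + (-1) * ?s x = 0" for x
      using T_inj[OF V_add[OF v d]] by blast
    then have "v = (\<Sum>i<l. (\<lambda>x. u (A i) * b i x))" by (auto simp: fun_eq_iff sum_fun_apply)
    moreover have "(\<Sum>i<l. (\<lambda>x. u (A i) * b i x)) \<in> V.span (b ` {..<l})"
      by (intro V.span_sum V.span_scale V.span_base) simp
    ultimately show "v \<in> V.span (b ` {..<l})" by simp
  qed
  then show ?thesis
    using V.dim_unique[of "b ` {..<l}" V l] b B card_image[OF B(1)] by auto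
qed

lemma moment_recursion_step:
  assumes u: "u \<in> dirichlet_eigenspace \<mu>"
    and prev: "j > 0 \<Longrightarrow> moment u (\<lambda>x. planar c m x * (x $ 3) ^ (2 * (j - 1) + 1)) = 0"
    and ne: "\<mu> \<noteq> real (m + (2 * j + 1)) * (real (m + (2 * j + 1)) + 1)"
  shows "moment u (\<lambda>x. planar c m x * (x $ 3) ^ (2 * j + 1)) = 0"
proof -
  have "real (2 * j * Suc (2 * j)) * moment u (\<lambda>x. planar c m x * (x $ 3) ^ (2 * j - 1)) = 0"
  proof (cases j)
    case (Suc i)
    then have "2 * j - 1 = 2 * (j - 1) + 1" by simp
    then show ?thesis using prev Suc by (simp only: mult_zero_right)
  qed simp
  then have "(\<mu> - real (m + Suc (2 * j)) * (real (m + Suc (2 * j)) + 1)) * moment u (\<lambda>x. planar c m x * (x $ 3) ^ Suc (2 * j)) = 0"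
    using moment_recursion[OF u, of m "2 * j" c] by (simp only: add_0_right)
  then show ?thesis using ne by (simp only: mult_eq_0_iff Suc_eq_plus1 right_minus_eq) blast
qed

text \<open>Induction on \<open>j\<close> along the recursion: away from resonance the factor \<open>\<mu> - d (d + 1)\<close> can be cancelled.\<close>
lemma eigenfunction_eq_0_if_resonant_moments_0:
  assumes u: "u \<in> dirichlet_eigenspace \<mu>"
    and res: "\<And>c m j. \<mu> = real (m + (2 * j + 1)) * (real (m + (2 * j + 1)) + 1) \<Longrightarrow>
      moment u (\<lambda>x. planar c m x * (x $ 3) ^ (2 * j + 1)) = 0"
  shows "u x = 0"
proof (rule eigenfunction_eq_0_if_moments_0[OF u])
  fix c m j
  show "moment u (\<lambda>x. planar c m x * (x $ 3) ^ (2 * j + 1)) = 0"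
  proof (induction j)
    case 0
    show ?case using moment_recursion_step[OF u, of 0 c m] res[of m 0 c] by blast
  next
    case (Suc j)
    have "Suc j - 1 = j" by simp
    then show ?case
      using moment_recursion_step[OF u, of "Suc j" c m] res[of m "Suc j" c] Suc.IH by metis
  qed
qed

lemma eigenvalue_form:
  assumes u: "u \<in> dirichlet_eigenspace \<mu>" and "u x \<noteq> 0"
  obtains l :: nat where "l \<noteq> 0" "\<mu> = real l * (real l + 1)"
proof -
  have "\<exists>m j :: nat. \<mu> = real (m + (2 * j + 1)) * (real (m + (2 * j + 1)) + 1)"
    using eigenfunction_eq_0_if_resonant_moments_0[OF u] assms(2) by blast
  then obtain m j :: nat where "\<mu> = real (m + (2 * j + 1)) * (real (m + (2 * j + 1)) + 1)" by blast
  then show ?thesis by (intro that[of "m + (2 * j + 1)"]) simp_all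
qed

text \<open>A single integer index covers both families: \<open>Re (\<omega>\<^sup>n)\<close> for \<open>n \<ge> 0\<close> and \<open>Im (\<omega>\<^bsup>-n\<^esup>)\<close> for \<open>n < 0\<close>.\<close>
definition angular :: "int \<Rightarrow> real^3 \<Rightarrow> real" where
  "angular n = planar (if n \<ge> 0 then 1 else - \<i>) (nat \<bar>n\<bar>)"

text \<open>For \<open>i < l\<close> these are the \<open>l\<close> integers \<open>l - 1, l - 3, \<dots>, 1 - l\<close>, that is, the \<open>n\<close> with \<open>|n| < l\<close> and
\<open>l - |n|\<close> odd.\<close>
definition azimuthal :: "nat \<Rightarrow> nat \<Rightarrow> int" where
  "azimuthal l i = int l - 1 - 2 * int i"

definition resonant_moment :: "nat \<Rightarrow> nat \<Rightarrow> (real^3 \<Rightarrow> real) \<Rightarrow> real" where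
  "resonant_moment l i u = moment u (\<lambda>x. angular (azimuthal l i) x * (x $ 3) ^ (l - nat \<bar>azimuthal l i\<bar>))"

lemma planar_decompose: "planar c m x = Re c * planar 1 m x + (- Im c) * planar (- \<i>) m x"
proof -
  have "c = of_real (Re c) * 1 + of_real (- Im c) * (- \<i>)" by (simp add: complex_eq_iff)
  then show ?thesis by (metis planar_add planar_of_real_mult)
qed

lemma continuous_on_angular: "continuous_on S (angular n)"
  unfolding angular_def by (rule continuous_on_planar)

lemma moment_scale: "moment u (\<lambda>x. r * f x) = r * moment u f"
proof -
  have "(\<lambda>y. radial_extension u y * (r * f (y /\<^sub>R norm y)) * (bump (y \<bullet> y) / (y \<bullet> y)))
    = (\<lambda>y. r * (radial_extension u y * f (y /\<^sub>R norm y) * (bump (y \<bullet> y) / (y \<bullet> y))))"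
    by (rule ext) (simp only: ac_simps)
  then show ?thesis unfolding moment_def by (simp only: integral_mult_right_zero)
qed

lemma eigenvalue_inj:
  assumes "real d * (real d + 1) = real l * (real l + 1)"
  shows "d = l"
proof -
  have "real (d * (d + 1)) = real (l * (l + 1))" using assms by (simp add: algebra_simps)
  then have e: "d * (d + 1) = l * (l + 1)" by (simp only: of_nat_eq_iff)
  show ?thesis
  proof (rule ccontr)
    assume "d \<noteq> l"
    then consider "d < l" | "l < d" by linarith
    then show False
    proof cases
      case 1
      then have "d * (d + 1) < l * (l + 1)" by (intro mult_strict_mono) auto
      then show False using e by simp
    next
      case 2
      then have "l * (l + 1) < d * (d + 1)" by (intro mult_strict_mono) auto
      then show False using e by simp
    qed
  qed
qed

lemma resonant_moments_separate:
  assumes u: "u \<in> dirichlet_eigenspace (real l * (real l + 1))"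
    and res: "\<And>i. i < l \<Longrightarrow> resonant_moment l i u = 0"
  shows "u x = 0"
proof (rule eigenfunction_eq_0_if_resonant_moments_0[OF u])
  fix c m j
  assume "real l * (real l + 1) = real (m + (2 * j + 1)) * (real (m + (2 * j + 1)) + 1)"
  then have l: "m + (2 * j + 1) = l" using eigenvalue_inj by metis
  have k: "l - m = 2 * j + 1" using l by simp
  have "azimuthal l j = int m" using l by (simp add: azimuthal_def)
  then have 1: "moment u (\<lambda>x. planar 1 m x * (x $ 3) ^ (2 * j + 1)) = 0"
    using res[of j] l k by (simp add: resonant_moment_def angular_def)
  have 2: "moment u (\<lambda>x. planar (- \<i>) m x * (x $ 3) ^ (2 * j + 1)) = 0"
  proof (cases "m = 0")
    case True
    then show ?thesis by (simp add: planar_def moment_def)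
  next
    case False
    have "azimuthal l (l - 1 - j) = - int m" using l by (simp add: azimuthal_def of_nat_diff)
    then show ?thesis
      using res[of "l - 1 - j"] l k False by (simp add: resonant_moment_def angular_def)
  qed
  let ?f = "\<lambda>c x. planar c m x * (x $ 3) ^ (2 * j + 1)"
  have c: "continuous_on closed_hemisphere (\<lambda>x. r * ?f c x)" for r c
    by (intro continuous_on_mult continuous_on_const continuous_on_planar continuous_on_power continuous_on_component continuous_on_id)
  have "?f c = (\<lambda>x. Re c * ?f 1 x + (- Im c) * ?f (- \<i>) x)"
    by (rule ext) (subst planar_decompose, simp only: distrib_right mult.assoc)
  then show "moment u (?f c) = 0"
    using moment_add[OF u c c, of "Re c" 1 "- Im c" "- \<i>"] by (simp only: moment_scale 1 2 mult_zero_right add_0_right)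
qed

lemma radial_extension_linear:
  "radial_extension (\<lambda>x. u x + v x) = (\<lambda>y. radial_extension u y + radial_extension v y)"
  "radial_extension (\<lambda>x. r * u x) = (\<lambda>y. r * radial_extension u y)"
  by (simp_all add: radial_extension_def fun_eq_iff)

lemma hemisphere_subset: "hemisphere \<subseteq> upper_half_space"
  by (auto simp: hemisphere_def upper_half_space_def)

lemma zero_in_eigenspace: "(\<lambda>x. 0) \<in> dirichlet_eigenspace \<mu>"
  by (auto simp: dirichlet_eigenspace_def C2_on_hemisphere_def radial_extension_def[abs_def] sphere_laplacian_def
    laplacian_const upper_half_space_def[symmetric] intro: C2_on_const open_upper_half_space)

lemma eigenspace_add:
  assumes "u \<in> dirichlet_eigenspace \<mu>" "v \<in> dirichlet_eigenspace \<mu>"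
  shows "(\<lambda>x. u x + v x) \<in> dirichlet_eigenspace \<mu>"
proof -
  note C = C2_on_add[OF open_upper_half_space radial_extension_C2[OF assms(1)] radial_extension_C2[OF assms(2)]]
  have "- sphere_laplacian (\<lambda>x. u x + v x) x = \<mu> * (u x + v x)" if x: "x \<in> hemisphere" for x
  proof -
    have "- sphere_laplacian u x = \<mu> * u x" "- sphere_laplacian v x = \<mu> * v x"
      using assms x by (auto simp: dirichlet_eigenspace_def)
    moreover have "sphere_laplacian (\<lambda>x. u x + v x) x = sphere_laplacian u x + sphere_laplacian v x"
      unfolding sphere_laplacian_def radial_extension_linear by (rule C(2)) (use x hemisphere_subset in auto)
    ultimately show ?thesis by (simp add: distrib_left)
  qed
  moreover have "C2_on_hemisphere (\<lambda>x. u x + v x)"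
    unfolding C2_on_hemisphere_def radial_extension_linear upper_half_space_def[symmetric] by (rule C(1))
  ultimately show ?thesis
    using assms by (auto simp: dirichlet_eigenspace_def intro!: continuous_on_add)
qed

lemma eigenspace_scale:
  assumes "u \<in> dirichlet_eigenspace \<mu>"
  shows "(\<lambda>x. r * u x) \<in> dirichlet_eigenspace \<mu>"
proof -
  note C = C2_on_mult[OF open_upper_half_space C2_on_const[OF open_upper_half_space, of r] radial_extension_C2[OF assms(1)]]
  have "- sphere_laplacian (\<lambda>x. r * u x) x = \<mu> * (r * u x)" if x: "x \<in> hemisphere" for x
  proof -
    have "- sphere_laplacian u x = \<mu> * u x" using assms x by (auto simp: dirichlet_eigenspace_def)
    moreover have "x \<in> upper_half_space" using x hemisphere_subset by auto
    then have "sphere_laplacian (\<lambda>x. r * u x) x = r * sphere_laplacian u x"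
      unfolding sphere_laplacian_def radial_extension_linear by (simp add: C(2) partial_const laplacian_const)
    ultimately show ?thesis by (metis mult.left_commute mult_minus_right)
  qed
  moreover have "C2_on_hemisphere (\<lambda>x. r * u x)"
    unfolding C2_on_hemisphere_def radial_extension_linear upper_half_space_def[symmetric] by (rule C(1))
  ultimately show ?thesis
    using assms by (auto simp: dirichlet_eigenspace_def intro!: continuous_on_mult continuous_on_const)
qed

lemma resonant_moment_add:
  assumes "u \<in> dirichlet_eigenspace \<mu>" "v \<in> dirichlet_eigenspace \<mu>"
  shows "resonant_moment l i (\<lambda>x. u x + v x) = resonant_moment l i u + resonant_moment l i v"
proof -
  have c: "continuous_on closed_hemisphere (\<lambda>x. angular (azimuthal l i) x * (x $ 3) ^ (l - nat \<bar>azimuthal l i\<bar>))"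
    by (intro continuous_intros continuous_on_angular)
  show ?thesis
    unfolding resonant_moment_def moment_def radial_extension_linear
    by (subst Bochner_Integration.integral_add[symmetric, OF moment_integrable[OF assms(1) c] moment_integrable[OF assms(2) c]])
      (simp only: distrib_right)
qed

lemma resonant_moment_scale: "resonant_moment l i (\<lambda>x. r * u x) = r * resonant_moment l i u"
  unfolding resonant_moment_def moment_def radial_extension_linear
  by (simp only: mult.assoc integral_mult_right_zero)

section \<open>Explicit eigenfunctions\<close>

text \<open>The function is homogeneous of degree zero, so on the unit sphere its Laplacian is the spherical
Laplacian of \<open>planar c m x \<cdot> x\<^sub>3\<^sup>p\<close>.\<close>
lemma laplacian_homogeneous_term:
  fixes m p :: nat
  defines "d \<equiv> real m + real p"
  shows "C2_on upper_half_space (\<lambda>y. planar c m y * ((y $ 3) ^ p * (y \<bullet> y) powr (- d / 2)))"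
    and "norm x = 1 \<Longrightarrow> x \<in> upper_half_space \<Longrightarrow>
      laplacian (\<lambda>y. planar c m y * ((y $ 3) ^ p * (y \<bullet> y) powr (- d / 2))) x
      = planar c m x * (real p * real (p - 1) * (x $ 3) ^ (p - 2) - d * (d + 1) * (x $ 3) ^ p)"
proof -
  have A: "((\<lambda>z::real. z ^ p) has_real_derivative real p * z ^ (p - 1)) (at z)" for z
    using DERIV_pow[of p z UNIV] by simp
  have A1: "((\<lambda>z::real. real p * z ^ (p - 1)) has_real_derivative real p * (real (p - 1) * z ^ (p - 2))) (at z)" for z
    using DERIV_cmult[OF DERIV_pow[of "p - 1" z UNIV], of "real p"] by (simp add: numeral_2_eq_2)
  have A2: "continuous_on UNIV (\<lambda>z::real. real p * (real (p - 1) * z ^ (p - 2)))"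
    by (intro continuous_intros)
  define q where "q b s = s powr b" for b s :: real
  have q: "(q b has_real_derivative b * q (b - 1) s) (at s)" if "s > 0" for b s
    unfolding q_def using that by (auto intro!: derivative_eq_intros simp: powr_diff)
  have B: "\<forall>s>0. (q (- d / 2) has_real_derivative - d / 2 * q (- d / 2 - 1) s) (at s)"
    using q by blast
  have B1: "\<forall>s>0. ((\<lambda>s. - d / 2 * q (- d / 2 - 1) s) has_real_derivative - d / 2 * ((- d / 2 - 1) * q (- d / 2 - 1 - 1) s)) (at s)"
    by (intro allI impI DERIV_cmult q)
  have B2: "continuous_on {0<..} (\<lambda>s. - d / 2 * ((- d / 2 - 1) * q (- d / 2 - 1 - 1) s))"
    unfolding q_def by (intro continuous_intros) auto
  have V0: "0 \<notin> upper_half_space" by (simp add: upper_half_space_def)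
  note L = laplacian_planar_axial_radial[OF A A1 A2 B B1 B2 open_upper_half_space V0, where c=c and m=m]
  show "C2_on upper_half_space (\<lambda>y. planar c m y * ((y $ 3) ^ p * (y \<bullet> y) powr (- d / 2)))"
    using L(1) unfolding q_def .
  assume n: "norm x = 1" and x: "x \<in> upper_half_space"
  have s: "x \<bullet> x = 1" using n by (simp add: norm_eq_1)
  have q1: "q b 1 = 1" for b by (simp add: q_def)
  have z: "x $ 3 * (real p * (x $ 3) ^ (p - 1)) = real p * (x $ 3) ^ p" by (cases p) simp_all
  have "laplacian (\<lambda>y. planar c m y * ((y $ 3) ^ p * q (- d / 2) (y \<bullet> y))) x =
     planar c m x * (real p * (real (p - 1) * (x $ 3) ^ (p - 2)) + 4 * (x $ 3 * (real p * (x $ 3) ^ (p - 1))) * (- d / 2)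
       + (x $ 3) ^ p * ((6 + 4 * real m) * (- d / 2) + 4 * (- d / 2 * (- d / 2 - 1))))"
    using L(2)[OF x] unfolding s q1 by (simp only: mult_1_right mult.assoc)
  also have "\<dots> = planar c m x * (real p * real (p - 1) * (x $ 3) ^ (p - 2) - d * (d + 1) * (x $ 3) ^ p)"
    unfolding z d_def by (simp add: field_simps)
  finally show "laplacian (\<lambda>y. planar c m y * ((y $ 3) ^ p * (y \<bullet> y) powr (- d / 2))) x
      = planar c m x * (real p * real (p - 1) * (x $ 3) ^ (p - 2) - d * (d + 1) * (x $ 3) ^ p)"
    unfolding q_def .
qed

text \<open>Coefficients of the odd power series solution, normalised to start with \<open>t\<close>, of the equation that
\<open>F\<close> has to satisfy for \<open>Re (c \<omega>\<^sup>m) F(x\<^sub>3)\<close> to be an eigenfunction for \<open>l (l + 1)\<close>. If \<open>l - m\<close> is odd, the series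
breaks off after the power \<open>t\<^bsup>l-m\<^esup>\<close> because the next numerator vanishes; it is a multiple of the \<open>m\<close>-th
derivative of the Legendre polynomial of degree \<open>l\<close>.\<close>
fun latitude_coeff :: "nat \<Rightarrow> nat \<Rightarrow> nat \<Rightarrow> real" where
  "latitude_coeff l m 0 = 1"
| "latitude_coeff l m (Suc j) =
    (real (m + (2 * j + 1)) * (real (m + (2 * j + 1)) + 1) - real l * (real l + 1))
      / (real (2 * j + 3) * real (2 * j + 2)) * latitude_coeff l m j"

definition latitude :: "nat \<Rightarrow> nat \<Rightarrow> real \<Rightarrow> real" where
  "latitude l m t = (\<Sum>j\<le>(l - m - 1) div 2. latitude_coeff l m j * t ^ (2 * j + 1))"

definition harmonic :: "nat \<Rightarrow> nat \<Rightarrow> real^3 \<Rightarrow> real" where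
  "harmonic l i x = (if x \<in> closed_hemisphere
     then angular (azimuthal l i) x * latitude l (nat \<bar>azimuthal l i\<bar>) (x $ 3) else 0)"

text \<open>By the definition of the coefficients the left-hand side plus \<open>l (l + 1)\<close> times the series telescopes.
The lower boundary term vanishes because the series starts with \<open>t\<close>, the upper one because it breaks off.\<close>
lemma latitude_equation:
  assumes "l = m + (2 * J + 1)"
  shows "(\<Sum>j\<le>J. latitude_coeff l m j *
     (real (2 * j + 1) * real (2 * j) * t ^ (2 * j - 1)
       - real (m + (2 * j + 1)) * (real (m + (2 * j + 1)) + 1) * t ^ (2 * j + 1)))
    = - (real l * (real l + 1)) * (\<Sum>j\<le>J. latitude_coeff l m j * t ^ (2 * j + 1))"
proof -
  \<comment> \<open>The contribution of the second derivative of the \<open>j\<close>-th term; by the recursion it cancels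
     against the remaining contributions of the term before.\<close>
  define e where "e j = latitude_coeff l m j * (real (2 * j + 1) * real (2 * j) * t ^ (2 * j - 1))" for j
  let ?d = "\<lambda>j. real (m + (2 * j + 1)) * (real (m + (2 * j + 1)) + 1)"
  have e_Suc: "e (Suc j) = (?d j - real l * (real l + 1)) * (latitude_coeff l m j * t ^ (2 * j + 1))" for j
  proof -
    have n: "real (2 * Suc j + 1) = real (2 * j + 3)" "real (2 * Suc j) = real (2 * j + 2)" "2 * Suc j - 1 = 2 * j + 1"
      by simp_all
    have nz: "real (2 * j + 3) * real (2 * j + 2) \<noteq> 0" by (simp only: mult_eq_0_iff of_nat_eq_0_iff) simp
    have "e (Suc j) = (real (2 * j + 3) * real (2 * j + 2)) * latitude_coeff l m (Suc j) * t ^ (2 * j + 1)"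
      unfolding e_def n by (simp only: ac_simps)
    also have "(real (2 * j + 3) * real (2 * j + 2)) * latitude_coeff l m (Suc j)
      = (?d j - real l * (real l + 1)) * latitude_coeff l m j"
    proof -
      have "N * (X / N * a) = X * a" if "N \<noteq> 0" for N X a :: real using that by simp
      then show ?thesis unfolding latitude_coeff.simps using nz .
    qed
    finally show ?thesis by (simp only: mult.assoc)
  qed
  have "(\<Sum>j\<le>J. e j - e (Suc j)) = e 0 - e (Suc J)" by (rule sum_telescope)
  moreover have "e 0 = 0" by (simp add: e_def)
  moreover have "e (Suc J) = 0" unfolding e_Suc by (simp add: assms)
  ultimately have "(\<Sum>j\<le>J. e j - e (Suc j)) = 0" by simp
  then have "0 = (\<Sum>j\<le>J. latitude_coeff l m j *
     (real (2 * j + 1) * real (2 * j) * t ^ (2 * j - 1) - ?d j * t ^ (2 * j + 1))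
     + real l * (real l + 1) * (latitude_coeff l m j * t ^ (2 * j + 1)))"
    unfolding e_Suc unfolding e_def by (simp only: left_diff_distrib right_diff_distrib) (simp only: ac_simps diff_diff_eq2 add_diff_eq diff_add_eq)
  then show ?thesis by (simp only: sum.distrib sum_distrib_left mult_minus_left sum_negf)
qed

lemma azimuthal_abs:
  assumes "i < l"
  obtains J where "l = nat \<bar>azimuthal l i\<bar> + (2 * J + 1)"
proof (cases "azimuthal l i \<ge> 0")
  case True
  then show ?thesis using assms that[of i] by (simp add: azimuthal_def nat_eq_iff)
next
  case False
  then show ?thesis using assms that[of "l - 1 - i"] by (simp add: azimuthal_def nat_eq_iff of_nat_diff)
qed

text \<open>The extension constant along rays is a sum of terms homogeneous of degree zero, to which
\<open>laplacian_homogeneous_term\<close> applies; \<open>latitude_equation\<close> sums up the result. The boundary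
condition holds because the latitude factor is odd.\<close>
lemma harmonic_in_eigenspace:
  assumes i: "i < l"
  shows "harmonic l i \<in> dirichlet_eigenspace (real l * (real l + 1))"
proof -
  define n where "n = azimuthal l i"
  define m where "m = nat \<bar>n\<bar>"
  obtain J where J: "l = m + (2 * J + 1)" using azimuthal_abs[OF i] unfolding m_def n_def .
  define c where "c = (if n \<ge> 0 then 1 else - \<i>)"
  have ang: "angular n = planar c m" by (simp add: angular_def c_def m_def)
  have lat: "latitude l m t = (\<Sum>j\<le>J. latitude_coeff l m j * t ^ (2 * j + 1))" for t
    by (simp add: latitude_def J)
  let ?h = "harmonic l i"
  have h: "?h x = (if x \<in> closed_hemisphere then planar c m x * latitude l m (x $ 3) else 0)" for x
    unfolding harmonic_def n_def[symmetric] m_def[symmetric] ang ..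
  let ?d = "\<lambda>j. real m + real (2 * j + 1)"
  define f where "f j y = latitude_coeff l m j * (planar c m y * ((y $ 3) ^ (2 * j + 1) * (y \<bullet> y) powr (- ?d j / 2)))" for j y
  have ext: "(\<Sum>j\<le>J. f j y) = radial_extension ?h y" if y: "y \<in> upper_half_space" for y
  proof -
    have y0: "norm y > 0" using y by (auto simp: upper_half_space_def)
    then have "y /\<^sub>R norm y \<in> closed_hemisphere" using y by (simp add: closed_hemisphere_def upper_half_space_def)
    then have "radial_extension ?h y = planar c m (y /\<^sub>R norm y) * latitude l m ((y /\<^sub>R norm y) $ 3)"
      by (simp add: radial_extension_def h)
    also have "\<dots> = (\<Sum>j\<le>J. f j y)"
      unfolding lat sum_distrib_left
    proof (rule sum.cong[OF refl])
      fix j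
      have "(y \<bullet> y) powr (- ?d j / 2) = (norm y powr 2) powr (- ?d j / 2)"
        using y0 by (simp add: power2_norm_eq_inner[symmetric])
      also have "\<dots> = norm y powr (- real (m + (2 * j + 1)))"
      proof -
        have e: "2 * (- ?d j / 2) = - real (m + (2 * j + 1))" by (simp add: field_simps)
        show ?thesis unfolding powr_powr e ..
      qed
      also have "\<dots> = inverse (norm y) ^ m * inverse (norm y) ^ (2 * j + 1)"
        by (simp only: powr_minus powr_realpow[OF y0] power_add inverse_mult_distrib power_inverse)
      finally show "planar c m (y /\<^sub>R norm y) * (latitude_coeff l m j * (y /\<^sub>R norm y) $ 3 ^ (2 * j + 1)) = f j y"
        unfolding f_def planar_scale vector_scaleR_component real_scaleR_def power_mult_distrib by (simp only: ac_simps)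
    qed
    finally show ?thesis by simp
  qed
  have fC: "C2_on upper_half_space (f j)" for j
    unfolding f_def by (rule C2_on_mult(1)[OF open_upper_half_space C2_on_const[OF open_upper_half_space] laplacian_homogeneous_term(1)])
  have fL: "laplacian (f j) x = planar c m x * (latitude_coeff l m j *
     (real (2 * j + 1) * real (2 * j) * (x $ 3) ^ (2 * j - 1)
       - real (m + (2 * j + 1)) * (real (m + (2 * j + 1)) + 1) * (x $ 3) ^ (2 * j + 1)))"
    if x: "norm x = 1" "x \<in> upper_half_space" for j x
  proof -
    have n: "2 * j + 1 - 1 = 2 * j" "2 * j + 1 - 2 = 2 * j - 1" by simp_all
    have "laplacian (f j) x = latitude_coeff l m j *
      (planar c m x * (real (2 * j + 1) * real (2 * j) * (x $ 3) ^ (2 * j - 1) - ?d j * (?d j + 1) * (x $ 3) ^ (2 * j + 1)))"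
      using C2_on_mult(2)[OF open_upper_half_space C2_on_const[OF open_upper_half_space, of "latitude_coeff l m j"]
          laplacian_homogeneous_term(1)[of c m "2 * j + 1"] x(2)]
        laplacian_homogeneous_term(2)[OF x, of c m "2 * j + 1"]
      unfolding f_def n by (simp only: laplacian_const partial_const mult_zero_left sum.neutral_const mult_zero_right add_0_right)
    then show ?thesis by (simp only: of_nat_add[of m] mult.left_commute)
  qed
  note S = C2_on_sum[where f = f and J = "{..J}", OF open_upper_half_space finite_atMost fC]
  have C2: "C2_on upper_half_space (radial_extension ?h)"
    by (rule C2_on_cong(1)[OF open_upper_half_space conjunct1[OF S] ext])
  have L: "- sphere_laplacian ?h x = real l * (real l + 1) * ?h x" if x: "x \<in> hemisphere" for x
  proof -
    have x': "norm x = 1" "x \<in> upper_half_space" "x \<in> closed_hemisphere"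
      using x by (auto simp: hemisphere_def upper_half_space_def closed_hemisphere_def)
    have "sphere_laplacian ?h x = laplacian (\<lambda>y. \<Sum>j\<le>J. f j y) x"
      unfolding sphere_laplacian_def
      by (rule C2_on_cong(2)[OF open_upper_half_space conjunct1[OF S] ext x'(2), symmetric])
    also have "\<dots> = (\<Sum>j\<le>J. laplacian (f j) x)" using S x'(2) by blast
    also have "\<dots> = planar c m x * (- (real l * (real l + 1)) * latitude l m (x $ 3))"
      unfolding fL[OF x'(1,2)] sum_distrib_left[symmetric] latitude_equation[OF J] lat ..
    finally show ?thesis using x'(3) by (simp add: h)
  qed
  have c: "continuous_on closed_hemisphere ?h"
  proof (rule continuous_on_eq)
    show "continuous_on closed_hemisphere (\<lambda>x. planar c m x * latitude l m (x $ 3))"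
      unfolding lat by (intro continuous_intros continuous_on_planar)
  qed (simp add: h)
  have e: "?h x = 0" if "x \<in> equator" for x
    using that by (simp add: h lat equator_def)
  show ?thesis
    using C2 L c e by (simp add: dirichlet_eigenspace_def C2_on_hemisphere_def upper_half_space_def h)
qed

section \<open>Eigenvalues and multiplicities\<close>

lemma infinite_unit_circle: "infinite (sphere (0::complex) 1)"
proof
  assume "finite (sphere (0::complex) 1)"
  moreover have "connected (sphere (0::complex) 1)" by (rule connected_sphere) simp
  moreover have 1: "(1::complex) \<in> sphere 0 1" by (simp only: mem_sphere dist_0_norm norm_one)
  ultimately obtain w where w: "sphere (0::complex) 1 = {w}"
    using connected_finite_iff_sing by blast
  have "(-1::complex) \<in> sphere 0 1" by (simp only: mem_sphere dist_0_norm norm_one norm_minus_cancel)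
  then have "(-1::complex) = w" unfolding w by (simp only: singleton_iff)
  moreover have "(1::complex) = w" using 1 unfolding w by (simp only: singleton_iff)
  ultimately have "(1::complex) = -1" by (simp only:)
  then show False by simp
qed

text \<open>Twice the real part of a polynomial expression in \<open>\<omega>\<close> is a Laurent polynomial on the unit circle.
After multiplication by \<open>\<omega>\<^sup>l\<close> it is a polynomial with infinitely many zeros, so its coefficients
vanish; the coefficient at \<open>\<omega>\<^bsup>l+m\<^esup>\<close> isolates the terms with \<open>|n| = m\<close>, and its real and
imaginary parts separate these.\<close>
lemma trigonometric_independence:
  fixes a :: "nat \<Rightarrow> real"
  assumes "\<And>\<omega>. cmod \<omega> = 1 \<Longrightarrow>
     (\<Sum>i<l. a i * Re ((if azimuthal l i \<ge> 0 then 1 else - \<i>) * \<omega> ^ nat \<bar>azimuthal l i\<bar>)) = 0"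
  shows "\<forall>i<l. a i = 0"
proof (intro allI impI)
  fix k assume k: "k < l"
  define c where "c i = (if azimuthal l i \<ge> 0 then 1 else - \<i>)" for i
  define m where "m i = nat \<bar>azimuthal l i\<bar>" for i
  have m_le: "m i \<le> l" if "i < l" for i using that by (auto simp: m_def azimuthal_def)
  define p where "p = (\<Sum>i<l. smult (of_real (a i)) (monom (c i) (l + m i) + monom (cnj (c i)) (l - m i)))"
  have root: "poly p \<omega> = 0" if \<omega>: "cmod \<omega> = 1" for \<omega>
  proof -
    have inv: "\<omega> ^ (l - m i) = \<omega> ^ l * cnj \<omega> ^ m i" if "i < l" for i
    proof -
      have "\<omega> * cnj \<omega> = 1" using complex_norm_square[of \<omega>] \<omega> by simp
      then have "\<omega> ^ m i * cnj \<omega> ^ m i = 1" by (metis power_mult_distrib power_one)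
      moreover have "\<omega> ^ l = \<omega> ^ (l - m i) * \<omega> ^ m i" using m_le[OF that] by (simp add: power_add[symmetric])
      ultimately show ?thesis by (simp add: mult.assoc)
    qed
    have "poly p \<omega> = (\<Sum>i<l. of_real (a i) * (c i * \<omega> ^ (l + m i) + cnj (c i) * \<omega> ^ (l - m i)))"
      by (simp add: p_def poly_sum poly_monom)
    also have "\<dots> = (\<Sum>i<l. \<omega> ^ l * (of_real (a i) * (c i * \<omega> ^ m i + cnj (c i * \<omega> ^ m i))))"
      by (rule sum.cong[OF refl]) (simp add: inv power_add algebra_simps)
    also have "\<dots> = \<omega> ^ l * (\<Sum>i<l. of_real (2 * (a i * Re (c i * \<omega> ^ m i))))"
      unfolding sum_distrib_left complex_add_cnj by (simp add: algebra_simps)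
    also have "(\<Sum>i<l. of_real (2 * (a i * Re (c i * \<omega> ^ m i)))) = (of_real (2 * (\<Sum>i<l. a i * Re (c i * \<omega> ^ m i))) :: complex)"
      by (simp only: of_real_sum sum_distrib_left)
    also have "(\<Sum>i<l. a i * Re (c i * \<omega> ^ m i)) = 0"
      using assms[OF \<omega>] unfolding c_def m_def .
    finally show ?thesis by simp
  qed
  have "p = 0"
  proof (rule ccontr)
    assume "p \<noteq> 0"
    then have "finite (sphere (0::complex) 1)"
      using poly_roots_finite[of p] root by (auto elim!: finite_subset[rotated])
    then show False using infinite_unit_circle by blast
  qed
  then have co: "(\<Sum>i<l. of_real (a i) * ((if m i = m k then c i else 0) + (if m i = 0 \<and> m k = 0 then cnj (c i) else 0))) = 0"
  proof -
    have "0 = coeff p (l + m k)" using \<open>p = 0\<close> by simp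
    also have "\<dots> = (\<Sum>i<l. of_real (a i) * ((if m i = m k then c i else 0) + (if m i = 0 \<and> m k = 0 then cnj (c i) else 0)))"
      unfolding p_def coeff_sum
      by (rule sum.cong[OF refl]) (use m_le in \<open>auto simp: coeff_monom\<close>)
    finally show ?thesis by simp
  qed
  have inj: "i = k" if "azimuthal l i = azimuthal l k" for i using that by (simp add: azimuthal_def)
  have abs_eq: "\<bar>azimuthal l i\<bar> = \<bar>azimuthal l k\<bar>" if "m i = m k" for i
    using that by (simp add: m_def eq_nat_nat_iff)
  show "a k = 0"
  proof (cases "azimuthal l k \<ge> 0")
    case True
    have "0 = (\<Sum>i<l. a i * ((if m i = m k then Re (c i) else 0) + (if m i = 0 \<and> m k = 0 then Re (c i) else 0)))"
      using arg_cong[OF co, of Re] by (simp add: if_distrib[of Re] cong: if_cong)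
    also have "\<dots> = (\<Sum>i<l. if i = k then a k * (1 + (if m k = 0 then 1 else 0)) else 0)"
    proof (rule sum.cong[OF refl])
      fix i assume "i \<in> {..<l}"
      show "a i * ((if m i = m k then Re (c i) else 0) + (if m i = 0 \<and> m k = 0 then Re (c i) else 0))
        = (if i = k then a k * (1 + (if m k = 0 then 1 else 0)) else 0)"
      proof (cases "i = k")
        case False
        then have "m i = m k \<Longrightarrow> azimuthal l i < 0" using True inj[of i] abs_eq[of i] by (auto simp: abs_if split: if_splits)
        then have "m i = m k \<Longrightarrow> Re (c i) = 0" by (simp add: c_def)
        then show ?thesis using False by auto
      qed (use True in \<open>simp add: c_def\<close>)
    qed
    finally show ?thesis using k by (auto split: if_splits)
  next
    case False
    then have mk: "m k \<noteq> 0" by (simp add: m_def)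
    have "0 = (\<Sum>i<l. a i * (if m i = m k then Im (c i) else 0))"
      using arg_cong[OF co, of Im] mk by (simp add: if_distrib[of Im] cong: if_cong)
    also have "\<dots> = (\<Sum>i<l. if i = k then - a k else 0)"
    proof (rule sum.cong[OF refl])
      fix i assume "i \<in> {..<l}"
      show "a i * (if m i = m k then Im (c i) else 0) = (if i = k then - a k else 0)"
      proof (cases "i = k")
        case ik: False
        then have "m i = m k \<Longrightarrow> azimuthal l i \<ge> 0" using False inj[of i] abs_eq[of i] by (auto simp: abs_if split: if_splits)
        then have "m i = m k \<Longrightarrow> Im (c i) = 0" by (simp add: c_def)
        then show ?thesis using ik by auto
      qed (use False in \<open>simp add: c_def\<close>)
    qed
    finally show ?thesis using k by simp
  qed
qed

lemma latitude_pos_near_0: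
  "\<forall>\<^sub>F t in at_right 0. latitude l m t > 0"
proof -
  define g where "g t = (\<Sum>j\<le>(l - m - 1) div 2. latitude_coeff l m j * t ^ (2 * j))" for t
  have "g 0 = (\<Sum>j\<le>(l - m - 1) div 2. if j = 0 then 1 else 0)"
    unfolding g_def by (rule sum.cong[OF refl]) auto
  then have g0: "g 0 = 1" by simp
  have "continuous_on UNIV g" unfolding g_def[abs_def] by (intro continuous_intros)
  then have "(g \<longlongrightarrow> g 0) (at 0)" by (simp add: continuous_on_def)
  then have "(g \<longlongrightarrow> 1) (at_right 0)" unfolding g0 by (rule filterlim_mono) (auto simp: at_le)
  then have "\<forall>\<^sub>F t in at_right 0. g t > 0" by (rule order_tendstoD(1)) simp
  moreover have "\<forall>\<^sub>F t :: real in at_right 0. t > 0" by (rule eventually_at_right_less)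
  ultimately show ?thesis
  proof eventually_elim
    case (elim t)
    have "latitude l m t = t * g t"
      unfolding latitude_def g_def sum_distrib_left by (rule sum.cong[OF refl]) simp
    then show ?case using elim by simp
  qed
qed

text \<open>All latitude factors are positive at a sufficiently small common height \<open>t\<close>. On the circle of latitude at
that height the functions are nonzero multiples of distinct trigonometric functions.\<close>
lemma harmonic_independent:
  assumes "\<And>x. (\<Sum>i<l. a i * harmonic l i x) = 0"
  shows "\<forall>i<l. a i = 0"
proof -
  let ?m = "\<lambda>i. nat \<bar>azimuthal l i\<bar>"
  have "\<forall>\<^sub>F t in at_right 0. \<forall>i\<in>{..<l}. latitude l (?m i) t > 0"
    by (intro eventually_ball_finite ballI latitude_pos_near_0) simp
  moreover have "\<forall>\<^sub>F t :: real in at_right 0. t \<in> {0<..<1}"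
    by (rule eventually_at_right_real) simp
  ultimately have "\<forall>\<^sub>F t in at_right 0. (\<forall>i\<in>{..<l}. latitude l (?m i) t > 0) \<and> t \<in> {0<..<1}"
    by (rule eventually_conj)
  then obtain t where t: "\<And>i. i < l \<Longrightarrow> latitude l (?m i) t > 0" "0 < t" "t < 1"
    using eventually_happens'[OF trivial_limit_at_right_real] by fastforce
  define \<rho> where "\<rho> = sqrt (1 - t\<^sup>2)"
  have t2: "t\<^sup>2 < 1" using t(2,3) by (simp add: power_less_one_iff)
  then have \<rho>: "\<rho> > 0" "\<rho>\<^sup>2 = 1 - t\<^sup>2" by (simp_all add: \<rho>_def)
  define b where "b i = a i * latitude l (?m i) t * \<rho> ^ ?m i" for i
  have "\<forall>i<l. b i = 0"
  proof (rule trigonometric_independence)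
    fix \<omega> :: complex assume \<omega>: "cmod \<omega> = 1"
    let ?x = "vector [\<rho> * Re \<omega>, \<rho> * Im \<omega>, t] :: real^3"
    have cx: "Complex (?x $ 1) (?x $ 2) = of_real \<rho> * \<omega>" by (simp add: complex_eq_iff)
    have "(Re \<omega>)\<^sup>2 + (Im \<omega>)\<^sup>2 = 1" using \<omega> by (simp add: cmod_def)
    moreover have "?x \<bullet> ?x = \<rho>\<^sup>2 * ((Re \<omega>)\<^sup>2 + (Im \<omega>)\<^sup>2) + t\<^sup>2"
      by (simp add: inner_vec_def sum_3 power2_eq_square algebra_simps)
    ultimately have "?x \<in> closed_hemisphere"
      using \<rho>(2) t(2) by (simp add: closed_hemisphere_def norm_eq_1)
    then have h: "a i * harmonic l i ?x = b i * Re ((if azimuthal l i \<ge> 0 then 1 else - \<i>) * \<omega> ^ ?m i)" for i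
    proof -
      define c :: complex where "c = (if azimuthal l i \<ge> 0 then 1 else - \<i>)"
      have "c * (of_real \<rho> * \<omega>) ^ ?m i = of_real (\<rho> ^ ?m i) * (c * \<omega> ^ ?m i)"
        by (simp only: power_mult_distrib of_real_power ac_simps)
      then have "angular (azimuthal l i) ?x = \<rho> ^ ?m i * Re (c * \<omega> ^ ?m i)"
        unfolding angular_def c_def[symmetric] planar_def cx
        by (simp only: Re_complex_of_real times_complex.sel Im_complex_of_real mult_zero_left diff_zero)
      then show ?thesis
        using \<open>?x \<in> closed_hemisphere\<close> unfolding c_def[symmetric] by (simp add: harmonic_def b_def)
    qed
    then show "(\<Sum>i<l. b i * Re ((if azimuthal l i \<ge> 0 then 1 else - \<i>) * \<omega> ^ ?m i)) = 0"
      using assms[of ?x] by (simp only: h)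
  qed
  then show ?thesis using t(1) \<rho>(1) by (fastforce simp: b_def)
qed

text \<open>The eigenspace contains \<open>l\<close> independent functions and is separated by \<open>l\<close> linear functionals.\<close>
theorem multiplicity_eq: "multiplicity_of (real l * (real l + 1)) = l"
  unfolding multiplicity_of_def
  by (rule dim_eq_if_separating_functionals[where b = "harmonic l" and T = "resonant_moment l"])
    (rule harmonic_in_eigenspace harmonic_independent zero_in_eigenspace eigenspace_add eigenspace_scale
      resonant_moment_add resonant_moment_scale resonant_moments_separate; assumption?; simp)+

theorem dirichlet_eigenvalues_eq:
  "dirichlet_eigenvalues = (\<lambda>l. real l * (real l + 1)) ` {l. l \<noteq> 0}"
proof (intro equalityI subsetI)
  fix \<mu> assume "\<mu> \<in> dirichlet_eigenvalues"
  then obtain u x where "u \<in> dirichlet_eigenspace \<mu>" "u x \<noteq> 0" by (auto simp: dirichlet_eigenvalues_def)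
  then obtain l :: nat where "l \<noteq> 0" "\<mu> = real l * (real l + 1)" by (rule eigenvalue_form)
  then show "\<mu> \<in> (\<lambda>l. real l * (real l + 1)) ` {l. l \<noteq> 0}" by blast
next
  fix \<mu> assume "\<mu> \<in> (\<lambda>l. real l * (real l + 1)) ` {l. l \<noteq> 0}"
  then obtain l :: nat where l: "l \<noteq> 0" "\<mu> = real l * (real l + 1)" by blast
  have "\<exists>x. harmonic l 0 x \<noteq> 0"
  proof (rule ccontr)
    assume "\<nexists>x. harmonic l 0 x \<noteq> 0"
    then have "(\<Sum>i<l. (if i = 0 then 1 else 0) * harmonic l i x) = 0" for x
      by (auto intro!: sum.neutral)
    from harmonic_independent[OF this] show False using l(1) by auto
  qed
  then show "\<mu> \<in> dirichlet_eigenvalues"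
    using harmonic_in_eigenspace[of 0 l] l by (auto simp: dirichlet_eigenvalues_def)
qed

section \<open>The Riesz mean\<close>

lemma riesz_mean_1_sum:
  assumes z: "z \<le> real (Suc L) * (real (Suc L) + 1)" "real L * (real L + 1) \<le> z"
  shows "riesz_mean_1 z = (\<Sum>l\<le>L. real l * (z - real l * (real l + 1)))"
proof -
  let ?e = "\<lambda>l. real l * (real l + 1)"
  have inj: "inj_on ?e {l. l \<noteq> 0}" by (rule inj_onI) (rule eigenvalue_inj)
  have "riesz_mean_1 z = (\<Sum>\<^sub>\<infinity>l\<in>{l. l \<noteq> 0}. real l * max (z - ?e l) 0)"
    unfolding riesz_mean_1_def dirichlet_eigenvalues_eq infsum_reindex[OF inj]
    by (simp only: comp_def multiplicity_eq)
  also have "\<dots> = (\<Sum>\<^sub>\<infinity>l\<in>{..L}. real l * (z - ?e l))"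
  proof (rule infsum_cong_neutral)
    have mono: "?e l \<le> ?e k" if "l \<le> k" for l k using that by (intro mult_mono) auto
    fix l :: nat
    show "real l * max (z - ?e l) 0 = 0" if "l \<in> {l. l \<noteq> 0} - {..L}"
      using that z(1) mono[of "Suc L" l] by auto
    show "real l * (z - ?e l) = 0" if "l \<in> {..L} - {l. l \<noteq> 0}" using that by simp
    show "real l * max (z - ?e l) 0 = real l * (z - ?e l)" if "l \<in> {l. l \<noteq> 0} \<inter> {..L}"
      using that z(2) mono[of l L] by simp
  qed
  also have "\<dots> = (\<Sum>l\<le>L. real l * (z - ?e l))" by simp
  finally show ?thesis .
qed

lemma weighted_level_sum:
  "(\<Sum>l\<le>L. real l * (z - real l * (real l + 1)))
    = real L * (real L + 1) / 2 * z - (real L * (real L + 1))^2 / 4 - real L * (real L + 1) * (2 * real L + 1) / 6"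
proof (induction L)
  case (Suc L)
  have r: "real (Suc L) = real L + 1" by simp
  show ?case unfolding sum.atMost_Suc Suc.IH r by (simp add: field_simps power2_eq_square)
qed simp

text \<open>Substituting \<open>z = (L + 1/2 + x)\<^sup>2 - 1/4\<close> makes everything polynomial in \<open>L\<close> and \<open>x\<close>. The factor
\<open>x (1 - x)\<close> reflects that both sides agree at the two consecutive eigenvalues that enclose \<open>z\<close>.\<close>
lemma riesz_mean_1_deviation:
  fixes L :: nat
  assumes z: "real L * (real L + 1) \<le> z" "z \<le> real (Suc L) * (real (Suc L) + 1)"
  defines "x \<equiv> sqrt (z + 1/4) - (real L + 1/2)"
  shows "0 \<le> x" "x \<le> 1" "z = (real L + 1/2 + x)^2 - 1/4"
    and "riesz_mean_1 z - (1/4 * z^2 - 1/3 * z * sqrt (z + 1/4))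
      = x * (1 - x) * ((real L + 1/2)^2 + (real L + 1/2) * x + x^2 / 4 - x / 12 - 1 / 12)"
proof -
  define a where "a = real L + 1/2"
  define s where "s = sqrt (z + 1/4)"
  have e: "real L = a - 1/2" "real (Suc L) = a + 1/2" by (simp_all add: a_def)
  have a0: "a \<ge> 0" by (simp add: a_def)
  have b: "a^2 \<le> z + 1/4" "z + 1/4 \<le> (a + 1)^2"
    using z unfolding e by (simp_all add: power2_eq_square field_simps)
  have "sqrt (a^2) \<le> s" "s \<le> sqrt ((a + 1)^2)" unfolding s_def using b by (simp_all only: real_sqrt_le_iff)
  then have s: "a \<le> s" "s \<le> a + 1" using a0 by (simp_all add: real_sqrt_abs)
  have "z + 1/4 \<ge> 0" using b(1) by (meson order_trans zero_le_power2)
  then have s2: "s^2 = z + 1/4" by (simp add: s_def)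
  have x: "x = s - a" by (simp add: x_def s_def a_def)
  show "0 \<le> x" "x \<le> 1" using s by (simp_all add: x)
  have zx: "z = (a + x)^2 - 1/4" using s2 by (simp add: x)
  then show "z = (real L + 1/2 + x)^2 - 1/4" by (simp add: a_def)
  have sx: "s = a + x" by (simp add: x)
  have R: "riesz_mean_1 z = (a - 1/2) * (a - 1/2 + 1) / 2 * z - ((a - 1/2) * (a - 1/2 + 1))^2 / 4
      - (a - 1/2) * (a - 1/2 + 1) * (2 * (a - 1/2) + 1) / 6"
    unfolding riesz_mean_1_sum[OF z(2,1)] weighted_level_sum e ..
  show "riesz_mean_1 z - (1/4 * z^2 - 1/3 * z * sqrt (z + 1/4))
      = x * (1 - x) * ((real L + 1/2)^2 + (real L + 1/2) * x + x^2 / 4 - x / 12 - 1 / 12)"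
    unfolding a_def[symmetric] s_def[symmetric] R unfolding sx zx
    by (simp add: field_simps power2_eq_square)
qed

theorem theorem3p2p2:
  fixes z :: real
  assumes "z \<ge> 0"
  shows "(1/4 * z^2 - 1/3 * z * sqrt (z + 1/4) \<le> riesz_mean_1 z \<and>
          riesz_mean_1 z \<le> 1/4 * z^2 - 1/3 * z * sqrt (z + 1/4) + 1/4 * z) \<and>
         (1/4 * z^2 - 1/3 * z * sqrt (z + 1/4) = riesz_mean_1 z \<longleftrightarrow>
          z = 0 \<or> (\<exists>l::nat. l \<noteq> 0 \<and> z = real l * (real l + 1)))"
proof -
  let ?g = "1/4 * z^2 - 1/3 * z * sqrt (z + 1/4)"
  define L where "L = (LEAST n. z < real (Suc n) * (real (Suc n) + 1))"
  have "\<exists>n. z < real (Suc n) * (real (Suc n) + 1)"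
  proof -
    obtain n where "z < real n" using reals_Archimedean2 by blast
    also have "real n \<le> real (Suc n) * (real (Suc n) + 1)" by (simp add: algebra_simps)
    finally show ?thesis by blast
  qed
  then have z2: "z < real (Suc L) * (real (Suc L) + 1)" unfolding L_def by (rule LeastI_ex)
  have z1: "real L * (real L + 1) \<le> z"
  proof (cases L)
    case (Suc n)
    then have "\<not> z < real (Suc n) * (real (Suc n) + 1)"
      using not_less_Least[of n "\<lambda>n. z < real (Suc n) * (real (Suc n) + 1)"] by (simp add: L_def)
    then show ?thesis using Suc by simp
  qed (use assms in simp)
  define x where "x = sqrt (z + 1/4) - (real L + 1/2)"
  define Q where "Q = (real L + 1/2)^2 + (real L + 1/2) * x + x^2 / 4 - x / 12 - 1 / 12"
  note D = riesz_mean_1_deviation[OF z1 less_imp_le[OF z2], folded x_def, folded Q_def]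
  have Q: "Q > 0"
  proof -
    have "Q = (real L)^2 + real L * (1 + x) + (1/6 + 5/12 * x + x^2 / 4)"
      by (simp add: Q_def field_simps power2_eq_square)
    moreover have "(real L)^2 + real L * (1 + x) \<ge> 0" using D(1) by simp
    moreover have "1/6 + 5/12 * x + x^2 / 4 > 0" using D(1) by (simp add: add_pos_nonneg)
    ultimately show ?thesis by linarith
  qed
  have x1: "x < 1"
  proof (rule ccontr)
    assume "\<not> x < 1"
    then have "x = 1" using D(2) by simp
    then show False using D(3) z2 by (simp add: power2_eq_square algebra_simps)
  qed
  have lower: "riesz_mean_1 z - ?g \<ge> 0"
    unfolding D(4) using D(1,2) Q by simp
  have upper: "riesz_mean_1 z - ?g \<le> 1/4 * z"
  proof -
    \<comment> \<open>Expanded in powers of \<open>L\<close>, every coefficient is nonnegative.\<close>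
    have "1/4 * z - x * (1 - x) * Q = ((1 - 2 * x)^2 * (real L)^2
      + real L * ((1 - 2 * x)^2 * (1 + x) + x) + (x / 3 + 2/3 * x^3 + x^4)) / 4"
      unfolding D(3) Q_def by (simp add: field_simps power2_eq_square power3_eq_cube power4_eq_xxxx)
    also have "\<dots> \<ge> 0" using D(1) by simp
    finally show ?thesis unfolding D(4) by simp
  qed
  have "z = real L * (real L + 1)" if "?g = riesz_mean_1 z"
  proof -
    have "x * (1 - x) * Q = 0" using D(4) that by simp
    then have "x = 0" using Q x1 by simp
    then show ?thesis using D(3) by (simp add: power2_eq_square algebra_simps)
  qed
  moreover have "?g = riesz_mean_1 z" if "z = real l * (real l + 1)" for l :: nat
  proof -
    have "z + 1/4 = (real l + 1/2)^2" using that by (simp add: power2_eq_square algebra_simps)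
    then have s: "sqrt (z + 1/4) - (real l + 1/2) = 0" by simp
    have "real l * (real l + 1) \<le> z" "z \<le> real (Suc l) * (real (Suc l) + 1)"
      using that by (simp_all add: algebra_simps)
    from riesz_mean_1_deviation(4)[OF this] show ?thesis unfolding s by simp
  qed
  from this[of 0] this have "?g = riesz_mean_1 z" if "z = 0 \<or> (\<exists>l::nat. l \<noteq> 0 \<and> z = real l * (real l + 1))"
    using that by auto
  ultimately have "?g = riesz_mean_1 z \<longleftrightarrow> z = 0 \<or> (\<exists>l::nat. l \<noteq> 0 \<and> z = real l * (real l + 1))"
    by (cases "L = 0") auto
  then show ?thesis using lower upper by simp
qed

end
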